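(* The square Sierpinski carpet $\mathbb S$ and the cubical Menger sponge $\mathbb M$, each equipped with the metric induced by the Euclidean metric, satisfy the Combinatorial Loewner Property.
   Context: The square Sierpinski carpet $\mathbb S\subset[0,1]^2$ is obtained from the unit square by subdividing it into nine equal subsquares, removing the open middle square, and repeating this inductively on the remaining squares. The cubical Menger sponge is $\mathbb M=\bigcap_{i=1}^3\pi_i^{-1}(\mathbb S)$, where $\pi_i:\mathbb R^3\to\mathbb R^2$ forgets the $i$-th coordinate. Combinatorial modulus: let $(Z,d)$ be a compact metric space, $\kappa\ge1$, $k\in\mathbb N$. A finite graph $G_k$ is a $\kappa$-approximation of $Z$ on scale $k$ if it is the incidence graph of a finite covering of $Z$ (vertices are the covering sets, identified with subsets of $Z$; distinct vertices are adjacent iff they intersect) such that for each vertex $v$ there is $z_v\in Z$ with $B(z_v,\kappa^{-1}2^{-k})\subset v\subset B(z_v,\kappa2^{-k})$, and for distinct vertices $v\neq w$ the balls $B(z_v,\kappa^{-1}2^{-k})$, $B(z_w,\kappa^{-1}2^{-k})$ are disjoint. A sequence $\{G_k\}_{k\in\mathbb N}$ with each $G_k$ a $\kappa$-approximation on scale $k$ is a $\kappa$-approximation of $Z$. For a curve (or subset) $\gamma$ and $\rho:G_k^0\to\mathbb R_+$ set $L_\rho(\gamma)=\sum_{v\cap\gamma\neq\emptyset}\rho(v)$ and $M_p(\rho)=\sum_{v\in G_k^0}\rho(v)^p$. For a nonempty curve family $\mathcal F$, $\mathrm{Mod}_p(\mathcal F,G_k)=\inf M_p(\rho)$ over all $\rho$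 with $L_\rho(\gamma)\ge1$ for every $\gamma\in\mathcal F$; $\mathrm{Mod}_p(\emptyset,G_k)=0$. $\mathrm{Mod}_p(A,B,G_k)$ is the modulus of the family of curves joining $A$ and $B$. Combinatorial Loewner Property (CLP): let $Z$ be a compact arcwise connected doubling metric space with a $\kappa$-approximation $\{G_k\}$. For disjoint non-degenerate continua $A,B$, $\Delta(A,B)=\mathrm{dist}(A,B)/\min\{\mathrm{diam}A,\mathrm{diam}B\}$. For $p>1$, $Z$ satisfies the combinatorial $p$-Loewner property if there are positive increasing functions $\phi,\psi$ on $(0,\infty)$ with $\lim_{t\to0}\psi(t)=0$ such that for all disjoint non-degenerate continua $A,B\subset Z$ and all $k$ with $2^{-k}\le\min\{\mathrm{diam}A,\mathrm{diam}B\}$: $\phi(\Delta(A,B)^{-1})\le\mathrm{Mod}_p(A,B,G_k)\le\psi(\Delta(A,B)^{-1})$. $Z$ satisfies the CLP if it satisfies this for some $p>1$ (this does not depend on the choice of $\kappa$-approximation). *)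

theory Defs
  imports "HOL-Analysis.Analysis"
begin

text \<open>Squares are encoded by (a, b, s): lower-left corner (a,b) and side length s.
  Level n squares are those remaining after n subdivision steps: each remaining
  square is divided into nine equal subsquares and the open middle one removed,
  i.e. the eight outer closed subsquares are kept.\<close>

fun carpet_level :: "nat \<Rightarrow> (real \<times> real \<times> real) set" where
  "carpet_level 0 = {(0, 0, 1)}"
| "carpet_level (Suc n) =
     {(a + real i * s / 3, b + real j * s / 3, s / 3) | a b s i j.
        (a, b, s) \<in> carpet_level n \<and> i < 3 \<and> j < 3 \<and> (i, j) \<noteq> (1, 1)}"

definition closed_square :: "real \<times> real \<times> real \<Rightarrow> (real \<times> real) set" where
  "closed_square q = (case q of (a, b, s) \<Rightarrow> {a..a + s} \<times> {b..b + s})"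

definition sierpinski_carpet :: "(real \<times> real) set" where
  "sierpinski_carpet = (\<Inter>n. \<Union>q\<in>carpet_level n. closed_square q)"

definition forget1 :: "real \<times> real \<times> real \<Rightarrow> real \<times> real" where
  "forget1 p = (case p of (x, y, z) \<Rightarrow> (y, z))"
definition forget2 :: "real \<times> real \<times> real \<Rightarrow> real \<times> real" where
  "forget2 p = (case p of (x, y, z) \<Rightarrow> (x, z))"
definition forget3 :: "real \<times> real \<times> real \<Rightarrow> real \<times> real" where
  "forget3 p = (case p of (x, y, z) \<Rightarrow> (x, y))"

definition menger_sponge :: "(real \<times> real \<times> real) set" where
  "menger_sponge = forget1 -` sierpinski_carpet \<inter> forget2 -` sierpinski_carpet
                   \<inter> forget3 -` sierpinski_carpet"

text \<open>On product types, dist is the Euclidean (l2) metric, so subsets of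
  real \<times> real and real \<times> real \<times> real carry the Euclidean metric.\<close>

definition sball :: "'a::metric_space set \<Rightarrow> 'a \<Rightarrow> real \<Rightarrow> 'a set" where
  "sball Z z r = {w \<in> Z. dist z w < r}"

text \<open>G is a kappa-approximation of Z on scale k: a finite covering of Z by subsets
  (the vertices; adjacency = nonempty intersection, determined by the sets).\<close>
definition is_approx_scale :: "'a::metric_space set \<Rightarrow> real \<Rightarrow> nat \<Rightarrow> 'a set set \<Rightarrow> bool" where
  "is_approx_scale Z \<kappa> k G \<longleftrightarrow>
     finite G \<and> (\<forall>v\<in>G. v \<subseteq> Z) \<and> \<Union>G = Z \<and>
     (\<exists>c. (\<forall>v\<in>G. c v \<in> Z \<and> sball Z (c v) (inverse \<kappa> * (1/2)^k) \<subseteq> v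
                         \<and> v \<subseteq> sball Z (c v) (\<kappa> * (1/2)^k)) \<and>
          (\<forall>v\<in>G. \<forall>w\<in>G. v \<noteq> w \<longrightarrow>
              sball Z (c v) (inverse \<kappa> * (1/2)^k) \<inter> sball Z (c w) (inverse \<kappa> * (1/2)^k) = {}))"

definition is_approx :: "'a::metric_space set \<Rightarrow> real \<Rightarrow> (nat \<Rightarrow> 'a set set) \<Rightarrow> bool" where
  "is_approx Z \<kappa> G \<longleftrightarrow> \<kappa> \<ge> 1 \<and> (\<forall>k. is_approx_scale Z \<kappa> k (G k))"

definition rho_length :: "'a set set \<Rightarrow> ('a set \<Rightarrow> real) \<Rightarrow> 'a set \<Rightarrow> real" where
  "rho_length G \<rho> \<gamma> = (\<Sum>v\<in>{v\<in>G. v \<inter> \<gamma> \<noteq> {}}. \<rho> v)"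

definition rho_mass :: "real \<Rightarrow> 'a set set \<Rightarrow> ('a set \<Rightarrow> real) \<Rightarrow> real" where
  "rho_mass p G \<rho> = (\<Sum>v\<in>G. \<rho> v powr p)"

definition comb_mod :: "real \<Rightarrow> (real \<Rightarrow> 'a::topological_space) set \<Rightarrow> 'a set set \<Rightarrow> real" where
  "comb_mod p F G =
     (if F = {} then 0
      else Inf {rho_mass p G \<rho> | \<rho>. (\<forall>v\<in>G. \<rho> v \<ge> 0) \<and>
                                     (\<forall>\<gamma>\<in>F. rho_length G \<rho> (path_image \<gamma>) \<ge> 1)})"

definition joining_curves :: "'a::topological_space set \<Rightarrow> 'a set \<Rightarrow> 'a set \<Rightarrow> (real \<Rightarrow> 'a) set" where
  "joining_curves Z A B = {\<gamma>. path \<gamma> \<and> path_image \<gamma> \<subseteq> Z \<and> pathstart \<gamma> \<in> A \<and> pathfinish \<gamma> \<in> B}"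

definition arcwise_connected :: "'a::topological_space set \<Rightarrow> bool" where
  "arcwise_connected Z \<longleftrightarrow>
     (\<forall>x\<in>Z. \<forall>y\<in>Z. x \<noteq> y \<longrightarrow>
        (\<exists>g. arc g \<and> path_image g \<subseteq> Z \<and> pathstart g = x \<and> pathfinish g = y))"

definition doubling :: "'a::metric_space set \<Rightarrow> bool" where
  "doubling Z \<longleftrightarrow>
     (\<exists>N::nat. \<forall>x\<in>Z. \<forall>r>0. \<exists>C. C \<subseteq> Z \<and> finite C \<and> card C \<le> N \<and>
         sball Z x r \<subseteq> (\<Union>c\<in>C. sball Z c (r / 2)))"

definition nondegenerate_continuum :: "'a::metric_space set \<Rightarrow> bool" where
  "nondegenerate_continuum A \<longleftrightarrow> compact A \<and> connected A \<and> (\<exists>x\<in>A. \<exists>y\<in>A. x \<noteq> y)"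

definition rel_dist :: "'a::metric_space set \<Rightarrow> 'a set \<Rightarrow> real" where
  "rel_dist A B = setdist A B / min (diameter A) (diameter B)"

definition comb_p_loewner_wrt ::
    "real \<Rightarrow> 'a::metric_space set \<Rightarrow> (nat \<Rightarrow> 'a set set) \<Rightarrow> bool" where
  "comb_p_loewner_wrt p Z G \<longleftrightarrow>
     (\<exists>\<phi> \<psi> :: real \<Rightarrow> real.
        (\<forall>t>0. \<phi> t > 0) \<and> mono_on {0<..} \<phi> \<and>
        (\<forall>t>0. \<psi> t > 0) \<and> mono_on {0<..} \<psi> \<and> (\<psi> \<longlongrightarrow> 0) (at_right 0) \<and>
        (\<forall>A B k. A \<subseteq> Z \<and> B \<subseteq> Z \<and> nondegenerate_continuum A \<and> nondegenerate_continuum B \<and>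
                 A \<inter> B = {} \<and> (1/2)^k \<le> min (diameter A) (diameter B) \<longrightarrow>
            \<phi> (inverse (rel_dist A B)) \<le> comb_mod p (joining_curves Z A B) (G k) \<and>
            comb_mod p (joining_curves Z A B) (G k) \<le> \<psi> (inverse (rel_dist A B))))"

definition CLP :: "'a::metric_space set \<Rightarrow> bool" where
  "CLP Z \<longleftrightarrow> compact Z \<and> arcwise_connected Z \<and> doubling Z \<and>
     (\<exists>\<kappa> G p. is_approx Z \<kappa> G \<and> p > 1 \<and> comb_p_loewner_wrt p Z G)"

end

theory Submission
  imports Defs
begin

text \<open>Both sets are instances of one construction: a cell with integer index vector \<open>u\<close> survives iff no
  two coordinates of \<open>u\<close> have a ternary digit 1 in the same place. Let \<open>M n\<close> be the discrete
  \<open>p\<close>-modulus of the face-connected sets of level-\<open>n\<close> cells that cross the cube in a fixed direction.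
  Folding weights into annuli shows \<open>M (n + m) \<le> C * M n * M m\<close>. Conversely, reflections and
  coordinate swaps turn a single crossing set into a connected pattern in every chain of cells, and
  averaging over an optimal probability measure on crossing sets (convex duality) gives
  \<open>M n * M m \<le> K * M (n + m)\<close>. Since \<open>M n\<close> tends to infinity for \<open>p\<close> close to 1 and to 0 for large
  \<open>p\<close>, some exponent \<open>p > 1\<close> keeps it bounded above and away from 0.

  For this \<open>p\<close> the upper Loewner bound follows by summing disjointly supported annular weights over
  logarithmically many scales. For the lower bound, given a weight of small mass, a short pattern
  running close to both continua is connected to each of them by recursively filling gaps at smaller
  scales. Among the many places where pattern and continuum run in parallel one always carries little
  mass, so the lengths used form a convergent geometric series.\<close>


section \<open>Ternary digits\<close>

definition ones :: "nat \<Rightarrow> nat set" where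
  "ones x = {k. x div 3 ^ k mod 3 = 1}"

lemma ones_0 [simp]: "ones 0 = {}"
  by (simp add: ones_def)

lemma ones_block:
  assumes "r < 3 ^ m"
  shows "ones (q * 3 ^ m + r) = ones r \<union> (+) m ` ones q"
proof -
  have "k \<in> ones (q * 3 ^ m + r) \<longleftrightarrow> k \<in> ones r \<union> (+) m ` ones q" for k
  proof (cases "k < m")
    case True
    then have m: "(3::nat) ^ m = 3 ^ k * (3 * 3 ^ (m - k - 1))"
      by (simp flip: power_add power_Suc)
    define c where "c = 3 ^ (m - k - 1) * q"
    have "q * 3 ^ m + r = r + 3 ^ k * (3 * c)"
      unfolding m c_def by (simp add: algebra_simps)
    then have "(q * 3 ^ m + r) div 3 ^ k = (r + 3 ^ k * (3 * c)) div 3 ^ k" by (rule arg_cong)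
    then have "(q * 3 ^ m + r) div 3 ^ k = r div 3 ^ k + 3 * c" by simp
    then have "(q * 3 ^ m + r) div 3 ^ k mod 3 = r div 3 ^ k mod 3"
      by simp
    then show ?thesis using True by (auto simp: ones_def)
  next
    case False
    then have k: "(3::nat) ^ k = 3 ^ m * 3 ^ (k - m)"
      by (simp flip: power_add)
    have "(q * 3 ^ m + r) div 3 ^ k = q div 3 ^ (k - m)"
      using assms by (simp add: k div_mult2_eq)
    moreover have "r div 3 ^ k = 0"
      using assms False by (meson div_less le_less_trans less_le_trans not_less power_increasing
          one_le_numeral order_less_le_trans)
    moreover have "k \<in> (+) m ` A \<longleftrightarrow> k - m \<in> A" for A
      using False by (auto simp: image_iff intro: bexI[of _ "k - m"])
    ultimately show ?thesis by (auto simp: ones_def)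
  qed
  then show ?thesis by blast
qed

lemma ones_div_mod: "ones x = ones (x mod 3 ^ m) \<union> (+) m ` ones (x div 3 ^ m)"
proof -
  have "x mod 3 ^ m < 3 ^ m" by simp
  from ones_block[OF this, of "x div 3 ^ m"] show ?thesis by (simp only: div_mult_mod_eq)
qed

lemma ones_digit: "r < 3 \<Longrightarrow> ones (q * 3 + r) = (if r = 1 then {0} else {}) \<union> Suc ` ones q"
proof -
  assume "r < 3"
  then have "r = 0 \<or> r = 1 \<or> r = 2" by auto
  moreover have three: "(3::nat) ^ k \<ge> 3" if "k > 0" for k
    using that power_increasing[of 1 k "3::nat"] by auto
  moreover have "ones 1 = {0}" 
  proof -
    have "(1::nat) div 3 ^ k = 0" if "k > 0" for k
      using that three[of k] by (simp add: div_eq_0_iff)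
    then have "(1::nat) div 3 ^ k mod 3 = 1 \<longleftrightarrow> k = 0" for k by (cases "k = 0") auto
    then show ?thesis by (auto simp: ones_def)
  qed
  moreover have "ones 2 = {}"
  proof -
    have "(2::nat) div 3 ^ k = 0" if "k > 0" for k
      using that three[of k] by (simp add: div_eq_0_iff)
    then have "(2::nat) div 3 ^ k mod 3 \<noteq> 1" for k by (cases "k = 0") auto
    then show ?thesis by (auto simp: ones_def)
  qed
  moreover have "(+) 1 = Suc" by auto
  ultimately show ?thesis
    using ones_block[of r 1 q] \<open>r < 3\<close> by auto
qed

lemma ones_complement:
  "r < 3 ^ m \<Longrightarrow> ones (3 ^ m - 1 - r) = ones r"
proof (induction m arbitrary: r)
  case 0
  then show ?case by simp
next
  case (Suc m)
  define q b where "q = r div 3" and "b = r mod 3"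
  have r: "r = q * 3 + b" and b: "b < 3" and q: "q < 3 ^ m"
    using Suc.prems by (auto simp: q_def b_def)
  have "3 ^ Suc m - 1 - r = (3 ^ m - 1 - q) * 3 + (2 - b)"
    using q b by (simp add: r algebra_simps)
  moreover have "2 - b < 3" "2 - b = 1 \<longleftrightarrow> b = 1" using b by auto
  ultimately show ?case
    using ones_digit[of "2 - b" "3 ^ m - 1 - q"] ones_digit[OF b, of q] Suc.IH[OF q] r by auto
qed

text \<open>Incrementing turns a trailing block of digits 2 into zeros and raises the next digit, so
  it adds or removes exactly one digit 1.\<close>
lemma ones_Suc_nested: "ones x \<subseteq> ones (Suc x) \<or> ones (Suc x) \<subseteq> ones x"
proof (induction x rule: less_induct)
  case (less x)
  define q b where "q = x div 3" and "b = x mod 3"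
  have x: "x = q * 3 + b" and b: "b < 3" by (auto simp: q_def b_def)
  show ?case
  proof (cases "b = 2")
    case True
    then have "Suc x = Suc q * 3 + 0" using x by simp
    moreover have "ones (Suc q * 3 + 0) = Suc ` ones (Suc q)"
      using ones_digit[of 0 "Suc q"] by (simp only: zero_less_numeral) simp
    ultimately have "ones (Suc x) = Suc ` ones (Suc q)" by (simp only:)
    moreover have "ones x = Suc ` ones q" using x True ones_digit[of 2 q] by simp
    moreover have "q < x" using x True by simp
    ultimately show ?thesis using less.IH[of q] by (metis image_mono)
  next
    case False
    then have "Suc x = q * 3 + Suc b" "Suc b < 3" using x b by auto
    then show ?thesis using ones_digit[of "Suc b" q] ones_digit[of b q] b x False
      by (cases "b = 0") auto
  qed
qed

lemma ones_nested:
  assumes "x \<le> y + 1" "y \<le> x + 1"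
  shows "ones x \<subseteq> ones y \<or> ones y \<subseteq> ones x"
proof -
  have "x = y \<or> x = Suc y \<or> y = Suc x" using assms by auto
  then show ?thesis using ones_Suc_nested by auto
qed

text \<open>The zigzag map of period \<open>2 * 3 ^ m\<close> folds the line onto one block of length \<open>3 ^ m\<close>.\<close>
definition zigzag :: "nat \<Rightarrow> nat \<Rightarrow> nat" where
  "zigzag m x = (if even (x div 3 ^ m) then x mod 3 ^ m else 3 ^ m - 1 - x mod 3 ^ m)"

definition unzigzag :: "nat \<Rightarrow> nat \<Rightarrow> nat \<Rightarrow> nat" where
  "unzigzag m q u = q * 3 ^ m + (if even q then u else 3 ^ m - 1 - u)"

lemma zigzag_less: "zigzag m x < 3 ^ m"
  by (auto simp: zigzag_def less_Suc_eq_le intro: le_less_trans[of _ "3 ^ m - 1"])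

lemma ones_zigzag: "ones (zigzag m x) = ones (x mod 3 ^ m)"
  using ones_complement[of "x mod 3 ^ m" m] by (simp add: zigzag_def)

lemma unzigzag_div: "u < 3 ^ m \<Longrightarrow> unzigzag m q u div 3 ^ m = q"
  by (auto simp: unzigzag_def)

lemma unzigzag_mod: "u < 3 ^ m \<Longrightarrow> unzigzag m q u mod 3 ^ m = (if even q then u else 3 ^ m - 1 - u)"
  by (auto simp: unzigzag_def simp del: diff_diff_left One_nat_def)

lemma zigzag_unzigzag: "u < 3 ^ m \<Longrightarrow> zigzag m (unzigzag m q u) = u"
  by (simp add: zigzag_def unzigzag_div unzigzag_mod)

lemma unzigzag_zigzag: "unzigzag m (x div 3 ^ m) (zigzag m x) = x"
proof -
  have "x mod 3 ^ m < 3 ^ m" by simp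
  then have "3 ^ m - 1 - (3 ^ m - 1 - x mod 3 ^ m) = x mod 3 ^ m" by linarith
  then have "unzigzag m (x div 3 ^ m) (zigzag m x) = x div 3 ^ m * 3 ^ m + x mod 3 ^ m"
    by (simp only: unzigzag_def zigzag_def split: if_splits) simp
  then show ?thesis by (simp only: div_mult_mod_eq)
qed

lemma div_Suc_cases: "Suc x div N = x div N \<and> Suc x mod N = Suc (x mod N) \<or>
   Suc x div N = Suc (x div N) \<and> Suc x mod N = 0 \<and> x mod N = N - 1" if "N > 0" for N :: nat
  using that by (auto simp: div_Suc mod_Suc)

lemma zigzag_Suc: "zigzag m (Suc x) \<le> zigzag m x + 1 \<and> zigzag m x \<le> zigzag m (Suc x) + 1"
  using div_Suc_cases[of "3 ^ m" x] by (auto simp: zigzag_def)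

lemma zigzag_step: "x \<le> y + 1 \<Longrightarrow> y \<le> x + 1 \<Longrightarrow> zigzag m x \<le> zigzag m y + 1"
proof -
  assume "x \<le> y + 1" "y \<le> x + 1"
  then have "x = y \<or> x = Suc y \<or> y = Suc x" by auto
  then show ?thesis using zigzag_Suc[of m x] zigzag_Suc[of m y] by auto
qed

lemma div_step: "x \<le> y + 1 \<Longrightarrow> x div 3 ^ m \<le> y div 3 ^ m + (1::nat)"
  using div_le_mono[of x "Suc y" "3 ^ m"] div_Suc_cases[of "3 ^ m" y] by auto

lemma unzigzag_step: "u \<le> w + 1 \<Longrightarrow> w \<le> u + 1 \<Longrightarrow> unzigzag m q u \<le> unzigzag m q w + 1"
  by (auto simp: unzigzag_def)

text \<open>Two neighbouring blocks are mirror images in their common wall.\<close>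
lemma unzigzag_wall:
  "unzigzag m q (if even q then 3 ^ m - 1 else 0) + 1 = unzigzag m (Suc q) (if even q then 3 ^ m - 1 else 0)"
  by (auto simp: unzigzag_def)

section \<open>Cells and face adjacency\<close>

text \<open>A cell of level \<open>n\<close> is the cube of side \<open>1/3^n\<close> with lower corner \<open>u/3^n\<close>. It survives the
  construction iff no two coordinates of \<open>u\<close> have a ternary digit 1 in the same place.\<close>
definition cells :: "nat \<Rightarrow> ('i::finite \<Rightarrow> nat) set" where
  "cells n = {u. (\<forall>i. u i < 3 ^ n) \<and> (\<forall>i j. i \<noteq> j \<longrightarrow> ones (u i) \<inter> ones (u j) = {})}"

definition adj :: "('i \<Rightarrow> nat) \<Rightarrow> ('i \<Rightarrow> nat) \<Rightarrow> bool" where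
  "adj u v \<longleftrightarrow> (\<exists>i. (\<forall>j. j \<noteq> i \<longrightarrow> u j = v j) \<and> u i \<le> v i + 1 \<and> v i \<le> u i + 1)"

definition near :: "nat \<Rightarrow> ('i \<Rightarrow> nat) \<Rightarrow> ('i \<Rightarrow> nat) \<Rightarrow> bool" where
  "near r u v \<longleftrightarrow> (\<forall>i. u i \<le> v i + r \<and> v i \<le> u i + r)"

definition conn :: "('i \<Rightarrow> nat) set \<Rightarrow> bool" where
  "conn S \<longleftrightarrow> (\<forall>T\<subseteq>S. T \<noteq> {} \<longrightarrow> (\<forall>x\<in>T. \<forall>y\<in>S. adj x y \<longrightarrow> y \<in> T) \<longrightarrow> T = S)"

definition anc :: "nat \<Rightarrow> ('i \<Rightarrow> nat) \<Rightarrow> 'i \<Rightarrow> nat" where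
  "anc m v = (\<lambda>i. v i div 3 ^ m)"

definition fold_cell :: "nat \<Rightarrow> ('i \<Rightarrow> nat) \<Rightarrow> 'i \<Rightarrow> nat" where
  "fold_cell m v = (\<lambda>i. zigzag m (v i))"

definition lift_cell :: "nat \<Rightarrow> ('i \<Rightarrow> nat) \<Rightarrow> ('i \<Rightarrow> nat) \<Rightarrow> 'i \<Rightarrow> nat" where
  "lift_cell m e u = (\<lambda>i. unzigzag m (e i) (u i))"

definition swap_cell :: "'i \<Rightarrow> 'i \<Rightarrow> ('i \<Rightarrow> nat) \<Rightarrow> 'i \<Rightarrow> nat" where
  "swap_cell a b u = u \<circ> Transposition.transpose a b"

lemma finite_cells [simp, intro]: "finite (cells n :: ('i::finite \<Rightarrow> nat) set)"
proof -
  have "(cells n :: ('i \<Rightarrow> nat) set) \<subseteq> PiE UNIV (\<lambda>_. {..<3 ^ n})"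
    by (auto simp: cells_def)
  then show ?thesis by (rule finite_subset) (auto intro: finite_PiE)
qed

lemma cells_0: "cells 0 = {\<lambda>_. 0}"
  by (auto simp: cells_def)

lemma adj_refl [simp]: "adj u u"
  by (auto simp: adj_def)

lemma adj_sym: "adj u v \<Longrightarrow> adj v u"
  unfolding adj_def by metis

lemma near_refl [simp]: "near r u u"
  by (auto simp: near_def)

lemma near_sym: "near r u v \<Longrightarrow> near r v u"
  by (auto simp: near_def)

lemma near_trans: "near r u v \<Longrightarrow> near s v w \<Longrightarrow> near (r + s) u w"
  unfolding near_def
proof (intro allI)
  fix i
  assume "\<forall>i. u i \<le> v i + r \<and> v i \<le> u i + r" "\<forall>i. v i \<le> w i + s \<and> w i \<le> v i + s"
  then have "u i \<le> v i + r" "v i \<le> u i + r" "v i \<le> w i + s" "w i \<le> v i + s" by auto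
  then show "u i \<le> w i + (r + s) \<and> w i \<le> u i + (r + s)" by linarith
qed

lemma near_mono: "near r u v \<Longrightarrow> r \<le> s \<Longrightarrow> near s u v"
  unfolding near_def
proof (intro allI)
  fix i
  assume "\<forall>i. u i \<le> v i + r \<and> v i \<le> u i + r" "r \<le> s"
  then have "u i \<le> v i + r" "v i \<le> u i + r" "r \<le> s" by auto
  then show "u i \<le> v i + s \<and> v i \<le> u i + s" by linarith
qed

lemma adj_near: "adj u v \<Longrightarrow> near 1 u v"
  unfolding adj_def near_def by (metis le_add1)

lemma cells_less: "u \<in> cells n \<Longrightarrow> u i < 3 ^ n"
  by (simp add: cells_def)

lemma anc_cells:
  assumes "v \<in> cells (n + m)"
  shows "anc m v \<in> cells n"
proof -
  have "anc m v i < 3 ^ n" for i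
    using assms by (auto simp: cells_def anc_def power_add less_mult_imp_div_less)
  moreover have "ones (anc m v i) \<inter> ones (anc m v j) = {}" if "i \<noteq> j" for i j
  proof -
    have "(+) m ` ones (anc m v i) \<inter> (+) m ` ones (anc m v j) \<subseteq> ones (v i) \<inter> ones (v j)"
      unfolding anc_def using ones_div_mod[of "v i" m] ones_div_mod[of "v j" m] by blast
    also have "\<dots> = {}" using assms that by (auto simp: cells_def)
    finally show ?thesis by blast
  qed
  ultimately show ?thesis by (auto simp: cells_def)
qed

lemma fold_cells:
  assumes "v \<in> cells n"
  shows "fold_cell m v \<in> cells m"
proof -
  have "ones (fold_cell m v i) \<subseteq> ones (v i)" for i
    unfolding fold_cell_def ones_zigzag using ones_div_mod[of "v i" m] by blast
  then have "ones (fold_cell m v i) \<inter> ones (fold_cell m v j) = {}" if "i \<noteq> j" for i j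
    using assms that unfolding cells_def by blast
  then show ?thesis by (simp add: cells_def fold_cell_def zigzag_less)
qed

lemma block_cells:
  assumes e: "e \<in> cells n" and u: "u \<in> cells m"
  shows "(\<lambda>i. e i * 3 ^ m + u i) \<in> cells (n + m)"
proof -
  have ul: "u i < 3 ^ m" and el: "e i < 3 ^ n" for i using u e by (auto simp: cells_def)
  have "e i * 3 ^ m + u i < 3 ^ (n + m)" for i
  proof -
    have "(e i + 1) * 3 ^ m \<le> 3 ^ n * 3 ^ m" using el[of i] by (intro mult_right_mono) auto
    then show ?thesis using ul[of i] by (simp add: power_add)
  qed
  moreover have "ones (e i * 3 ^ m + u i) \<inter> ones (e j * 3 ^ m + u j) = {}" if "i \<noteq> j" for i j
  proof -
    have lt: "k < m" if "k \<in> ones (u i)" for k i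
    proof (rule ccontr)
      assume "\<not> k < m"
      then have "(3::nat) ^ m \<le> 3 ^ k" by (intro power_increasing) auto
      then have "u i < 3 ^ k" using ul[of i] by linarith
      then show False using that by (auto simp: ones_def)
    qed
    have "ones (u i) \<inter> ones (u j) = {}" "ones (e i) \<inter> ones (e j) = {}"
      using u e that by (auto simp: cells_def)
    then show ?thesis unfolding ones_block[OF ul] using lt by fastforce
  qed
  ultimately show ?thesis by (auto simp: cells_def)
qed

lemma lift_cells:
  assumes "e \<in> cells n" "u \<in> cells m"
  shows "lift_cell m e u \<in> cells (n + m)"
proof -
  let ?r = "\<lambda>i. if even (e i) then u i else 3 ^ m - 1 - u i"
  have u: "u i < 3 ^ m" for i using assms by (auto simp: cells_def)
  have "ones (?r i) = ones (u i)" for i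
    using ones_complement[OF u[of i]] by auto
  moreover have "?r i < 3 ^ m" for i using u[of i] by auto
  ultimately have "?r \<in> cells m" using assms(2) by (simp add: cells_def)
  from block_cells[OF assms(1) this] show ?thesis
    by (simp only: lift_cell_def unzigzag_def)
qed

lemma anc_lift: "u \<in> cells m \<Longrightarrow> anc m (lift_cell m e u) = e"
  by (auto simp: anc_def lift_cell_def unzigzag_div cells_def)

lemma fold_lift: "u \<in> cells m \<Longrightarrow> fold_cell m (lift_cell m e u) = u"
  by (auto simp: fold_cell_def lift_cell_def zigzag_unzigzag cells_def)

lemma lift_fold: "lift_cell m (anc m v) (fold_cell m v) = v"
  by (auto simp: fold_cell_def lift_cell_def anc_def unzigzag_zigzag)

lemma anc_anc: "anc k (anc m v) = anc (m + k) v"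
  by (auto simp: anc_def power_add div_mult2_eq)

lemma adj_anc: "adj u v \<Longrightarrow> adj (anc m u) (anc m v)"
  unfolding adj_def anc_def by (metis div_step)

lemma adj_fold: "adj u v \<Longrightarrow> adj (fold_cell m u) (fold_cell m v)"
  unfolding adj_def fold_cell_def by (metis zigzag_step)

lemma adj_lift: "adj u v \<Longrightarrow> adj (lift_cell m e u) (lift_cell m e v)"
  unfolding adj_def lift_cell_def by (metis unzigzag_step)

lemma swap_cell_swap_cell [simp]: "swap_cell a b (swap_cell a b u) = u"
  by (simp add: swap_cell_def comp_assoc)

lemma swap_cell_apply: "swap_cell a b u i = u (Transposition.transpose a b i)"
  by (simp add: swap_cell_def)

lemma swap_cells: "u \<in> cells n \<Longrightarrow> swap_cell a b u \<in> cells n"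
proof -
  assume "u \<in> cells n"
  moreover have "Transposition.transpose a b i \<noteq> Transposition.transpose a b j" if "i \<noteq> j" for i j
    using that by (metis transpose_involutory)
  ultimately show ?thesis unfolding cells_def swap_cell_apply by blast
qed

lemma swap_cell_bij: "bij_betw (swap_cell a b) (cells n) (cells n)"
  by (rule bij_betw_byWitness[where f' = "swap_cell a b"]) (auto simp: swap_cells)

lemma adj_swap: "adj u v \<Longrightarrow> adj (swap_cell a b u) (swap_cell a b v)"
proof -
  assume "adj u v"
  then obtain i where "\<forall>j. j \<noteq> i \<longrightarrow> u j = v j" "u i \<le> v i + 1" "v i \<le> u i + 1"
    by (auto simp: adj_def)
  then show ?thesis
    unfolding adj_def swap_cell_apply
    by (intro exI[of _ "Transposition.transpose a b i"]) (auto, metis transpose_involutory)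
qed

section \<open>Connected sets of cells\<close>

lemma connI:
  assumes "\<And>T. T \<subseteq> S \<Longrightarrow> T \<noteq> {} \<Longrightarrow> (\<And>x y. x \<in> T \<Longrightarrow> y \<in> S \<Longrightarrow> adj x y \<Longrightarrow> y \<in> T) \<Longrightarrow> S \<subseteq> T"
  shows "conn S"
  unfolding conn_def using assms by blast

lemma connD:
  assumes "conn S" "T \<subseteq> S" "T \<noteq> {}" "\<And>x y. x \<in> T \<Longrightarrow> y \<in> S \<Longrightarrow> adj x y \<Longrightarrow> y \<in> T"
  shows "T = S"
  using assms unfolding conn_def by blast

lemma conn_subset_closed:
  assumes "conn C" "C \<subseteq> S" "C \<inter> T \<noteq> {}" "\<And>x y. x \<in> T \<Longrightarrow> y \<in> S \<Longrightarrow> adj x y \<Longrightarrow> y \<in> T"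
  shows "C \<subseteq> T"
  using connD[of C "C \<inter> T"] assms by blast

lemma conn_image:
  assumes "conn S" and f: "\<And>u v. u \<in> S \<Longrightarrow> v \<in> S \<Longrightarrow> adj u v \<Longrightarrow> adj (f u) (f v)"
  shows "conn (f ` S)"
proof (rule connI)
  fix T assume T: "T \<subseteq> f ` S" "T \<noteq> {}" "\<And>x y. x \<in> T \<Longrightarrow> y \<in> f ` S \<Longrightarrow> adj x y \<Longrightarrow> y \<in> T"
  have "{u \<in> S. f u \<in> T} = S"
    using T f by (intro connD[OF assms(1)]) auto
  then show "f ` S \<subseteq> T" by blast
qed

lemma conn_singleton [simp]: "conn {u}"
  by (auto simp: conn_def)

lemma conn_pairwise:
  assumes "\<And>x y. x \<in> S \<Longrightarrow> y \<in> S \<Longrightarrow> \<exists>C. conn C \<and> C \<subseteq> S \<and> x \<in> C \<and> y \<in> C"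
  shows "conn S"
proof (rule connI)
  fix T assume T: "T \<subseteq> S" "T \<noteq> {}" "\<And>x y. x \<in> T \<Longrightarrow> y \<in> S \<Longrightarrow> adj x y \<Longrightarrow> y \<in> T"
  then obtain x where x: "x \<in> T" by blast
  show "S \<subseteq> T"
  proof
    fix y assume "y \<in> S"
    then obtain C where "conn C" "C \<subseteq> S" "x \<in> C" "y \<in> C" using assms x T(1) by blast
    then show "y \<in> T" using conn_subset_closed[of C S T] T(3) x by blast
  qed
qed

lemma conn_Un:
  assumes "conn A" "conn B" "x \<in> A" "y \<in> B" "adj x y"
  shows "conn (A \<union> B)"
proof (rule connI)
  fix T assume T: "T \<subseteq> A \<union> B" "T \<noteq> {}" "\<And>x y. x \<in> T \<Longrightarrow> y \<in> A \<union> B \<Longrightarrow> adj x y \<Longrightarrow> y \<in> T"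
  have a: "A \<inter> T \<noteq> {} \<Longrightarrow> A \<subseteq> T" and b: "B \<inter> T \<noteq> {} \<Longrightarrow> B \<subseteq> T"
    using conn_subset_closed[of _ "A \<union> B" T] T(3) assms by auto
  from T(1,2) consider "A \<inter> T \<noteq> {}" | "B \<inter> T \<noteq> {}" by blast
  then show "A \<union> B \<subseteq> T"
  proof cases
    case 1
    then have "x \<in> T" using a assms by blast
    then have "y \<in> T" using T(3) assms by blast
    then show ?thesis using a b 1 assms by blast
  next
    case 2
    then have "y \<in> T" using b assms by blast
    then have "x \<in> T" using T(3) assms adj_sym by blast
    then show ?thesis using a b 2 assms by blast
  qed
qed

lemma conn_Un_meet: "conn A \<Longrightarrow> conn B \<Longrightarrow> A \<inter> B \<noteq> {} \<Longrightarrow> conn (A \<union> B)"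
  using conn_Un by (metis adj_refl disjoint_iff)

lemma conn_exit:
  assumes "conn S" "x \<in> S" "P x" "y \<in> S" "\<not> P y"
  obtains u v where "u \<in> S" "v \<in> S" "adj u v" "P u" "\<not> P v"
  using connD[OF assms(1), of "{u \<in> S. P u}"] assms(2-5) by blast

definition comp :: "('i \<Rightarrow> nat) set \<Rightarrow> ('i \<Rightarrow> nat) \<Rightarrow> ('i \<Rightarrow> nat) set" where
  "comp S x = {y. (x, y) \<in> {(u, v). u \<in> S \<and> v \<in> S \<and> adj u v}\<^sup>*}"

lemma comp_self: "x \<in> comp S x"
  by (simp add: comp_def)

lemma comp_subset: "x \<in> S \<Longrightarrow> comp S x \<subseteq> S"
proof
  fix y assume "x \<in> S" "y \<in> comp S x"
  then have "(x, y) \<in> {(u, v). u \<in> S \<and> v \<in> S \<and> adj u v}\<^sup>*" by (simp add: comp_def)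
  then show "y \<in> S" using \<open>x \<in> S\<close> by (induction rule: rtrancl_induct) auto
qed

lemma comp_closed: "x \<in> S \<Longrightarrow> u \<in> comp S x \<Longrightarrow> v \<in> S \<Longrightarrow> adj u v \<Longrightarrow> v \<in> comp S x"
proof -
  assume "x \<in> S" and u: "u \<in> comp S x" and "v \<in> S" "adj u v"
  then have "(u, v) \<in> {(u, v). u \<in> S \<and> v \<in> S \<and> adj u v}" using comp_subset by blast
  with u show ?thesis unfolding comp_def by (auto intro: rtrancl_into_rtrancl)
qed

lemma conn_comp: "x \<in> S \<Longrightarrow> conn (comp S x)"
proof (rule connI)
  fix T
  assume x: "x \<in> S" and T: "T \<subseteq> comp S x" "T \<noteq> {}"
    "\<And>u v. u \<in> T \<Longrightarrow> v \<in> comp S x \<Longrightarrow> adj u v \<Longrightarrow> v \<in> T"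
  let ?R = "{(u, v). u \<in> S \<and> v \<in> S \<and> adj u v}"
  have sym: "sym ?R" by (auto simp: sym_def intro: adj_sym)
  obtain y where y: "y \<in> T" using T by blast
  show "comp S x \<subseteq> T"
  proof
    fix z assume z: "z \<in> comp S x"
    have "(y, x) \<in> ?R\<^sup>*" using y T(1) sym_rtrancl[OF sym] by (auto simp: comp_def sym_def)
    then have "(y, z) \<in> ?R\<^sup>*" using z by (auto simp: comp_def)
    then show "z \<in> T"
    proof (induction rule: rtrancl_induct)
      case base
      then show ?case using y .
    next
      case (step u v)
      then have "v \<in> comp S x" using comp_closed[OF x, of u v] T(1) by blast
      then show ?case using step T(3) by blast
    qed
  qed
qed

subsection \<open>Touching cells\<close>

text \<open>Of two touching coordinates one has fewer digits 1, so replacing coordinates of a cell by the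
  poorer alternative is always allowed.\<close>
lemma conn_box:
  fixes e e' :: "'i::finite \<Rightarrow> nat"
  assumes e: "e \<in> cells n" and e': "e' \<in> cells n" and "near 1 e e'"
  shows "conn {w \<in> cells n. \<forall>i. w i \<in> {e i, e' i}}" (is "conn ?B")
proof -
  have nb: "e i \<le> e' i + 1" "e' i \<le> e i + 1" for i using assms(3) by (auto simp: near_def)
  define m where "m = (\<lambda>i. if ones (e i) \<subseteq> ones (e' i) then e i else e' i)"
  have m_min: "ones (m i) \<subseteq> ones (e i)" "ones (m i) \<subseteq> ones (e' i)" for i
    using ones_nested[OF nb] unfolding m_def by auto
  have m_in: "m i \<in> {e i, e' i}" for i by (auto simp: m_def)
  have reach: "m \<in> T" if x: "x \<in> ?B" "x \<in> T" and cl: "\<And>x y. x \<in> T \<Longrightarrow> y \<in> ?B \<Longrightarrow> adj x y \<Longrightarrow> y \<in> T"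
    for T x
  proof -
    have "(\<lambda>i. if i \<in> J then m i else x i) \<in> T \<inter> ?B" if "finite J" for J
      using that
    proof (induction J)
      case empty
      then show ?case using x by simp
    next
      case (insert k J)
      let ?w = "\<lambda>i. if i \<in> insert k J then m i else x i"
      have xm: "ones (m i) \<subseteq> ones (x i)" "x i < 3 ^ n" "m i < 3 ^ n" for i
      proof -
        have "x i = e i \<or> x i = e' i" using x by auto
        then show "ones (m i) \<subseteq> ones (x i)" using m_min[of i] by metis
      qed (use x m_in[of i] cells_less[OF e, of i] cells_less[OF e', of i] in \<open>auto simp: cells_def\<close>)
      have "ones (?w i) \<inter> ones (?w j) = {}" if "i \<noteq> j" for i j
      proof -
        have "ones (?w i) \<subseteq> ones (x i)" "ones (?w j) \<subseteq> ones (x j)" using xm by auto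
        moreover have "ones (x i) \<inter> ones (x j) = {}" using x that by (auto simp: cells_def)
        ultimately show ?thesis by blast
      qed
      moreover have "?w i < 3 ^ n" for i using xm by simp
      ultimately have "?w \<in> cells n" by (simp add: cells_def)
      moreover have "?w i \<in> {e i, e' i}" for i using m_in[of i] x by auto
      ultimately have "?w \<in> ?B" by blast
      moreover have "adj (\<lambda>i. if i \<in> J then m i else x i) ?w"
      proof -
        have "x k \<in> {e k, e' k}" using x by auto
        then have "x k \<le> m k + 1 \<and> m k \<le> x k + 1" using m_in[of k] nb[of k] by auto
        then show ?thesis unfolding adj_def using insert by (intro exI[of _ k]) auto
      qed
      ultimately show ?case using insert.IH cl by blast
    qed
    from this[OF finite, of UNIV] show ?thesis by simp
  qed
  show ?thesis
  proof (rule connI)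
    fix T assume T: "T \<subseteq> ?B" "T \<noteq> {}" and cl: "\<And>x y. x \<in> T \<Longrightarrow> y \<in> ?B \<Longrightarrow> adj x y \<Longrightarrow> y \<in> T"
    have mT: "m \<in> T" using T reach cl by blast
    show "?B \<subseteq> T"
    proof (rule ccontr)
      assume "\<not> ?B \<subseteq> T"
      then obtain y where "y \<in> ?B - T" by blast
      moreover have "v \<in> ?B - T" if "u \<in> ?B - T" "v \<in> ?B" "adj u v" for u v
        using that cl adj_sym by blast
      ultimately have "m \<in> ?B - T" using reach[of y "?B - T"] by blast
      then show False using mT by blast
    qed
  qed
qed

lemma conn_near:
  assumes "e \<in> cells n"
  shows "conn {w \<in> cells n. near 1 e w}" (is "conn ?N")
proof (rule connI)
  fix T assume T: "T \<subseteq> ?N" "T \<noteq> {}" and cl: "\<And>x y. x \<in> T \<Longrightarrow> y \<in> ?N \<Longrightarrow> adj x y \<Longrightarrow> y \<in> T"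
  have box: "{z \<in> cells n. \<forall>i. z i \<in> {e i, w i}} \<subseteq> T"
    if "w \<in> ?N" "w \<in> T \<or> e \<in> T" for w
  proof (rule conn_subset_closed[OF conn_box, where S = ?N])
    show "{z \<in> cells n. \<forall>i. z i \<in> {e i, w i}} \<subseteq> ?N"
    proof
      fix z assume "z \<in> {z \<in> cells n. \<forall>i. z i \<in> {e i, w i}}"
      then have z: "z \<in> cells n" "z i = e i \<or> z i = w i" for i by auto
      have "e i \<le> z i + 1 \<and> z i \<le> e i + 1" for i
        using z(2)[of i] that(1) by (auto simp: near_def)
      then show "z \<in> ?N" using z(1) by (auto simp: near_def)
    qed
    show "{z \<in> cells n. \<forall>i. z i \<in> {e i, w i}} \<inter> T \<noteq> {}"
      using that assms by auto
  qed (use that assms cl in auto)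
  obtain w where "w \<in> T" using T by blast
  then have "e \<in> T" using box[of w] T assms by auto
  then show "?N \<subseteq> T" using box by fastforce
qed

subsection \<open>Subdividing connected sets\<close>

lemma conn_blocks:
  fixes E :: "('i::finite \<Rightarrow> nat) set"
  assumes E: "conn E" "E \<subseteq> cells n" and G: "conn G" "G \<subseteq> cells m" "G \<noteq> {}"
    and faces: "\<And>i. \<exists>u\<in>G. u i = 0" "\<And>i. \<exists>u\<in>G. u i = 3 ^ m - 1"
  shows "conn {v \<in> cells (n + m). anc m v \<in> E \<and> fold_cell m v \<in> G}" (is "conn ?U")
proof (rule connI)
  fix T assume T: "T \<subseteq> ?U" "T \<noteq> {}" and cl: "\<And>x y. x \<in> T \<Longrightarrow> y \<in> ?U \<Longrightarrow> adj x y \<Longrightarrow> y \<in> T"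
  have lift_U: "lift_cell m e u \<in> ?U" if "e \<in> E" "u \<in> G" for e u
    using that E G lift_cells[of e n u m] anc_lift[of u m e] fold_lift[of u m e] by auto
  have block: "lift_cell m e ` G \<subseteq> T" if "e \<in> E" "lift_cell m e ` G \<inter> T \<noteq> {}" for e
  proof (rule conn_subset_closed[where S = ?U])
    show "conn (lift_cell m e ` G)" using G(1) adj_lift by (rule conn_image)
  qed (use that lift_U cl in auto)
  have "{e \<in> E. lift_cell m e ` G \<subseteq> T} = E"
  proof (rule connD[OF E(1)])
    obtain v where v: "v \<in> T" using T by blast
    then have "lift_cell m (anc m v) (fold_cell m v) \<in> T" by (simp add: lift_fold)
    then have "lift_cell m (anc m v) ` G \<subseteq> T"
      using v T by (intro block) auto
    then show "{e \<in> E. lift_cell m e ` G \<subseteq> T} \<noteq> {}" using v T by auto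
  next
    fix e f assume e: "e \<in> {e \<in> E. lift_cell m e ` G \<subseteq> T}" and f: "f \<in> E" and "adj e f"
    then obtain i where i: "\<forall>j. j \<noteq> i \<longrightarrow> e j = f j" "e i \<le> f i + 1" "f i \<le> e i + 1"
      by (auto simp: adj_def)
    have "\<exists>u\<in>G. adj (lift_cell m e u) (lift_cell m f u)"
    proof -
      define q where "q = min (e i) (f i)"
      obtain u where u: "u \<in> G" "u i = (if even q then 3 ^ m - 1 else 0)"
        using faces[of i] by (cases "even q") auto
      have "e i = f i \<or> (e i = q \<and> f i = Suc q) \<or> (f i = q \<and> e i = Suc q)"
        using i by (auto simp: q_def min_def)
      then have "adj (lift_cell m e u) (lift_cell m f u)"
        unfolding adj_def lift_cell_def using i(1) u(2) unzigzag_wall[of m q]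
        by (intro exI[of _ i]) auto
      then show ?thesis using u(1) by blast
    qed
    then have "lift_cell m f ` G \<inter> T \<noteq> {}"
      using e f cl lift_U by blast
    then show "f \<in> {e \<in> E. lift_cell m e ` G \<subseteq> T}" using block f by blast
  qed auto
  then have "lift_cell m e u \<in> T" if "e \<in> E" "u \<in> G" for e u using that by blast
  note all = this
  show "?U \<subseteq> T"
  proof
    fix v assume "v \<in> ?U"
    then show "v \<in> T" using all[of "anc m v" "fold_cell m v"] by (simp add: lift_fold)
  qed
qed

lemma ones_small: "x < 3 \<Longrightarrow> ones x = (if x = 1 then {0} else {})"
  using ones_digit[of x 0] by simp

lemma conn_cells_1: "conn (cells 1 :: ('i::finite \<Rightarrow> nat) set)"
proof (rule connI)
  fix T :: "('i \<Rightarrow> nat) set"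
  assume T: "T \<subseteq> cells 1" "T \<noteq> {}" and cl: "\<And>x y. x \<in> T \<Longrightarrow> y \<in> cells 1 \<Longrightarrow> adj x y \<Longrightarrow> y \<in> T"
  have zero: "(\<lambda>_. 0) \<in> T" if "x \<in> cells 1" "x \<in> T"
    "\<forall>x\<in>T. \<forall>y\<in>cells 1. adj x y \<longrightarrow> y \<in> T" for x and T :: "('i \<Rightarrow> nat) set"
    using that
  proof (induction "sum x UNIV" arbitrary: x rule: less_induct)
    case less
    show ?case
    proof (cases "\<forall>i. x i = 0")
      case True
      then have "x = (\<lambda>_. 0)" by auto
      then show ?thesis using less.prems(2) by simp
    next
      case False
      define i where "i = (if \<exists>i. x i = 1 then SOME i. x i = 1 else SOME i. x i \<noteq> 0)"
      have xi: "x i \<noteq> 0" and one: "x i = 1 \<or> (\<forall>j. x j \<noteq> 1)"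
        using False someI_ex[of "\<lambda>i. x i = 1"] someI_ex[of "\<lambda>i. x i \<noteq> 0"]
        unfolding i_def by (auto split: if_splits)
      define y where "y = x(i := x i - 1)"
      have xl: "x j < 3" for j using less.prems(1) by (auto simp: cells_def)
      have yl: "y j < 3" for j using xl[of j] by (auto simp: y_def)
      have "ones (y j) \<inter> ones (y k) = {}" if "j \<noteq> k" for j k
      proof -
        have "ones (x j) \<inter> ones (x k) = {}" using less.prems(1) that by (auto simp: cells_def)
        then have "\<not> (x j = 1 \<and> x k = 1)" by (auto simp: ones_small)
        then have "\<not> (y j = 1 \<and> y k = 1)"
          using one that by (auto simp: y_def)
        then show ?thesis by (auto simp: ones_small[OF yl] split: if_splits)
      qed
      moreover have "y j < 3 ^ 1" for j using yl[of j] by simp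
      ultimately have y: "y \<in> cells 1" by (simp add: cells_def)
      have "adj x y" unfolding adj_def y_def by (intro exI[of _ i]) auto
      then have yT: "y \<in> T" using less.prems y by blast
      have "sum y UNIV < sum x UNIV"
      proof (rule sum_strict_mono_ex1)
        show "\<exists>j\<in>UNIV. y j < x j" using xi by (intro bexI[of _ i]) (auto simp: y_def)
      qed (auto simp: y_def)
      then show ?thesis by (rule less.hyps[OF _ y yT less.prems(3)])
    qed
  qed
  obtain z where z: "z \<in> T" using T by blast
  have 0: "(\<lambda>_. 0) \<in> T"
  proof (rule zero)
    show "z \<in> cells 1" "z \<in> T" using z T by auto
  qed (use cl in auto)
  show "cells 1 \<subseteq> T"
  proof (rule ccontr)
    assume "\<not> cells 1 \<subseteq> T"
    then obtain y where y: "y \<in> cells 1" "y \<in> cells 1 - T" by auto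
    have "\<forall>x\<in>cells 1 - T. \<forall>y\<in>cells 1. adj x y \<longrightarrow> y \<in> cells 1 - T"
      using cl adj_sym by blast
    then show False using zero[OF y] 0 by auto
  qed
qed

lemma ones_max [simp]: "ones (3 ^ n - Suc 0) = {}"
  using ones_complement[of 0 n] by simp

lemma const_cells: "ones c = {} \<Longrightarrow> c < 3 ^ n \<Longrightarrow> (\<lambda>_. c) \<in> cells n"
  by (auto simp: cells_def)

lemma cells_faces: "\<exists>u\<in>cells m. u i = 0" "\<exists>u\<in>cells m. u i = 3 ^ m - 1"
  using const_cells[of 0 m] const_cells[of "3 ^ m - 1" m] by (auto intro: bexI)

lemma conn_subcells_aux:
  assumes "conn E" "E \<subseteq> cells n" "conn (cells m :: ('i::finite \<Rightarrow> nat) set)"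
  shows "conn {v \<in> cells (n + m). anc m v \<in> (E :: ('i \<Rightarrow> nat) set)}"
proof -
  have "{v \<in> cells (n + m). anc m v \<in> E} = {v \<in> cells (n + m). anc m v \<in> E \<and> fold_cell m v \<in> cells m}"
    using fold_cells by blast
  then show ?thesis
    using conn_blocks[OF assms(1,2,3) order_refl _ cells_faces] cells_faces(1)[of m] by auto
qed

lemma conn_cells: "conn (cells m :: ('i::finite \<Rightarrow> nat) set)"
proof (induction m)
  case 0
  then show ?case by (simp add: cells_0)
next
  case (Suc m)
  have "{v \<in> cells (m + 1). anc 1 v \<in> cells m} = (cells (Suc m) :: ('i \<Rightarrow> nat) set)"
    using anc_cells[of _ m 1] by auto
  moreover have "conn {v \<in> cells (m + 1). anc 1 v \<in> (cells m :: ('i \<Rightarrow> nat) set)}"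
    by (rule conn_subcells_aux[OF Suc order_refl conn_cells_1])
  ultimately show ?case by simp
qed

lemma conn_subcells:
  "conn E \<Longrightarrow> E \<subseteq> cells n \<Longrightarrow> conn {v \<in> cells (n + m). anc m v \<in> E}"
  by (rule conn_subcells_aux[OF _ _ conn_cells])


section \<open>The modulus of crossing sets\<close>

definition cross :: "'i::finite \<Rightarrow> nat \<Rightarrow> ('i::finite \<Rightarrow> nat) set set" where
  "cross a n = {S. S \<subseteq> cells n \<and> conn S \<and> (\<exists>u\<in>S. u a = 0) \<and> (\<exists>u\<in>S. u a = 3 ^ n - 1)}"

definition adm :: "'i::finite \<Rightarrow> nat \<Rightarrow> (('i::finite \<Rightarrow> nat) \<Rightarrow> real) \<Rightarrow> bool" where
  "adm a n \<rho> \<longleftrightarrow> (\<forall>v. 0 \<le> \<rho> v) \<and> (\<forall>S\<in>cross a n. 1 \<le> sum \<rho> S)"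

definition mass :: "real \<Rightarrow> nat \<Rightarrow> (('i::finite \<Rightarrow> nat) \<Rightarrow> real) \<Rightarrow> real" where
  "mass p n \<rho> = (\<Sum>v\<in>cells n. \<rho> v powr p)"

definition cross_mod :: "'i::finite \<Rightarrow> real \<Rightarrow> nat \<Rightarrow> real" where
  "cross_mod a p n = Inf (mass p n ` {\<rho>. adm a n \<rho>})"

lemma mass_nonneg: "0 \<le> mass p n \<rho>"
  by (simp add: mass_def sum_nonneg)

lemma finite_cross [simp]: "finite (cross a n)"
  by (rule finite_subset[of _ "Pow (cells n)"]) (auto simp: cross_def)

lemma cells_cross: "cells n \<in> cross a n"
  using cells_faces[of n a] conn_cells by (auto simp: cross_def)

lemma cross_nonempty: "S \<in> cross a n \<Longrightarrow> S \<noteq> {}"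
  by (auto simp: cross_def)

lemma cross_finite: "S \<in> cross a n \<Longrightarrow> finite S"
  by (auto simp: cross_def intro: finite_subset)

lemma adm_one: "adm a n (\<lambda>_. 1)"
proof -
  have "1 \<le> card S" if "S \<in> cross a n" for S :: "('a \<Rightarrow> nat) set"
    using cross_nonempty[OF that] cross_finite[OF that]
    by (metis One_nat_def Suc_leI card_gt_0_iff)
  then show ?thesis by (auto simp: adm_def)
qed

lemma cross_mod_le: "adm a n \<rho> \<Longrightarrow> cross_mod a p n \<le> mass p n \<rho>"
  unfolding cross_mod_def by (rule cINF_lower) (auto simp: bdd_below_def intro: mass_nonneg)

lemma cross_mod_greatest: "(\<And>\<rho>. adm a n \<rho> \<Longrightarrow> x \<le> mass p n \<rho>) \<Longrightarrow> x \<le> cross_mod a p n"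
  unfolding cross_mod_def using adm_one by (intro cINF_greatest) auto

lemma cross_mod_approx: "cross_mod a p n < x \<Longrightarrow> \<exists>\<rho>. adm a n \<rho> \<and> mass p n \<rho> < x"
  using cross_mod_greatest[of a n x p] by (meson not_less)

lemma cells_nonempty: "cells n \<noteq> ({} :: ('i::finite \<Rightarrow> nat) set)"
  using cells_cross[of n undefined] cross_nonempty by blast

lemma card_cells_pos: "0 < real (card (cells n :: ('i::finite \<Rightarrow> nat) set))"
proof -
  have "0 < card (cells n :: ('i \<Rightarrow> nat) set)"
    unfolding card_gt_0_iff using cells_nonempty by blast
  then show ?thesis by (simp only: of_nat_0_less_iff)
qed

lemma cross_mod_pos:
  fixes a :: "'i::finite"
  assumes "p > 0"
  shows "0 < cross_mod a p n"
proof -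
  define c where "c = real (card (cells n :: ('i \<Rightarrow> nat) set))"
  have c: "c > 0" unfolding c_def by (rule card_cells_pos)
  have "(1 / c) powr p \<le> cross_mod a p n"
  proof (rule cross_mod_greatest)
    fix \<rho> :: "('i \<Rightarrow> nat) \<Rightarrow> real" assume adm: "adm a n \<rho>"
    have "\<exists>v\<in>cells n. 1 / c \<le> \<rho> v"
    proof (rule ccontr)
      assume "\<not> ?thesis"
      then have "sum \<rho> (cells n) < (\<Sum>v\<in>(cells n :: ('i \<Rightarrow> nat) set). 1 / c)"
        using cells_nonempty by (intro sum_strict_mono) auto
      also have "\<dots> = c * (1 / c)" unfolding c_def by (rule sum_constant)
      also have "\<dots> = 1" using c by simp
      finally show False using adm cells_cross by (force simp: adm_def)
    qed
    then obtain v where v: "v \<in> cells n" "1 / c \<le> \<rho> v" by blast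
    have "(1 / c) powr p \<le> \<rho> v powr p" using v assms c by (intro powr_mono2) auto
    also have "\<dots> \<le> mass p n \<rho>" unfolding mass_def
      using v by (intro member_le_sum) auto
    finally show "(1 / c) powr p \<le> mass p n \<rho>" .
  qed
  moreover have "0 < (1 / c) powr p" using c by simp
  ultimately show ?thesis by linarith
qed

lemma powr_sum_le:
  fixes x :: "'b \<Rightarrow> real"
  assumes I: "finite I" and x: "\<And>i. i \<in> I \<Longrightarrow> 0 \<le> x i" and p: "p > 0"
    and K: "real (card {i \<in> I. x i \<noteq> 0}) \<le> K"
  shows "(sum x I) powr p \<le> K powr p * (\<Sum>i\<in>I. x i powr p)"
proof (cases "{i \<in> I. x i \<noteq> 0} = {}")
  case True
  then have "sum x I = 0" by (intro sum.neutral) auto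
  then show ?thesis by (simp add: sum_nonneg)
next
  case False
  let ?J = "{i \<in> I. x i \<noteq> 0}"
  have J: "finite ?J" using I by auto
  define M where "M = Max (x ` ?J)"
  have "M \<in> x ` ?J" unfolding M_def using J False by (intro Max_in) auto
  then obtain i where i: "i \<in> I" "M = x i" by auto
  have "sum x I = sum x ?J" using I by (intro sum.mono_neutral_right) auto
  also have "\<dots> \<le> (\<Sum>i\<in>?J. M)" unfolding M_def using J by (intro sum_mono) auto
  also have "\<dots> = real (card ?J) * M" by simp
  also have "\<dots> \<le> K * M" using K x[of i] i by (intro mult_right_mono) auto
  finally have "sum x I powr p \<le> (K * M) powr p"
    using p x by (intro powr_mono2 sum_nonneg) auto
  also have "\<dots> = K powr p * x i powr p" using i K x[of i] by (simp add: powr_mult)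
  also have "x i powr p \<le> (\<Sum>i\<in>I. x i powr p)" using i I by (intro member_le_sum) auto
  finally show ?thesis by (simp add: mult_left_mono)
qed

lemma card_near:
  fixes e :: "'i::finite \<Rightarrow> nat"
  shows "finite {w. near r e w}" "card {w. near r e w} \<le> (2 * r + 1) ^ CARD('i)"
    "card {w. near r w e} \<le> (2 * r + 1) ^ CARD('i)"
proof -
  have sub: "{w. near r e w} \<subseteq> PiE UNIV (\<lambda>i. {e i - r..e i + r})"
  proof
    fix w assume "w \<in> {w. near r e w}"
    then have "e i \<le> w i + r \<and> w i \<le> e i + r" for i by (auto simp: near_def)
    then have "w i \<in> {e i - r..e i + r}" for i by (simp add: le_diff_conv)
    then show "w \<in> PiE UNIV (\<lambda>i. {e i - r..e i + r})" by auto
  qed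
  have fin: "finite (PiE UNIV (\<lambda>i. {e i - r..e i + r}))" by (auto intro: finite_PiE)
  show "finite {w. near r e w}" using finite_subset[OF sub fin] .
  have "card {w. near r e w} \<le> card (PiE UNIV (\<lambda>i. {e i - r..e i + r}))"
    by (rule card_mono[OF fin sub])
  also have "\<dots> = (\<Prod>i\<in>UNIV. card {e i - r..e i + r})" by (rule card_PiE) simp
  also have "\<dots> \<le> (\<Prod>i\<in>(UNIV::'i set). 2 * r + 1)" by (intro prod_mono) auto
  finally show *: "card {w. near r e w} \<le> (2 * r + 1) ^ CARD('i)" by simp
  have "{w. near r w e} = {w. near r e w}" using near_sym by blast
  then show "card {w. near r w e} \<le> (2 * r + 1) ^ CARD('i)" using * by simp
qed

lemma sum_fold_le:
  fixes h :: "('i::finite \<Rightarrow> nat) \<Rightarrow> real"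
  assumes E: "finite E" and A: "A \<subseteq> cells l" "anc m ` A \<subseteq> E" and h: "\<And>u. 0 \<le> h u"
  shows "(\<Sum>v\<in>A. h (fold_cell m v)) \<le> real (card E) * (\<Sum>u\<in>cells m. h u)"
proof -
  let ?f = "\<lambda>v. (anc m v, fold_cell m v)"
  have inj: "inj_on ?f A"
    by (intro inj_on_inverseI[where g = "\<lambda>(e, u). lift_cell m e u"]) (simp add: lift_fold)
  have "(\<Sum>v\<in>A. h (fold_cell m v)) = (\<Sum>z\<in>?f ` A. h (snd z))"
    using inj by (simp add: sum.reindex)
  also have "\<dots> \<le> (\<Sum>z\<in>E \<times> cells m. h (snd z))"
  proof (rule sum_mono2)
    show "?f ` A \<subseteq> E \<times> cells m"
    proof
      fix z assume "z \<in> ?f ` A"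
      then obtain v where "v \<in> A" "z = ?f v" by blast
      then show "z \<in> E \<times> cells m" using A fold_cells[of v l m] by auto
    qed
  qed (use E h in auto)
  also have "\<dots> = (\<Sum>e\<in>E. \<Sum>u\<in>cells m. h u)"
    by (subst sum.cartesian_product) (auto intro!: sum.cong)
  finally show ?thesis by simp
qed

section \<open>Collars and submultiplicativity\<close>

text \<open>Folding an admissible weight of the unit cube into the annulus between the \<open>r\<close>- and the
  \<open>(r + 1)\<close>-neighbourhood of the block \<open>e\<close> gives a weight that is admissible for the
  sets crossing this annulus.\<close>
definition collar :: "'i::finite \<Rightarrow> nat \<Rightarrow> (('i::finite \<Rightarrow> nat) \<Rightarrow> real) \<Rightarrow> nat \<Rightarrow> ('i \<Rightarrow> nat) \<Rightarrow> ('i \<Rightarrow> nat) \<Rightarrow> real" where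
  "collar a m \<rho> r e v =
     (if near (r + 1) e (anc m v) \<and> \<not> near r e (anc m v)
      then \<Sum>i\<in>UNIV. \<rho> (swap_cell a i (fold_cell m v)) else 0)"

lemma block_edge:
  fixes s t N :: nat
  assumes "t \<le> s + 1" "s \<le> t + 1" "t div N \<noteq> s div N" "N > 0"
  shows "s div N = t div N + 1 \<and> t mod N = N - 1 \<or> t div N = s div N + 1 \<and> t mod N = 0"
proof -
  have "t = Suc s \<or> s = Suc t" using assms by (metis Suc_eq_plus1 le_SucE le_antisym)
  then show ?thesis
    using div_Suc_cases[OF assms(4), of s] div_Suc_cases[OF assms(4), of t] assms(3) by auto
qed

lemma collar_nonneg: "adm a m \<rho> \<Longrightarrow> 0 \<le> collar a m \<rho> r e v"
  by (auto simp: collar_def adm_def intro: sum_nonneg)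

lemma exit_block:
  fixes e :: "'i::finite \<Rightarrow> nat"
  assumes S: "conn S"
    and x: "x \<in> S" "near r e (anc m x)" and y: "y \<in> S" "\<not> near (r + 1) e (anc m y)"
  obtains S0 w i where "conn S0" "S0 \<subseteq> S" "x \<in> S0" "w \<in> S0"
    "\<forall>v\<in>S0. near (r + 1) e (anc m v)"
    "w i div 3 ^ m = e i + (r + 1) \<and> w i mod 3 ^ m = 3 ^ m - 1 \<or>
     e i = w i div 3 ^ m + (r + 1) \<and> w i mod 3 ^ m = 0"
proof -
  define S1 where "S1 = {v \<in> S. near (r + 1) e (anc m v)}"
  have xS1: "x \<in> S1" using x near_mono[of r e "anc m x" "r + 1"] by (auto simp: S1_def)
  define S0 where "S0 = comp S1 x"
  have S0: "conn S0" "S0 \<subseteq> S1" "x \<in> S0"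
    unfolding S0_def using conn_comp comp_subset comp_self xS1 by blast+
  have "\<exists>w z. w \<in> S0 \<and> z \<in> S \<and> adj w z \<and> \<not> near (r + 1) e (anc m z)"
  proof (rule ccontr)
    assume no: "\<not> ?thesis"
    have "S0 = S"
    proof (rule connD[OF S])
      fix w z assume "w \<in> S0" "z \<in> S" "adj w z"
      then show "z \<in> S0" using no comp_closed[OF xS1, of w z] unfolding S0_def S1_def by blast
    qed (use S0 in \<open>auto simp: S1_def\<close>)
    then show False using y S0(2) by (auto simp: S1_def)
  qed
  then obtain w z where w: "w \<in> S0" and z: "z \<in> S" "adj w z" "\<not> near (r + 1) e (anc m z)" by blast
  obtain i where i: "\<forall>j. j \<noteq> i \<longrightarrow> w j = z j" "w i \<le> z i + 1" "z i \<le> w i + 1"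
    using z(2) by (auto simp: adj_def)
  have wn: "e j \<le> w j div 3 ^ m + (r + 1)" "w j div 3 ^ m \<le> e j + (r + 1)" for j
    using w S0 by (auto simp: S1_def near_def anc_def)
  have zi: "\<not> (e i \<le> z i div 3 ^ m + (r + 1) \<and> z i div 3 ^ m \<le> e i + (r + 1))"
    using z(3) i(1) wn unfolding near_def anc_def by metis
  then have "w i div 3 ^ m \<noteq> z i div 3 ^ m" using wn[of i] by auto
  from block_edge[OF i(2,3) this]
  have "w i div 3 ^ m = e i + (r + 1) \<and> w i mod 3 ^ m = 3 ^ m - 1 \<or>
      e i = w i div 3 ^ m + (r + 1) \<and> w i mod 3 ^ m = 0"
    using zi wn[of i] by auto
  then show ?thesis using S0 w by (intro that[of S0 w i]) (auto simp: S1_def)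
qed

lemma collar_length:
  fixes a :: "'i::finite"
  assumes \<rho>: "adm a m \<rho>" and S: "S \<subseteq> cells l" "conn S"
    and x: "x \<in> S" "near r e (anc m x)" and y: "y \<in> S" "\<not> near (r + 1) e (anc m y)"
  shows "1 \<le> sum (collar a m \<rho> r e) S"
proof -
  obtain S0 w i where S0: "conn S0" "S0 \<subseteq> S" "x \<in> S0" and w: "w \<in> S0"
    and near0: "\<forall>v\<in>S0. near (r + 1) e (anc m v)"
    and edge: "w i div 3 ^ m = e i + (r + 1) \<and> w i mod 3 ^ m = 3 ^ m - 1 \<or>
      e i = w i div 3 ^ m + (r + 1) \<and> w i mod 3 ^ m = 0"
    by (rule exit_block[OF S(2) x y]) (rule that, assumption+)
  define q where "q = w i div 3 ^ m"
  have we: "q = e i + (r + 1) \<and> w i mod 3 ^ m = 3 ^ m - 1 \<or> e i = q + (r + 1) \<and> w i mod 3 ^ m = 0"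
    using edge by (simp add: q_def)
  define S2 where "S2 = {v \<in> S0. v i div 3 ^ m = q}"
  have wS2: "w \<in> S2" using w by (auto simp: S2_def q_def)
  define T where "T = comp S2 w"
  have T: "conn T" "T \<subseteq> S2" "w \<in> T"
    unfolding T_def using conn_comp comp_subset comp_self wS2 by blast+
  have xq: "x i div 3 ^ m \<noteq> q" using x(2) we by (auto simp: near_def anc_def dest: spec[of _ i])
  have "\<exists>t s. t \<in> T \<and> s \<in> S0 \<and> adj t s \<and> s i div 3 ^ m \<noteq> q"
  proof (rule ccontr)
    assume no: "\<not> ?thesis"
    have "T = S0"
    proof (rule connD[OF S0(1)])
      fix t s assume "t \<in> T" "s \<in> S0" "adj t s"
      then show "s \<in> T" using no comp_closed[OF wS2, of t s] unfolding T_def S2_def by blast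
    qed (use T in \<open>auto simp: S2_def\<close>)
    then show False using S0(3) T(2) xq by (auto simp: S2_def)
  qed
  then obtain t s where t: "t \<in> T" and s: "s \<in> S0" "adj t s" "s i div 3 ^ m \<noteq> q" by blast
  have tq: "t i div 3 ^ m = q" using t T(2) by (auto simp: S2_def)
  obtain j where "\<forall>k. k \<noteq> j \<longrightarrow> t k = s k" "t j \<le> s j + 1" "s j \<le> t j + 1"
    using s(2) by (auto simp: adj_def)
  moreover from this have "j = i" using tq s(3) by metis
  ultimately have ts: "t i \<le> s i + 1" "s i \<le> t i + 1" by auto
  have sn: "e i \<le> s i div 3 ^ m + (r + 1)" "s i div 3 ^ m \<le> e i + (r + 1)"
    using bspec[OF near0 s(1)] by (auto simp: near_def anc_def)
  have te: "q = e i + (r + 1) \<and> t i mod 3 ^ m = 0 \<or> e i = q + (r + 1) \<and> t i mod 3 ^ m = 3 ^ m - 1"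
    using block_edge[OF ts, of "3 ^ m"] tq s(3) sn we by auto
  let ?f = "\<lambda>v. swap_cell a i (fold_cell m v)"
  have TS: "T \<subseteq> S" using T S0 by (auto simp: S2_def)
  have finS: "finite S" using S finite_subset by blast
  then have finT: "finite T" using TS finite_subset by blast
  have zz: "zigzag m (t i) = 0 \<and> zigzag m (w i) = 3 ^ m - 1 \<or>
      zigzag m (t i) = 3 ^ m - 1 \<and> zigzag m (w i) = 0"
  proof -
    have zt: "zigzag m (t i) = (if even q then t i mod 3 ^ m else 3 ^ m - 1 - t i mod 3 ^ m)"
      unfolding zigzag_def tq ..
    have zw: "zigzag m (w i) = (if even q then w i mod 3 ^ m else 3 ^ m - 1 - w i mod 3 ^ m)"
      unfolding zigzag_def q_def ..
    have "t i mod 3 ^ m = 0 \<and> w i mod 3 ^ m = 3 ^ m - 1 \<or> t i mod 3 ^ m = 3 ^ m - 1 \<and> w i mod 3 ^ m = 0"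
      using we te by linarith
    then show ?thesis unfolding zt zw by (elim disjE conjE) simp_all
  qed
  have app: "?f v a = zigzag m (v i)" for v
    by (simp add: swap_cell_apply fold_cell_def)
  have "?f ` T \<in> cross a m"
    unfolding cross_def
  proof (safe)
    show "conn (?f ` T)" using T(1) by (intro conn_image adj_swap adj_fold)
    show "\<exists>u\<in>?f ` T. u a = 0" using zz t T(3) by (auto simp: app)
    show "\<exists>u\<in>?f ` T. u a = 3 ^ m - 1" using zz t T(3) by (auto simp: app)
    fix v assume "v \<in> T"
    then show "?f v \<in> cells m" using TS S by (blast intro: swap_cells fold_cells)
  qed
  then have "1 \<le> sum \<rho> (?f ` T)" using \<rho> by (simp add: adm_def)
  also have "\<dots> \<le> (\<Sum>v\<in>T. \<rho> (?f v))"
    using sum_image_le[OF finT, of \<rho> ?f] \<rho> by (simp add: adm_def comp_def)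
  also have "\<dots> \<le> sum (collar a m \<rho> r e) T"
  proof (rule sum_mono)
    fix v assume "v \<in> T"
    then have "v i div 3 ^ m = q" "near (r + 1) e (anc m v)"
      using T(2) near0 by (auto simp: S2_def)
    moreover have "\<not> near r e (anc m v)"
      using calculation(1) we unfolding near_def anc_def by (metis add.assoc add_le_same_cancel1 not_one_le_zero)
    ultimately have "collar a m \<rho> r e v = (\<Sum>j\<in>UNIV. \<rho> (swap_cell a j (fold_cell m v)))"
      by (simp add: collar_def)
    then show "\<rho> (?f v) \<le> collar a m \<rho> r e v"
      using member_le_sum[of i UNIV "\<lambda>j. \<rho> (swap_cell a j (fold_cell m v))"] \<rho>
      by (simp add: adm_def)
  qed
  also have "\<dots> \<le> sum (collar a m \<rho> r e) S"
    using TS finS collar_nonneg[OF \<rho>] by (intro sum_mono2) auto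
  finally show ?thesis .
qed

lemma sum_swap_cells:
  fixes h :: "('i::finite \<Rightarrow> nat) \<Rightarrow> 'b::comm_monoid_add"
  shows "(\<Sum>u\<in>cells m. h (swap_cell a i u)) = sum h (cells m)"
  by (rule sum.reindex_bij_betw[OF swap_cell_bij])

lemma collar_mass:
  fixes a :: "'i::finite"
  assumes \<rho>: "adm a m \<rho>" and p: "p > 0"
  shows "(\<Sum>v\<in>cells l. collar a m \<rho> r e v powr p)
    \<le> real CARD('i) powr p * real CARD('i) * real ((2 * r + 3) ^ CARD('i)) * mass p m \<rho>"
proof -
  let ?d = "real CARD('i)"
  define E where "E = {w. near (r + 1) e w}"
  define A where "A = {v \<in> cells l. anc m v \<in> E}"
  have nn: "0 \<le> \<rho> u" for u using \<rho> by (simp add: adm_def)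
  have E: "finite E" "real (card E) \<le> real ((2 * r + 3) ^ CARD('i))"
    using card_near(1,2)[of "r + 1" e] unfolding E_def
    by (auto simp: algebra_simps numeral_3_eq_3 simp del: of_nat_power)
  have "(\<Sum>v\<in>cells l. collar a m \<rho> r e v powr p)
      \<le> (\<Sum>v\<in>cells l. if v \<in> A then ?d powr p * (\<Sum>i\<in>UNIV. \<rho> (swap_cell a i (fold_cell m v)) powr p) else 0)"
  proof (rule sum_mono)
    fix v assume v: "v \<in> (cells l :: ('i \<Rightarrow> nat) set)"
    have "(\<Sum>i\<in>UNIV. \<rho> (swap_cell a i (fold_cell m v))) powr p
      \<le> ?d powr p * (\<Sum>i\<in>UNIV. \<rho> (swap_cell a i (fold_cell m v)) powr p)"
      using nn p by (intro powr_sum_le) (auto intro: card_mono)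
    moreover have "0 \<le> ?d powr p * (\<Sum>i\<in>UNIV. \<rho> (swap_cell a i (fold_cell m v)) powr p)"
      by (simp add: sum_nonneg)
    ultimately show "collar a m \<rho> r e v powr p \<le> (if v \<in> A then ?d powr p *
        (\<Sum>i\<in>UNIV. \<rho> (swap_cell a i (fold_cell m v)) powr p) else 0)"
      using v by (auto simp: collar_def A_def E_def)
  qed
  also have "\<dots> = (\<Sum>v\<in>A. ?d powr p * (\<Sum>i\<in>UNIV. \<rho> (swap_cell a i (fold_cell m v)) powr p))"
    by (subst sum.inter_filter[symmetric]) (auto simp: A_def intro!: sum.cong)
  also have "\<dots> = ?d powr p * (\<Sum>i\<in>UNIV. \<Sum>v\<in>A. \<rho> (swap_cell a i (fold_cell m v)) powr p)"
    by (simp add: sum_distrib_left[symmetric] sum.swap[of _ A])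
  also have "\<dots> \<le> ?d powr p * (\<Sum>i\<in>(UNIV::'i set). real (card E) * mass p m \<rho>)"
  proof (intro mult_left_mono sum_mono)
    fix i :: 'i
    have "(\<Sum>v\<in>A. \<rho> (swap_cell a i (fold_cell m v)) powr p)
        \<le> real (card E) * (\<Sum>u\<in>cells m. \<rho> (swap_cell a i u) powr p)"
      by (rule sum_fold_le[OF E(1)]) (auto simp: A_def)
    then show "(\<Sum>v\<in>A. \<rho> (swap_cell a i (fold_cell m v)) powr p) \<le> real (card E) * mass p m \<rho>"
      by (simp add: mass_def sum_swap_cells[of "\<lambda>u. \<rho> u powr p"])
  qed simp
  also have "\<dots> = ?d powr p * ?d * real (card E) * mass p m \<rho>" by simp
  also have "\<dots> \<le> ?d powr p * ?d * real ((2 * r + 3) ^ CARD('i)) * mass p m \<rho>"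
    using E(2) by (intro mult_right_mono mult_left_mono mass_nonneg) auto
  finally show ?thesis .
qed

lemma cross_mod_submult_aux:
  fixes a :: "'i::finite"
  assumes n: "n \<ge> 2" and \<sigma>: "adm a n \<sigma>" and \<rho>: "adm a m \<rho>" and p: "p > 0"
  shows "cross_mod a p (n + m) \<le> real (3 ^ CARD('i)) powr p *
    (real CARD('i) powr p * real CARD('i) * real (3 ^ CARD('i))) * (mass p n \<sigma> * mass p m \<rho>)"
proof -
  let ?D = "real (3 ^ CARD('i))"
  let ?K = "real CARD('i) powr p * real CARD('i) * ?D"
  define \<tau> where "\<tau> v = (\<Sum>e\<in>cells n. \<sigma> e * collar a m \<rho> 0 e v)" for v
  have nn: "0 \<le> \<sigma> e * collar a m \<rho> 0 e v" for e v
    using \<sigma> collar_nonneg[OF \<rho>] by (simp add: adm_def)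
  have \<tau>nn: "0 \<le> \<tau> v" for v unfolding \<tau>_def by (intro sum_nonneg nn)
  have "adm a (n + m) \<tau>"
    unfolding adm_def
  proof (intro conjI allI ballI \<tau>nn)
    fix S assume S: "S \<in> cross a (n + m)"
    then have Sc: "S \<subseteq> cells (n + m)" "conn S" by (auto simp: cross_def)
    obtain u w where u: "u \<in> S" "u a = 0" and w: "w \<in> S" "w a = 3 ^ (n + m) - 1"
      using S by (auto simp: cross_def)
    have "w a = (3 ^ n - 1) * 3 ^ m + (3 ^ m - 1)"
      using w(2) by (simp add: power_add algebra_simps)
    moreover have "((3 ^ n - 1) * 3 ^ m + (3 ^ m - 1)) div 3 ^ m = (3 ^ n - 1 :: nat)"
      by (subst div_mult_self3) auto
    ultimately have wa: "anc m w a = 3 ^ n - 1" by (simp add: anc_def)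
    have ua: "anc m u a = 0" using u by (simp add: anc_def)
    have n9: "(3::nat) ^ n \<ge> 9" using power_increasing[OF n, of "3::nat"] by simp
    have T: "anc m ` S \<in> cross a n"
      unfolding cross_def
    proof (intro CollectI conjI)
      show "anc m ` S \<subseteq> cells n" using Sc(1) anc_cells by blast
      show "conn (anc m ` S)" using Sc(2) adj_anc by (rule conn_image)
      show "\<exists>e\<in>anc m ` S. e a = 0" using u(1) ua by blast
      show "\<exists>e\<in>anc m ` S. e a = 3 ^ n - 1" using w(1) wa by blast
    qed
    then have "1 \<le> sum \<sigma> (anc m ` S)" using \<sigma> by (simp add: adm_def)
    also have "\<dots> \<le> (\<Sum>e\<in>anc m ` S. \<sigma> e * sum (collar a m \<rho> 0 e) S)"
    proof (rule sum_mono)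
      fix e assume "e \<in> anc m ` S"
      then obtain x where x: "x \<in> S" "e = anc m x" by blast
      have "\<exists>y\<in>S. \<not> near (0 + 1) e (anc m y)"
      proof (rule ccontr)
        assume "\<not> ?thesis"
        then have "near 1 e (anc m u)" "near 1 e (anc m w)" using u w by auto
        then have "e a \<le> 1" "3 ^ n - 1 \<le> e a + 1" by (auto simp: near_def ua wa dest: spec[of _ a])
        then show False using n9 by simp
      qed
      then obtain y where y: "y \<in> S" "\<not> near (0 + 1) e (anc m y)" by blast
      have "near 0 e (anc m x)" by (simp add: x)
      from collar_length[OF \<rho> Sc x(1) this y]
      show "\<sigma> e \<le> \<sigma> e * sum (collar a m \<rho> 0 e) S"
        using \<sigma> mult_left_mono[of 1 "sum (collar a m \<rho> 0 e) S" "\<sigma> e"] by (simp add: adm_def)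
    qed
    also have "\<dots> \<le> (\<Sum>e\<in>cells n. \<sigma> e * sum (collar a m \<rho> 0 e) S)"
      using T \<sigma> collar_nonneg[OF \<rho>]
      by (intro sum_mono2) (auto simp: cross_def adm_def intro!: mult_nonneg_nonneg sum_nonneg)
    also have "\<dots> = sum \<tau> S"
      unfolding \<tau>_def sum_distrib_left by (rule sum.swap)
    finally show "1 \<le> sum \<tau> S" .
  qed
  then have "cross_mod a p (n + m) \<le> mass p (n + m) \<tau>" by (rule cross_mod_le)
  also have "\<dots> \<le> (\<Sum>v\<in>cells (n + m). ?D powr p * (\<Sum>e\<in>cells n. (\<sigma> e * collar a m \<rho> 0 e v) powr p))"
    unfolding mass_def
  proof (rule sum_mono)
    fix v
    have "{e \<in> cells n. \<sigma> e * collar a m \<rho> 0 e v \<noteq> 0} \<subseteq> {e. near 1 e (anc m v)}"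
      by (auto simp: collar_def split: if_splits)
    moreover have "{e. near 1 e (anc m v)} = {e. near 1 (anc m v) e}" using near_sym by blast
    then have fin: "finite {e. near 1 e (anc m v)}" using card_near(1)[of 1 "anc m v"] by simp
    ultimately have "card {e \<in> cells n. \<sigma> e * collar a m \<rho> 0 e v \<noteq> 0} \<le> card {e. near 1 e (anc m v)}"
      by (intro card_mono)
    also have "\<dots> \<le> (2 * 1 + 1) ^ CARD('i)" by (rule card_near(3))
    also have "(2 * 1 + 1 :: nat) = 3" by simp
    finally show "\<tau> v powr p \<le> ?D powr p * (\<Sum>e\<in>cells n. (\<sigma> e * collar a m \<rho> 0 e v) powr p)"
      unfolding \<tau>_def using nn p by (intro powr_sum_le) (auto simp del: of_nat_power)
  qed
  also have "\<dots> = ?D powr p * (\<Sum>e\<in>cells n. \<sigma> e powr p * (\<Sum>v\<in>cells (n + m). collar a m \<rho> 0 e v powr p))"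
  proof -
    have "(\<Sum>v\<in>cells (n + m). \<Sum>e\<in>cells n. (\<sigma> e * collar a m \<rho> 0 e v) powr p)
        = (\<Sum>e\<in>cells n. \<Sum>v\<in>cells (n + m). (\<sigma> e * collar a m \<rho> 0 e v) powr p)"
      by (rule sum.swap)
    also have "\<dots> = (\<Sum>e\<in>cells n. \<sigma> e powr p * (\<Sum>v\<in>cells (n + m). collar a m \<rho> 0 e v powr p))"
      using \<sigma> collar_nonneg[OF \<rho>] by (simp add: sum_distrib_left powr_mult adm_def)
    finally show ?thesis by (simp only: sum_distrib_left[symmetric])
  qed
  also have "\<dots> \<le> ?D powr p * (\<Sum>e\<in>cells n. \<sigma> e powr p * (?K * mass p m \<rho>))"
    using collar_mass[OF \<rho> p, where l = "n + m" and r = 0] by (intro mult_left_mono sum_mono) auto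
  also have "\<dots> = ?D powr p * ?K * (mass p n \<sigma> * mass p m \<rho>)"
    unfolding mass_def[of p n \<sigma>] sum_distrib_right[symmetric] by (simp only: mult_ac)
  finally show ?thesis .
qed

lemma cross_mod_submult:
  fixes a :: "'i::finite"
  assumes n: "n \<ge> 2" and p: "p > 0"
  shows "cross_mod a p (n + m) \<le> real (3 ^ CARD('i)) powr p *
    (real CARD('i) powr p * real CARD('i) * real (3 ^ CARD('i))) * (cross_mod a p n * cross_mod a p m)"
    (is "_ \<le> ?C * _")
proof -
  have C: "?C > 0" by simp
  have pos: "mass p k \<rho> > 0" if "adm a k \<rho>" for k \<rho>
    using cross_mod_le[OF that, of p] cross_mod_pos[OF p, of a k] by linarith
  have A: "cross_mod a p (n + m) / (?C * mass p m \<rho>) \<le> cross_mod a p n" if \<rho>: "adm a m \<rho>" for \<rho>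
  proof (rule cross_mod_greatest)
    fix \<sigma> assume "adm a n \<sigma>"
    from cross_mod_submult_aux[OF n this \<rho> p]
    show "cross_mod a p (n + m) / (?C * mass p m \<rho>) \<le> mass p n \<sigma>"
      using C pos[OF \<rho>] by (simp add: divide_le_eq mult_ac del: of_nat_power)
  qed
  have "cross_mod a p (n + m) / (?C * cross_mod a p n) \<le> mass p m \<rho>" if "adm a m \<rho>" for \<rho>
  proof -
    have "?C * mass p m \<rho> > 0" using C pos[OF that] by (rule mult_pos_pos)
    then have "cross_mod a p (n + m) \<le> cross_mod a p n * (?C * mass p m \<rho>)"
      using A[OF that] by (simp only: divide_le_eq if_True)
    also have "\<dots> = mass p m \<rho> * (?C * cross_mod a p n)" by (simp only: mult_ac)
    finally show ?thesis
      using mult_pos_pos[OF C cross_mod_pos[OF p, of a n]] by (simp only: divide_le_eq if_True)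
  qed
  then have "cross_mod a p (n + m) / (?C * cross_mod a p n) \<le> cross_mod a p m"
    by (rule cross_mod_greatest)
  then have "cross_mod a p (n + m) \<le> cross_mod a p m * (?C * cross_mod a p n)"
    using mult_pos_pos[OF C cross_mod_pos[OF p, of a n]] by (simp only: divide_le_eq if_True)
  then show ?thesis by (simp only: mult_ac)
qed


section \<open>Duality\<close>

lemma powr_slope_tendsto:
  fixes x y q :: real
  assumes x: "x \<ge> 0" and y: "y \<ge> 0" and q: "q > 1"
  shows "((\<lambda>t. ((x + t * (y - x)) powr q - x powr q) / t) \<longlongrightarrow> q * x powr (q - 1) * (y - x)) (at_right 0)"
proof (cases "x = 0")
  case True
  have "((\<lambda>t. t powr (q - 1) * y powr q) \<longlongrightarrow> 0 powr (q - 1) * y powr q) (at_right 0)"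
    using q eventually_at_right_less[of "0::real"]
    by (intro tendsto_mult tendsto_powr' tendsto_const tendsto_ident_at)
      (auto elim: eventually_mono)
  moreover have "eventually (\<lambda>t. t powr (q - 1) * y powr q = ((x + t * (y - x)) powr q - x powr q) / t) (at_right 0)"
    using eventually_at_right_less[of 0]
  proof eventually_elim
    case (elim t)
    then show ?case using True y q by (simp add: powr_mult powr_diff)
  qed
  ultimately show ?thesis
    using True q by (simp add: filterlim_cong)
next
  case False
  then have "((\<lambda>t. (x + t * (y - x)) powr q) has_real_derivative
      (q * (x + 0 * (y - x)) powr (q - 1)) * (0 + 1 * (y - x))) (at 0 within {0<..})"
    using x by (intro derivative_eq_intros | simp)+
  then show ?thesis
    by (simp add: has_field_derivative_iff)
qed

lemma holder_sum:
  fixes f g :: "'b \<Rightarrow> real"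
  assumes X: "finite X" and p: "p > 1" and q: "q > 1" "1 / p + 1 / q = 1"
    and f: "\<And>x. x \<in> X \<Longrightarrow> 0 \<le> f x" and g: "\<And>x. x \<in> X \<Longrightarrow> 0 \<le> g x"
  shows "(\<Sum>x\<in>X. f x * g x) \<le> (\<Sum>x\<in>X. f x powr p) powr (1 / p) * (\<Sum>x\<in>X. g x powr q) powr (1 / q)"
proof -
  let ?A = "\<Sum>x\<in>X. f x powr p" and ?B = "\<Sum>x\<in>X. g x powr q"
  show ?thesis
  proof (cases "?A = 0 \<or> ?B = 0")
    case True
    then have "f x * g x = 0" if "x \<in> X" for x
      using that X by (auto simp: sum_nonneg_eq_0_iff)
    then have "(\<Sum>x\<in>X. f x * g x) = 0" by (rule sum.neutral[OF ballI])
    then show ?thesis by simp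
  next
    case False
    have A: "?A > 0" and B: "?B > 0"
      using False by (auto simp: less_le sum_nonneg)
    let ?a = "?A powr (1 / p)" and ?b = "?B powr (1 / q)"
    have ab: "?a > 0" "?b > 0" using A B by auto
    have "(\<Sum>x\<in>X. f x / ?a * (g x / ?b)) \<le> (\<Sum>x\<in>X. (f x / ?a) powr p / p + (g x / ?b) powr q / q)"
      using f g ab p q by (intro sum_mono Youngs_inequality) auto
    also have "\<dots> = (\<Sum>x\<in>X. f x powr p / (?A * p)) + (\<Sum>x\<in>X. g x powr q / (?B * q))"
      using f g p q A B by (simp add: sum.distrib powr_divide powr_powr)
    also have "\<dots> = ?A / (?A * p) + ?B / (?B * q)"
      by (simp add: sum_divide_distrib)
    also have "\<dots> = 1" using A B q by simp
    finally have "(\<Sum>x\<in>X. f x * g x) / (?a * ?b) \<le> 1" by (simp add: sum_divide_distrib)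
    then show ?thesis using ab by (simp add: divide_le_eq)
  qed
qed

text \<open>The optimal weights minimise the \<open>q\<close>-norm of the expected visiting numbers; the first-order
  condition at the minimum produces an admissible function.\<close>
lemma modulus_duality:
  fixes X :: "'x set" and F :: "'x set set" and p M :: real
  assumes X: "finite X" and F: "F \<subseteq> Pow X" "F \<noteq> {}" "{} \<notin> F" and p: "p > 1" and M: "M > 0"
    and adm: "\<And>\<rho>. (\<And>x. 0 \<le> \<rho> x) \<Longrightarrow> (\<And>S. S \<in> F \<Longrightarrow> 1 \<le> sum \<rho> S) \<Longrightarrow> M \<le> (\<Sum>x\<in>X. \<rho> x powr p)"
  shows "\<exists>w. (\<forall>S\<in>F. 0 \<le> w S) \<and> sum w F = 1 \<and>
    (\<forall>\<sigma>. (\<forall>x. 0 \<le> \<sigma> x) \<longrightarrow> (\<Sum>S\<in>F. w S * sum \<sigma> S) powr p \<le> (\<Sum>x\<in>X. \<sigma> x powr p) / M)"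
proof -
  define q where "q = p / (p - 1)"
  have q: "q > 1" "1 / p + 1 / q = 1" "(q - 1) * p = q"
    using p by (auto simp: q_def field_simps)
  have finF: "finite F" using X F finite_subset by blast
  define N where "N w x = (\<Sum>S\<in>F. if x \<in> S then w S else 0)" for w :: "'x set \<Rightarrow> real" and x
  define \<Psi> where "\<Psi> w = (\<Sum>x\<in>X. N w x powr q)" for w
  define W where "W = PiE UNIV (\<lambda>S. if S \<in> F then {0..1::real} else {0}) \<inter> {w. sum w F = 1}"
  have "compactin (product_topology (\<lambda>_. euclidean) UNIV) (PiE UNIV (\<lambda>S. if S \<in> F then {0..1::real} else {0}))"
    unfolding compactin_PiE by auto
  then have "compact (PiE UNIV (\<lambda>S. if S \<in> F then {0..1::real} else {0}))"
    unfolding euclidean_product_topology compactin_euclidean_iff .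
  moreover have "closed {w :: 'x set \<Rightarrow> real. sum w F = 1}"
    by (intro closed_Collect_eq continuous_on_sum continuous_on_const)
      (auto intro: continuous_on_product_coordinates)
  ultimately have W: "compact W" unfolding W_def by (rule compact_Int_closed)
  have Wnn: "0 \<le> w S" "w S \<le> 1" if "w \<in> W" "S \<in> F" for w S
    using that by (auto simp: W_def PiE_def Pi_def split: if_splits dest: spec[of _ S])
  have Wsum: "sum w F = 1" if "w \<in> W" for w using that by (simp add: W_def)
  have Nnn: "0 \<le> N w x" if "w \<in> W" for w x
    unfolding N_def using Wnn[OF that] by (intro sum_nonneg) auto
  have WI: "w \<in> W" if "\<And>S. S \<in> F \<Longrightarrow> 0 \<le> w S" "\<And>S. S \<notin> F \<Longrightarrow> w S = 0" "sum w F = 1" for w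
  proof -
    have "w S \<le> 1" if "S \<in> F" for S
      using member_le_sum[OF that, of w] finF \<open>sum w F = 1\<close> \<open>\<And>S. S \<in> F \<Longrightarrow> 0 \<le> w S\<close> by auto
    then show ?thesis using that by (auto simp: W_def)
  qed
  have "continuous_on W (\<lambda>w. N w x)" for x
    unfolding N_def
  proof (intro continuous_on_sum)
    fix S
    show "continuous_on W (\<lambda>w. if x \<in> S then w S else 0)"
      by (cases "x \<in> S") (auto intro: continuous_on_product_coordinates continuous_on_subset)
  qed
  then have "continuous_on W \<Psi>"
    unfolding \<Psi>_def using Nnn q
    by (intro continuous_on_sum continuous_on_powr' continuous_on_const) auto
  moreover obtain S1 where S1: "S1 \<in> F" using F by blast
  have "(\<lambda>S. if S = S1 then 1 else 0) \<in> W"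
    using S1 finF by (intro WI) (auto simp: sum.delta)
  then have "W \<noteq> {}" by blast
  ultimately obtain w where w: "w \<in> W" and min: "\<And>w'. w' \<in> W \<Longrightarrow> \<Psi> w \<le> \<Psi> w'"
    using continuous_attains_inf[OF W] by blast
  define E where "E = \<Psi> w"
  have sumN: "(\<Sum>S\<in>F. w S * sum \<sigma> S) = (\<Sum>x\<in>X. N w x * \<sigma> x)" for \<sigma>
  proof -
    have "(\<Sum>x\<in>X. N w x * \<sigma> x) = (\<Sum>x\<in>X. \<Sum>S\<in>F. if x \<in> S then w S * \<sigma> x else 0)"
      unfolding N_def sum_distrib_right by (intro sum.cong) auto
    also have "\<dots> = (\<Sum>S\<in>F. \<Sum>x\<in>X. if x \<in> S then w S * \<sigma> x else 0)" by (rule sum.swap)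
    also have "\<dots> = (\<Sum>S\<in>F. w S * sum \<sigma> S)"
    proof (rule sum.cong)
      fix S assume "S \<in> F"
      then have "X \<inter> S = S" using F by auto
      then show "(\<Sum>x\<in>X. if x \<in> S then w S * \<sigma> x else 0) = w S * sum \<sigma> S"
        using X by (simp add: sum.inter_restrict[symmetric] sum_distrib_left)
    qed simp
    finally show ?thesis ..
  qed
  have "E \<noteq> 0"
  proof
    assume "E = 0"
    then have "N w x = 0" if "x \<in> X" for x
      using that X unfolding E_def \<Psi>_def by (auto simp: sum_nonneg_eq_0_iff)
    then have "(\<Sum>S\<in>F. w S * sum (\<lambda>_. 1) S) = 0" unfolding sumN by simp
    moreover have "0 \<le> w S * sum (\<lambda>_. 1) S" if "S \<in> F" for S
      using Wnn[OF w that] by simp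
    ultimately have "w S * sum (\<lambda>_. 1) S = 0" if "S \<in> F" for S
      using that finF by (simp add: sum_nonneg_eq_0_iff)
    moreover have "sum (\<lambda>_. 1) S \<noteq> (0::real)" if "S \<in> F" for S
    proof -
      have "finite S" "S \<noteq> {}" using that F X finite_subset by blast+
      then show ?thesis by simp
    qed
    ultimately have "w S = 0" if "S \<in> F" for S using that by (metis mult_eq_0_iff)
    then show False using Wsum[OF w] by simp
  qed
  then have E: "E > 0" unfolding E_def \<Psi>_def by (simp add: less_le sum_nonneg)
  have first_order: "E \<le> (\<Sum>x\<in>S. N w x powr (q - 1))" if S: "S \<in> F" for S
  proof -
    define y where "y x = (if x \<in> S then 1 else 0 :: real)" for x
    define D where "D = (\<Sum>x\<in>X. q * N w x powr (q - 1) * (y x - N w x))"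
    have lim: "((\<lambda>t. \<Sum>x\<in>X. ((N w x + t * (y x - N w x)) powr q - N w x powr q) / t) \<longlongrightarrow> D) (at_right 0)"
      unfolding D_def using Nnn[OF w] q(1) by (intro tendsto_sum powr_slope_tendsto) (auto simp: y_def)
    have "eventually (\<lambda>t. t \<in> {0<..<1}) (at_right (0::real))"
      by (rule eventually_at_right_real) simp
    then have "eventually (\<lambda>t. 0 \<le> (\<Sum>x\<in>X. ((N w x + t * (y x - N w x)) powr q - N w x powr q) / t)) (at_right 0)"
    proof eventually_elim
      case (elim t)
      define w' where "w' T = (1 - t) * w T + t * (if T = S then 1 else 0)" for T
      have Nw': "N w' x = N w x + t * (y x - N w x)" for x
      proof -
        have "N w' x = (\<Sum>T\<in>F. (1 - t) * (if x \<in> T then w T else 0) + (if T = S then t * y x else 0))"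
          unfolding N_def w'_def y_def by (intro sum.cong) auto
        also have "\<dots> = (1 - t) * N w x + t * y x"
          using S finF by (simp add: N_def sum.distrib sum_distrib_left)
        finally show ?thesis by (simp add: algebra_simps)
      qed
      have "w' \<in> W"
      proof (rule WI)
        show "0 \<le> w' T" if "T \<in> F" for T using elim Wnn[OF w that] by (auto simp: w'_def)
        show "w' T = 0" if "T \<notin> F" for T
          using w that S by (auto simp: w'_def W_def PiE_def Pi_def dest: spec[of _ T])
        have "sum w' F = (1 - t) * sum w F + (\<Sum>T\<in>F. if T = S then t else 0)"
          unfolding w'_def sum.distrib sum_distrib_left by (intro arg_cong2[of _ _ _ _ "(+)"] sum.cong) auto
        then show "sum w' F = 1" using S finF Wsum[OF w] by simp
      qed
      then have "\<Psi> w \<le> \<Psi> w'" by (rule min)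
      then have "0 \<le> (\<Psi> w' - \<Psi> w) / t" using elim by simp
      also have "\<dots> = (\<Sum>x\<in>X. ((N w x + t * (y x - N w x)) powr q - N w x powr q) / t)"
        unfolding \<Psi>_def Nw' by (simp add: sum_subtractf sum_divide_distrib diff_divide_distrib)
      finally show ?case .
    qed
    then have "0 \<le> D"
      by (rule tendsto_lowerbound[OF lim]) simp
    also have "D = q * ((\<Sum>x\<in>X. N w x powr (q - 1) * y x) - (\<Sum>x\<in>X. N w x powr (q - 1) * N w x))"
      unfolding D_def by (simp add: sum_distrib_left sum_subtractf algebra_simps)
    also have "(\<Sum>x\<in>X. N w x powr (q - 1) * N w x) = E"
      unfolding E_def \<Psi>_def
    proof (rule sum.cong)
      fix x show "N w x powr (q - 1) * N w x = N w x powr q"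
        using Nnn[OF w, of x] q(1) by (cases "N w x = 0") (auto simp: powr_diff)
    qed simp
    also have "(\<Sum>x\<in>X. N w x powr (q - 1) * y x) = (\<Sum>x\<in>S. N w x powr (q - 1))"
    proof -
      have "X \<inter> S = S" using S F by auto
      moreover have "(\<Sum>x\<in>X. N w x powr (q - 1) * y x) = (\<Sum>x\<in>X. if x \<in> S then N w x powr (q - 1) else 0)"
        by (intro sum.cong) (auto simp: y_def)
      ultimately show ?thesis using X by (simp add: sum.inter_restrict[symmetric])
    qed
    finally show ?thesis using q(1) by (simp add: zero_le_mult_iff)
  qed
  have "M \<le> (\<Sum>x\<in>X. (N w x powr (q - 1) / E) powr p)"
  proof (rule adm)
    show "0 \<le> N w x powr (q - 1) / E" for x using E by simp
    show "1 \<le> (\<Sum>x\<in>S. N w x powr (q - 1) / E)" if "S \<in> F" for S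
      using first_order[OF that] E by (simp add: sum_divide_distrib[symmetric])
  qed
  also have "\<dots> = (\<Sum>x\<in>X. N w x powr q) / E powr p"
    using E q(3) by (simp add: powr_divide powr_powr sum_divide_distrib)
  also have "\<dots> = E powr (1 - p)"
    using E unfolding E_def[symmetric] \<Psi>_def[symmetric] by (simp add: powr_diff)
  finally have ME: "M \<le> E powr (1 - p)" .
  have "(\<Sum>S\<in>F. w S * sum \<sigma> S) powr p \<le> (\<Sum>x\<in>X. \<sigma> x powr p) / M" if \<sigma>: "\<forall>x. 0 \<le> \<sigma> x" for \<sigma>
  proof -
    let ?A = "\<Sum>x\<in>X. \<sigma> x powr p"
    have A: "0 \<le> ?A" by (simp add: sum_nonneg)
    have "(\<Sum>S\<in>F. w S * sum \<sigma> S) = (\<Sum>x\<in>X. \<sigma> x * N w x)" unfolding sumN by (simp add: mult.commute)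
    also have "\<dots> \<le> ?A powr (1 / p) * E powr (1 / q)"
      unfolding E_def \<Psi>_def using X p q \<sigma> Nnn[OF w] by (intro holder_sum) auto
    finally have "(\<Sum>S\<in>F. w S * sum \<sigma> S) powr p \<le> (?A powr (1 / p) * E powr (1 / q)) powr p"
      using p \<sigma> Wnn[OF w] by (intro powr_mono2) (auto intro!: sum_nonneg mult_nonneg_nonneg)
    also have "\<dots> = ?A * E powr (p / q)"
      using p A E by (simp add: powr_mult powr_powr)
    also have "p / q = p - 1" using p by (simp add: q_def)
    also have "E powr (p - 1) = 1 / E powr (1 - p)"
      using powr_minus_divide[of E "1 - p"] by simp
    also have "?A * (1 / E powr (1 - p)) \<le> ?A * (1 / M)"
      using A M ME E by (intro mult_left_mono divide_left_mono) auto
    finally show ?thesis by simp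
  qed
  then show ?thesis using w Wnn Wsum by blast
qed

section \<open>Supermultiplicativity\<close>

text \<open>A crossing set meets every diagonal hyperplane, so its images under the coordinate swaps
  form a connected set which touches all faces of the cube. Its unfoldings into neighbouring cubes
  match along the common face.\<close>
definition swaps :: "'i \<Rightarrow> ('i::finite \<Rightarrow> nat) set \<Rightarrow> ('i \<Rightarrow> nat) set" where
  "swaps a S = (\<Union>i. swap_cell a i ` S)"

lemma cross_diagonal:
  assumes "S \<in> cross a m"
  shows "\<exists>u\<in>S. u a = u i"
proof -
  obtain x y where x: "x \<in> S" "x a = 0" and y: "y \<in> S" "y a = 3 ^ m - 1" and S: "conn S" "S \<subseteq> cells m"
    using assms by (auto simp: cross_def)
  show ?thesis
  proof (cases "y a \<le> y i")
    case True
    moreover have "y i < 3 ^ m" using y S by (auto simp: cells_def)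
    ultimately show ?thesis using y by (intro bexI[of _ y]) auto
  next
    case False
    obtain u v where uv: "u \<in> S" "v \<in> S" "adj u v" "u a \<le> u i" "\<not> v a \<le> v i"
      using conn_exit[OF S(1) x(1), of "\<lambda>u. u a \<le> u i" y] x y False by auto
    then have "u a = u i"
    proof -
      obtain k where "\<forall>j. j \<noteq> k \<longrightarrow> u j = v j" "u k \<le> v k + 1" "v k \<le> u k + 1"
        using uv(3) by (auto simp: adj_def)
      then show ?thesis using uv(4,5) by (cases "k = a"; cases "k = i") auto
    qed
    then show ?thesis using uv(1) by blast
  qed
qed

lemma conn_UN_meet:
  assumes "\<And>i. i \<in> I \<Longrightarrow> conn (A i)" "a \<in> I" "\<And>i. i \<in> I \<Longrightarrow> A i \<inter> A a \<noteq> {}"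
  shows "conn (\<Union>i\<in>I. A i)"
proof (rule conn_pairwise)
  fix x y assume "x \<in> (\<Union>i\<in>I. A i)" "y \<in> (\<Union>i\<in>I. A i)"
  then obtain i j where ij: "i \<in> I" "x \<in> A i" "j \<in> I" "y \<in> A j" by blast
  have "conn (A i \<union> A a)" using assms ij by (intro conn_Un_meet) auto
  then have "conn ((A i \<union> A a) \<union> A j)" using assms ij by (intro conn_Un_meet) auto
  then show "\<exists>C. conn C \<and> C \<subseteq> (\<Union>i\<in>I. A i) \<and> x \<in> C \<and> y \<in> C"
    using ij assms(2) by (intro exI[of _ "(A i \<union> A a) \<union> A j"]) auto
qed

lemma swap_cell_self [simp]: "swap_cell a a u = u"
  by (simp add: swap_cell_def)

lemma swaps_props:
  fixes a :: "'i::finite"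
  assumes S: "S \<in> cross a m"
  shows "conn (swaps a S)" "swaps a S \<subseteq> cells m" "swaps a S \<noteq> {}" "S \<subseteq> swaps a S"
    "\<exists>u\<in>swaps a S. u i = 0" "\<exists>u\<in>swaps a S. u i = 3 ^ m - 1"
proof -
  have Sp: "conn S" "S \<subseteq> cells m" using S by (auto simp: cross_def)
  show sub: "S \<subseteq> swaps a S"
    unfolding swaps_def by (force intro: exI[of _ a])
  then show "swaps a S \<noteq> {}" using cross_nonempty[OF S] by blast
  show "swaps a S \<subseteq> cells m"
    using Sp(2) swap_cells unfolding swaps_def by blast
  show "conn (swaps a S)"
    unfolding swaps_def
  proof (rule conn_UN_meet[where a = a])
    fix i show "conn (swap_cell a i ` S)" using Sp(1) adj_swap by (rule conn_image)
    obtain u where u: "u \<in> S" "u a = u i" using cross_diagonal[OF S] by blast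
    then have "swap_cell a i u = u"
      by (auto simp: swap_cell_apply fun_eq_iff Transposition.transpose_def)
    then have "u \<in> swap_cell a i ` S" using u(1) by (metis imageI)
    then show "swap_cell a i ` S \<inter> swap_cell a a ` S \<noteq> {}" using u(1) by auto
  qed simp
  obtain x y where xy: "x \<in> S" "x a = 0" "y \<in> S" "y a = 3 ^ m - 1" using S by (auto simp: cross_def)
  have in_swaps: "swap_cell a i u \<in> swaps a S" if "u \<in> S" for u
    using that by (auto simp: swaps_def)
  show "\<exists>u\<in>swaps a S. u i = 0"
    using xy in_swaps[of x] by (intro bexI[of _ "swap_cell a i x"]) (auto simp: swap_cell_apply)
  show "\<exists>u\<in>swaps a S. u i = 3 ^ m - 1"
    using xy in_swaps[of y] by (intro bexI[of _ "swap_cell a i y"]) (auto simp: swap_cell_apply)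
qed

definition unfold_set :: "'i \<Rightarrow> nat \<Rightarrow> nat \<Rightarrow> ('i::finite \<Rightarrow> nat) set \<Rightarrow> ('i \<Rightarrow> nat) set \<Rightarrow> ('i \<Rightarrow> nat) set" where
  "unfold_set a n m E S = {v \<in> cells (n + m). anc m v \<in> E \<and> fold_cell m v \<in> swaps a S}"

definition fold_weight :: "'i \<Rightarrow> nat \<Rightarrow> ('i::finite \<Rightarrow> nat) set \<Rightarrow> (('i \<Rightarrow> nat) \<Rightarrow> real) \<Rightarrow> ('i \<Rightarrow> nat) \<Rightarrow> real" where
  "fold_weight a m E \<rho> u = (\<Sum>(e, i)\<in>E \<times> UNIV. \<rho> (lift_cell m e (swap_cell a i u)))"

lemma fold_weight_nonneg: "(\<And>v. 0 \<le> \<rho> v) \<Longrightarrow> 0 \<le> fold_weight a m E \<rho> u"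
  by (auto simp: fold_weight_def intro: sum_nonneg)

lemma fold_weight_UN:
  "finite E \<Longrightarrow> fold_weight a m E \<rho> u = (\<Sum>e\<in>E. fold_weight a m {e} \<rho> u)"
  by (simp add: fold_weight_def sum.cartesian_product[symmetric])

lemma conn_unfold_set:
  assumes "S \<in> cross a m" "E \<subseteq> cells n" "conn E"
  shows "conn (unfold_set a n m E S)"
  unfolding unfold_set_def
  by (rule conn_blocks[OF assms(3,2) swaps_props(1,2,3,5,6)[OF assms(1)]])

lemma unfold_set_I:
  "S \<in> cross a m \<Longrightarrow> E \<subseteq> cells n \<Longrightarrow> e \<in> E \<Longrightarrow> u \<in> swaps a S \<Longrightarrow> lift_cell m e u \<in> unfold_set a n m E S"
  using swaps_props(2)[of S a m] by (auto simp: unfold_set_def lift_cells anc_lift fold_lift subset_iff)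

lemma sum_unfold_set_le:
  fixes a :: "'i::finite"
  assumes S: "S \<in> cross a m" and E: "finite E" and \<rho>: "\<And>v. 0 \<le> \<rho> v"
  shows "sum \<rho> (unfold_set a n m E S) \<le> sum (fold_weight a m E \<rho>) S"
proof -
  have fS: "finite S" using cross_finite[OF S] .
  let ?f = "\<lambda>((e, i), u). lift_cell m e (swap_cell a i u)"
  have sub: "unfold_set a n m E S \<subseteq> ?f ` ((E \<times> UNIV) \<times> S)"
  proof
    fix v assume "v \<in> unfold_set a n m E S"
    then obtain i u where "anc m v \<in> E" "u \<in> S" "fold_cell m v = swap_cell a i u"
      by (auto simp: unfold_set_def swaps_def)
    then have "v = ?f ((anc m v, i), u)" using lift_fold[of m v] by simp
    then show "v \<in> ?f ` ((E \<times> UNIV) \<times> S)" using \<open>anc m v \<in> E\<close> \<open>u \<in> S\<close> by blast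
  qed
  have "sum \<rho> (unfold_set a n m E S) \<le> sum \<rho> (?f ` ((E \<times> UNIV) \<times> S))"
    using E fS sub \<rho> by (intro sum_mono2) auto
  also have "\<dots> \<le> sum (\<rho> \<circ> ?f) ((E \<times> UNIV) \<times> S)"
    using E fS \<rho> by (intro sum_image_le) auto
  also have "\<dots> = (\<Sum>z\<in>E \<times> UNIV. \<Sum>u\<in>S. case z of (e, i) \<Rightarrow> \<rho> (lift_cell m e (swap_cell a i u)))"
    by (subst sum.cartesian_product) (auto intro!: sum.cong)
  also have "\<dots> = sum (fold_weight a m E \<rho>) S"
    unfolding fold_weight_def by (rule sum.swap)
  finally show ?thesis .
qed

lemma mass_fold_weight_le:
  fixes a :: "'i::finite"
  assumes E: "E \<subseteq> cells n" and \<rho>: "\<And>v. 0 \<le> \<rho> v" and p: "p > 0"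
  shows "mass p m (fold_weight a m E \<rho>) \<le>
    real (card E * CARD('i)) powr p * real CARD('i) * (\<Sum>v\<in>{v \<in> cells (n + m). anc m v \<in> E}. \<rho> v powr p)"
proof -
  have fE: "finite E" using E finite_subset by blast
  let ?K = "real (card E * CARD('i)) powr p"
  let ?R = "\<Sum>v\<in>{v \<in> cells (n + m). anc m v \<in> E}. \<rho> v powr p"
  have block: "(\<Sum>e\<in>E. \<Sum>u\<in>cells m. \<rho> (lift_cell m e u) powr p) \<le> ?R"
  proof -
    let ?f = "\<lambda>(e, u). lift_cell m e u"
    have inj: "inj_on ?f (E \<times> cells m)"
      by (rule inj_on_inverseI[where g = "\<lambda>v. (anc m v, fold_cell m v)"]) (auto simp: anc_lift fold_lift)
    have "(\<Sum>e\<in>E. \<Sum>u\<in>cells m. \<rho> (lift_cell m e u) powr p) = (\<Sum>z\<in>E \<times> cells m. \<rho> (?f z) powr p)"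
      by (subst sum.cartesian_product) (auto intro!: sum.cong)
    also have "\<dots> = (\<Sum>v\<in>?f ` (E \<times> cells m). \<rho> v powr p)"
      by (simp add: sum.reindex[OF inj] comp_def)
    also have "\<dots> \<le> ?R"
    proof (rule sum_mono2)
      show "?f ` (E \<times> cells m) \<subseteq> {v \<in> cells (n + m). anc m v \<in> E}"
        using E by (auto simp: anc_lift intro: lift_cells)
    qed auto
    finally show ?thesis .
  qed
  have "mass p m (fold_weight a m E \<rho>) \<le>
      (\<Sum>u\<in>cells m. ?K * (\<Sum>(e, i)\<in>E \<times> UNIV. \<rho> (lift_cell m e (swap_cell a i u)) powr p))"
    unfolding mass_def
  proof (rule sum_mono)
    fix u :: "'i \<Rightarrow> nat"
    let ?x = "\<lambda>(e, i). \<rho> (lift_cell m e (swap_cell a i u))"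
    have "card {z \<in> E \<times> (UNIV::'i set). ?x z \<noteq> 0} \<le> card (E \<times> (UNIV::'i set))"
      using fE by (intro card_mono) auto
    then have "(sum ?x (E \<times> UNIV)) powr p \<le> ?K * (\<Sum>z\<in>E \<times> UNIV. ?x z powr p)"
      using fE \<rho> p by (intro powr_sum_le) (auto simp: card_cartesian_product simp del: of_nat_mult)
    then show "fold_weight a m E \<rho> u powr p \<le> ?K * (\<Sum>(e, i)\<in>E \<times> UNIV. \<rho> (lift_cell m e (swap_cell a i u)) powr p)"
      unfolding fold_weight_def by (simp add: case_prod_beta)
  qed
  also have "\<dots> = ?K * (\<Sum>u\<in>cells m. \<Sum>e\<in>E. \<Sum>i\<in>UNIV. \<rho> (lift_cell m e (swap_cell a i u)) powr p)"
    by (simp only: sum_distrib_left[symmetric] sum.cartesian_product)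
  also have "(\<Sum>u\<in>cells m. \<Sum>e\<in>E. \<Sum>i\<in>UNIV. \<rho> (lift_cell m e (swap_cell a i u)) powr p)
      = (\<Sum>e\<in>E. \<Sum>u\<in>cells m. \<Sum>i\<in>UNIV. \<rho> (lift_cell m e (swap_cell a i u)) powr p)"
    by (rule sum.swap)
  also have "\<dots> = (\<Sum>e\<in>E. \<Sum>i\<in>UNIV. \<Sum>u\<in>cells m. \<rho> (lift_cell m e (swap_cell a i u)) powr p)"
    by (intro sum.cong refl sum.swap)
  also have "\<dots> = (\<Sum>e\<in>E. \<Sum>i\<in>(UNIV::'i set). \<Sum>u\<in>cells m. \<rho> (lift_cell m e u) powr p)"
    by (intro sum.cong refl sum_swap_cells)
  also have "\<dots> = real CARD('i) * (\<Sum>e\<in>E. \<Sum>u\<in>cells m. \<rho> (lift_cell m e u) powr p)"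
    by (simp add: sum_distrib_left)
  also have "?K * (real CARD('i) * (\<Sum>e\<in>E. \<Sum>u\<in>cells m. \<rho> (lift_cell m e u) powr p)) \<le> ?K * (real CARD('i) * ?R)"
    using block by (intro mult_left_mono) auto
  finally show ?thesis by (simp only: mult.assoc)
qed

lemma unfold_set_cross:
  assumes T: "T \<in> cross a n" and S: "S \<in> cross a m"
  shows "unfold_set a n m T S \<in> cross a (n + m)"
proof -
  have T': "T \<subseteq> cells n" "conn T" using T by (auto simp: cross_def)
  obtain x y where x: "x \<in> T" "x a = 0" and y: "y \<in> T" "y a = 3 ^ n - 1" using T by (auto simp: cross_def)
  obtain u v where u: "u \<in> S" "u a = 0" and v: "v \<in> S" "v a = 3 ^ m - 1" using S by (auto simp: cross_def)
  have "lift_cell m x u a = 0" using x u by (simp add: lift_cell_def unzigzag_def)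
  moreover have "lift_cell m y v a = 3 ^ (n + m) - 1"
  proof -
    have "even (3 ^ n - 1 :: nat)" by simp
    moreover have "(3 ^ n - 1) * 3 ^ m + (3 ^ m - 1) = (3 ^ (n + m) - 1 :: nat)"
      by (simp add: power_add algebra_simps)
    ultimately show ?thesis using y v by (simp only: lift_cell_def unzigzag_def if_True)
  qed
  moreover have "lift_cell m x u \<in> unfold_set a n m T S" "lift_cell m y v \<in> unfold_set a n m T S"
    using x y u v swaps_props(4)[OF S] by (auto intro!: unfold_set_I[OF S T'(1)])
  moreover have "unfold_set a n m T S \<subseteq> cells (n + m)" by (auto simp: unfold_set_def)
  ultimately show ?thesis
    unfolding cross_def using conn_unfold_set[OF S T'] by blast
qed

lemma cross_mod_supermult:
  fixes a :: "'i::finite"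
  assumes p: "p > 1"
  shows "cross_mod a p n * cross_mod a p m \<le> real CARD('i) powr p * real CARD('i) * cross_mod a p (n + m)"
proof -
  let ?M = "cross_mod a p m" and ?K = "real CARD('i) powr p * real CARD('i)"
  have M: "?M > 0" by (rule cross_mod_pos) (use p in simp)
  have K: "?K > 0" by simp
  have "\<exists>w. (\<forall>S\<in>cross a m. 0 \<le> w S) \<and> sum w (cross a m) = 1 \<and>
    (\<forall>\<sigma>. (\<forall>x. 0 \<le> \<sigma> x) \<longrightarrow> (\<Sum>S\<in>cross a m. w S * sum \<sigma> S) powr p \<le> (\<Sum>x\<in>cells m. \<sigma> x powr p) / ?M)"
  proof (rule modulus_duality)
    show "cross a m \<noteq> {}" using cells_cross by blast
    show "{} \<notin> cross a m" using cross_nonempty by blast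
    fix \<rho> :: "('i \<Rightarrow> nat) \<Rightarrow> real" assume "\<And>x. 0 \<le> \<rho> x" "\<And>S. S \<in> cross a m \<Longrightarrow> 1 \<le> sum \<rho> S"
    then show "?M \<le> (\<Sum>x\<in>cells m. \<rho> x powr p)"
      using cross_mod_le[of a m \<rho> p] by (simp add: adm_def mass_def)
  qed (use p M in \<open>auto simp: cross_def\<close>)
  then obtain w where w: "\<And>S. S \<in> cross a m \<Longrightarrow> 0 \<le> w S" "sum w (cross a m) = 1"
    and dual: "\<And>\<sigma>. (\<And>x. 0 \<le> \<sigma> x) \<Longrightarrow> (\<Sum>S\<in>cross a m. w S * sum \<sigma> S) powr p \<le> (\<Sum>x\<in>cells m. \<sigma> x powr p) / ?M"
    by blast
  have "cross_mod a p n * ?M / ?K \<le> cross_mod a p (n + m)"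
  proof (rule cross_mod_greatest)
    fix \<rho> assume \<rho>: "adm a (n + m) \<rho>"
    have nn: "0 \<le> \<rho> v" for v using \<rho> by (simp add: adm_def)
    define \<sigma> where "\<sigma> e = (\<Sum>S\<in>cross a m. w S * sum (fold_weight a m {e} \<rho>) S)" for e
    have \<sigma>nn: "0 \<le> \<sigma> e" for e
      unfolding \<sigma>_def using w(1) nn by (intro sum_nonneg mult_nonneg_nonneg fold_weight_nonneg) auto
    have "adm a n \<sigma>"
      unfolding adm_def
    proof (intro conjI allI ballI \<sigma>nn)
      fix T assume T: "T \<in> cross a n"
      have "1 = (\<Sum>S\<in>cross a m. w S * 1)" using w(2) by simp
      also have "\<dots> \<le> (\<Sum>S\<in>cross a m. w S * (\<Sum>e\<in>T. sum (fold_weight a m {e} \<rho>) S))"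
      proof (intro sum_mono mult_left_mono w(1))
        fix S assume S: "S \<in> cross a m"
        have "1 \<le> sum \<rho> (unfold_set a n m T S)"
          using \<rho> unfold_set_cross[OF T S] by (simp add: adm_def)
        also have "\<dots> \<le> sum (fold_weight a m T \<rho>) S"
          by (rule sum_unfold_set_le[OF S cross_finite[OF T] nn])
        also have "\<dots> = (\<Sum>e\<in>T. sum (fold_weight a m {e} \<rho>) S)"
          unfolding fold_weight_UN[OF cross_finite[OF T]] by (rule sum.swap)
        finally show "1 \<le> (\<Sum>e\<in>T. sum (fold_weight a m {e} \<rho>) S)" .
      qed
      also have "\<dots> = sum \<sigma> T"
        unfolding \<sigma>_def sum_distrib_left by (rule sum.swap)
      finally show "1 \<le> sum \<sigma> T" .
    qed
    then have "cross_mod a p n \<le> mass p n \<sigma>" by (rule cross_mod_le)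
    also have "\<dots> \<le> (\<Sum>e\<in>cells n. ?K * (\<Sum>v\<in>{v \<in> cells (n + m). anc m v = e}. \<rho> v powr p) / ?M)"
      unfolding mass_def
    proof (rule sum_mono)
      fix e assume e: "e \<in> (cells n :: ('i \<Rightarrow> nat) set)"
      have "\<sigma> e powr p \<le> mass p m (fold_weight a m {e} \<rho>) / ?M"
        unfolding \<sigma>_def mass_def by (intro dual fold_weight_nonneg nn)
      also have "\<dots> \<le> ?K * (\<Sum>v\<in>{v \<in> cells (n + m). anc m v = e}. \<rho> v powr p) / ?M"
        using mass_fold_weight_le[of "{e}" n \<rho> p m a] e nn p M by (intro divide_right_mono) auto
      finally show "\<sigma> e powr p \<le> ?K * (\<Sum>v\<in>{v \<in> cells (n + m). anc m v = e}. \<rho> v powr p) / ?M" .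
    qed
    also have "\<dots> = ?K * (\<Sum>e\<in>cells n. \<Sum>v\<in>{v \<in> cells (n + m). anc m v = e}. \<rho> v powr p) / ?M"
      by (simp only: sum_distrib_left sum_divide_distrib)
    also have "(\<Sum>e\<in>cells n. \<Sum>v\<in>{v \<in> cells (n + m). anc m v = e}. \<rho> v powr p) = mass p (n + m) \<rho>"
      unfolding mass_def by (rule sum.group) (auto simp: anc_cells)
    finally have "cross_mod a p n * ?M \<le> ?K * mass p (n + m) \<rho>" using M by (simp add: pos_le_divide_eq)
    then show "cross_mod a p n * ?M / ?K \<le> mass p (n + m) \<rho>"
      using K by (simp add: pos_divide_le_eq mult.commute)
  qed
  then show ?thesis using K by (simp add: pos_divide_le_eq mult.commute)
qed


section \<open>The critical exponent\<close>

lemma adm_truncate: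
  assumes "adm a n \<rho>"
  shows "adm a n (\<lambda>v. min (\<rho> v) 1)"
  unfolding adm_def
proof (intro conjI allI ballI)
  show "0 \<le> min (\<rho> v) 1" for v using assms by (simp add: adm_def)
  fix S assume S: "S \<in> cross a n"
  show "1 \<le> (\<Sum>v\<in>S. min (\<rho> v) 1)"
  proof (cases "\<exists>v\<in>S. 1 \<le> \<rho> v")
    case True
    then obtain v where v: "v \<in> S" "1 \<le> \<rho> v" by blast
    have "min (\<rho> v) 1 \<le> (\<Sum>v\<in>S. min (\<rho> v) 1)"
      using v cross_finite[OF S] assms by (intro member_le_sum) (auto simp: adm_def)
    then show ?thesis using v by simp
  next
    case False
    then have "(\<Sum>v\<in>S. min (\<rho> v) 1) = sum \<rho> S" by (intro sum.cong) auto
    then show ?thesis using assms S by (simp add: adm_def)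
  qed
qed

lemma powr_exponent_diff:
  fixes x p p' :: real
  assumes x: "0 \<le> x" "x \<le> 1" and p: "1 \<le> p" "p \<le> p'"
  shows "x powr p \<le> x powr p' + (p' - p)"
proof (cases "x = 0")
  case False
  then have x0: "x > 0" using x by simp
  have "1 - x powr (p' - p) \<le> (p' - p) * ln (1 / x)"
    using exp_ge_add_one_self[of "(p' - p) * ln x"] x0
    by (simp add: powr_def ln_div del: exp_ge_add_one_self)
  also have "\<dots> \<le> (p' - p) * (1 / x)"
    using ln_le_minus_one[of "1 / x"] x0 p by (intro mult_left_mono) auto
  finally have "x powr p * (1 - x powr (p' - p)) \<le> x powr p * ((p' - p) * (1 / x))"
    by (intro mult_left_mono) auto
  also have "\<dots> = (p' - p) * x powr (p - 1)" using x0 by (simp add: powr_diff)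
  also have "\<dots> \<le> (p' - p) * 1" using x0 x p by (intro mult_left_mono powr_le1) auto
  also have "x powr p * (1 - x powr (p' - p)) = x powr p - x powr p'"
    using x0 by (simp add: algebra_simps flip: powr_add)
  finally show ?thesis by simp
qed (use p in simp)

lemma cross_mod_exponent:
  fixes a :: "'i::finite"
  assumes p: "1 \<le> p" "p \<le> p'"
  shows "cross_mod a p n \<le> cross_mod a p' n + real (card (cells n :: ('i \<Rightarrow> nat) set)) * (p' - p)"
proof -
  let ?c = "real (card (cells n :: ('i \<Rightarrow> nat) set)) * (p' - p)"
  have "cross_mod a p n - ?c \<le> cross_mod a p' n"
  proof (rule cross_mod_greatest)
    fix \<rho> assume \<rho>: "adm a n \<rho>"
    let ?r = "\<lambda>v. min (\<rho> v) 1"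
    have nn: "0 \<le> \<rho> v" for v using \<rho> by (simp add: adm_def)
    have "cross_mod a p n \<le> mass p n ?r" by (rule cross_mod_le[OF adm_truncate[OF \<rho>]])
    also have "\<dots> \<le> (\<Sum>v\<in>cells n. \<rho> v powr p' + (p' - p))"
      unfolding mass_def
    proof (rule sum_mono)
      fix v
      have "?r v powr p \<le> ?r v powr p' + (p' - p)" using nn p by (intro powr_exponent_diff) auto
      also have "?r v powr p' \<le> \<rho> v powr p'" using nn p by (intro powr_mono2) auto
      finally show "?r v powr p \<le> \<rho> v powr p' + (p' - p)" by simp
    qed
    also have "\<dots> = mass p' n \<rho> + ?c" by (simp add: mass_def sum.distrib)
    finally show "cross_mod a p n - ?c \<le> mass p' n \<rho>" by simp
  qed
  then show ?thesis by simp
qed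

lemma mass_continuous:
  assumes "\<And>v. 0 \<le> \<rho> v"
  shows "isCont (\<lambda>p. mass p n \<rho>) p"
  unfolding mass_def
proof (rule continuous_sum)
  fix v
  show "isCont (\<lambda>p. \<rho> v powr p) p"
    using assms[of v] by (cases "\<rho> v = 0") (auto intro!: continuous_intros)
qed

subsection \<open>Large exponents\<close>

lemma card_cells_le: "card (cells n :: ('i::finite \<Rightarrow> nat) set) \<le> (3 ^ n) ^ CARD('i)"
proof -
  have "(cells n :: ('i \<Rightarrow> nat) set) \<subseteq> PiE UNIV (\<lambda>_. {..<3 ^ n})" by (auto simp: cells_def)
  then have "card (cells n :: ('i \<Rightarrow> nat) set) \<le> card (PiE (UNIV::'i set) (\<lambda>_. {..<3 ^ n::nat}))"
    by (intro card_mono finite_PiE) auto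
  then show ?thesis by (simp add: card_PiE)
qed

lemma cross_card_ge:
  assumes S: "S \<in> cross a n"
  shows "3 ^ n \<le> card S"
proof -
  obtain x y where x: "x \<in> S" "x a = 0" and y: "y \<in> S" "y a = 3 ^ n - 1" and "conn S"
    using S by (auto simp: cross_def)
  have "{..<3 ^ n} \<subseteq> (\<lambda>u. u a) ` S"
  proof
    fix t :: nat assume t: "t \<in> {..<3 ^ n}"
    show "t \<in> (\<lambda>u. u a) ` S"
    proof (cases "t = y a")
      case False
      obtain u v where uv: "u \<in> S" "v \<in> S" "adj u v" "u a \<le> t" "\<not> v a \<le> t"
      proof (rule conn_exit[OF \<open>conn S\<close> x(1), of "\<lambda>u. u a \<le> t" y])
        show "\<not> y a \<le> t" using y t False by simp
      qed (use x y in auto)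
      then have "v a \<le> u a + 1" using adj_near[of u v] by (auto simp: near_def)
      then have "u a = t" using uv by simp
      then show ?thesis using uv by blast
    qed (use y in blast)
  qed
  then have "card {..<3 ^ n::nat} \<le> card S"
    using cross_finite[OF S] by (meson card_image_le card_mono finite_imageI le_trans)
  then show ?thesis by simp
qed

lemma cross_mod_large_exponent:
  fixes a :: "'i::finite"
  shows "cross_mod a (real CARD('i) + 1) n \<le> (1 / 3) ^ n"
proof -
  let ?p = "real CARD('i) + 1"
  have "adm a n (\<lambda>_. (1 / 3) ^ n)"
    unfolding adm_def
  proof (intro conjI allI ballI)
    fix S assume "S \<in> cross a n"
    from cross_card_ge[OF this] have "real (3 ^ n) \<le> real (card S)" by (simp only: of_nat_le_iff)
    then show "1 \<le> (\<Sum>v\<in>S. (1 / 3 :: real) ^ n)" by (simp add: power_one_over field_simps)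
  qed simp
  then have "cross_mod a ?p n \<le> mass ?p n (\<lambda>_ :: 'i \<Rightarrow> nat. (1 / 3) ^ n)" by (rule cross_mod_le)
  also have "\<dots> = real (card (cells n :: ('i \<Rightarrow> nat) set)) * ((1 / 3) ^ n) powr ?p"
    by (simp add: mass_def)
  also have "\<dots> \<le> real ((3 ^ n) ^ CARD('i)) * ((1 / 3) ^ n) powr ?p"
    using card_cells_le[of n, where 'i = 'i] by (intro mult_right_mono) (simp_all only: of_nat_le_iff, simp)
  also have "((1 / 3 :: real) ^ n) powr ?p = ((1 / 3) ^ n) ^ Suc CARD('i)"
    by (subst powr_realpow[symmetric]) (auto simp: add.commute)
  also have "real ((3 ^ n) ^ CARD('i)) * ((1 / 3) ^ n) ^ Suc CARD('i) = (1 / 3) ^ n"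
    by (simp add: power_one_over flip: power_mult)
  finally show ?thesis .
qed

subsection \<open>Small exponents\<close>

lemma ones_mult3: "ones (q * 3) = Suc ` ones q" "ones (q * 3 + 2) = Suc ` ones q"
  using ones_digit[of 0 q] ones_digit[of 2 q] by auto

lemma cantor_indices: "\<exists>Z. finite Z \<and> card Z = 2 ^ n \<and> (\<forall>c\<in>Z. c < 3 ^ n \<and> ones c = {})"
proof (induction n)
  case 0
  then show ?case by (intro exI[of _ "{0}"]) auto
next
  case (Suc n)
  then obtain Z where Z: "finite Z" "card Z = 2 ^ n" "\<And>c. c \<in> Z \<Longrightarrow> c < 3 ^ n \<and> ones c = {}" by blast
  let ?A = "(\<lambda>c. c * 3) ` Z" and ?B = "(\<lambda>c. c * 3 + 2) ` Z"
  have "?A \<inter> ?B = {}"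
  proof -
    have "c * 3 \<noteq> c' * 3 + 2" for c c' :: nat by presburger
    then show ?thesis by auto
  qed
  moreover have "card ?A = 2 ^ n" "card ?B = 2 ^ n"
    using Z(2) by (auto simp: card_image inj_on_def)
  ultimately have "card (?A \<union> ?B) = 2 ^ Suc n" using Z(1) by (simp add: card_Un_disjoint)
  moreover have "c < 3 ^ Suc n \<and> ones c = {}" if "c \<in> ?A \<union> ?B" for c
  proof -
    from that obtain z where z: "z \<in> Z" "c = z * 3 \<or> c = z * 3 + 2" by blast
    then have "z < 3 ^ n" "ones z = {}" using Z(3) by auto
    moreover from this have "c < 3 ^ Suc n" using z(2) by auto
    ultimately show ?thesis using z(2) ones_mult3[of z] by auto
  qed
  ultimately show ?case using Z(1) by (intro exI[of _ "?A \<union> ?B"]) auto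
qed

lemma conn_line:
  assumes "\<And>t. adj (f t) (f (Suc t))"
  shows "conn (f ` {..t})"
proof (induction t)
  case 0
  then show ?case by simp
next
  case (Suc t)
  have "f ` {..Suc t} = f ` {..t} \<union> {f (Suc t)}" by (auto simp: le_Suc_eq)
  then show ?case using conn_Un[OF Suc conn_singleton, of "f t" "f (Suc t)"] assms by auto
qed

lemma powr_sum_ge:
  fixes x :: "'b \<Rightarrow> real"
  assumes L: "finite L" and x: "\<And>v. 0 \<le> x v" and one: "1 \<le> sum x L" and p: "p > 1"
    and N: "real (card L) = N" "N > 0"
  shows "N powr (1 - p) \<le> (\<Sum>v\<in>L. x v powr p)"
proof -
  define A where "A = 1 / N"
  have A: "A > 0" "A * N = 1" using N by (auto simp: A_def)
  define q where "q = p / (p - 1)"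
  have q: "q > 1" "1 / p + 1 / q = 1" "(p - 1) * q = p" "p / q = p - 1" using p by (auto simp: q_def field_simps)
  have "p * A powr (p - 1) * x v - (p - 1) * A powr p \<le> x v powr p" for v
  proof -
    have "x v * A powr (p - 1) \<le> x v powr p / p + (A powr (p - 1)) powr q / q"
      using p q x A by (intro Youngs_inequality) auto
    then have "p * (x v * A powr (p - 1)) \<le> p * (x v powr p / p + A powr p / q)"
      using p q by (intro mult_left_mono) (auto simp: powr_powr)
    also have "\<dots> = x v powr p + (p / q) * A powr p" using p by (simp add: distrib_left)
    finally show ?thesis using q(4) by (simp add: mult_ac)
  qed
  then have "(\<Sum>v\<in>L. p * A powr (p - 1) * x v - (p - 1) * A powr p) \<le> (\<Sum>v\<in>L. x v powr p)"
    by (intro sum_mono)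
  moreover have "(\<Sum>v\<in>L. p * A powr (p - 1) * x v - (p - 1) * A powr p)
      = p * A powr (p - 1) * sum x L - (p - 1) * (N * A powr p)"
    using N(1) by (simp add: sum_subtractf sum_distrib_left)
  moreover have "p * A powr (p - 1) * 1 \<le> p * A powr (p - 1) * sum x L"
    using one p by (intro mult_left_mono) auto
  moreover have "N * A powr p = A powr (p - 1)"
    using A N by (simp add: powr_diff A_def)
  moreover have "A powr (p - 1) = N powr (1 - p)"
    using N by (simp add: A_def powr_divide powr_minus_divide[of N "p - 1", simplified])
  ultimately show ?thesis by (simp add: algebra_simps)
qed

lemma cross_mod_small_exponent:
  fixes a b :: "'i::finite"
  assumes ab: "a \<noteq> b" and p: "p > 1"
  shows "(2 * 3 powr (1 - p)) ^ n \<le> cross_mod a p n"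
proof (rule cross_mod_greatest)
  fix \<rho> assume \<rho>: "adm a n \<rho>"
  have nn: "0 \<le> \<rho> v" for v using \<rho> by (simp add: adm_def)
  obtain Z where Z: "finite Z" "card Z = 2 ^ n" "\<And>c. c \<in> Z \<Longrightarrow> c < 3 ^ n \<and> ones c = {}"
    using cantor_indices[of n] by blast
  define f where "f c t = (\<lambda>i. if i = a then t else if i = b then c else 0 :: nat)" for c t
  define L where "L c = f c ` {..3 ^ n - 1}" for c
  have inj: "inj_on (f c) T" for c T
    by (rule inj_onI) (metis f_def)
  have fa: "f c t a = t" and fb: "f c t b = c" for c t using ab by (auto simp: f_def)
  have cells: "f c t \<in> cells n" if "c \<in> Z" "t \<le> 3 ^ n - 1" for c t
  proof -
    have "t < 3 ^ n" using that(2) by (metis One_nat_def Suc_pred le_imp_less_Suc zero_less_numeral zero_less_power)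
    moreover have "ones (f c t i) = {}" if "i \<noteq> a" for i
      using that Z(3)[OF \<open>c \<in> Z\<close>] by (auto simp: f_def)
    moreover have "f c t i < 3 ^ n" for i
      using \<open>t < 3 ^ n\<close> Z(3)[OF \<open>c \<in> Z\<close>] by (auto simp: f_def)
    ultimately have "ones (f c t i) \<inter> ones (f c t j) = {}" if "i \<noteq> j" for i j
      using that by (metis inf_bot_left inf_bot_right)
    then show ?thesis using \<open>\<And>i. f c t i < 3 ^ n\<close> by (simp add: cells_def)
  qed
  have cross: "L c \<in> cross a n" if "c \<in> Z" for c
    unfolding cross_def
  proof (intro CollectI conjI)
    show "conn (L c)" unfolding L_def
      by (rule conn_line) (auto simp: adj_def f_def intro!: exI[of _ a])
    show "L c \<subseteq> cells n" using cells that by (auto simp: L_def)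
    show "\<exists>u\<in>L c. u a = 0" "\<exists>u\<in>L c. u a = 3 ^ n - 1" by (auto simp: L_def fa)
  qed
  have cardL: "card (L c) = 3 ^ n" for c
    unfolding L_def by (simp add: card_image[OF inj])
  have "(2 * 3 powr (1 - p)) ^ n = (\<Sum>c\<in>Z. (3 ^ n) powr (1 - p))"
    by (simp add: Z(2) power_mult_distrib powr_powr powr_realpow[symmetric] mult.commute)
  also have "\<dots> \<le> (\<Sum>c\<in>Z. \<Sum>v\<in>L c. \<rho> v powr p)"
  proof (rule sum_mono)
    fix c assume "c \<in> Z"
    then show "(3 ^ n) powr (1 - p) \<le> (\<Sum>v\<in>L c. \<rho> v powr p)"
      using \<rho> cross[of c] nn p cardL[of c]
      by (intro powr_sum_ge) (auto simp: adm_def L_def)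
  qed
  also have "\<dots> = (\<Sum>v\<in>(\<Union>c\<in>Z. L c). \<rho> v powr p)"
  proof (rule sum.UNION_disjoint[symmetric])
    show "\<forall>c\<in>Z. \<forall>c'\<in>Z. c \<noteq> c' \<longrightarrow> L c \<inter> L c' = {}"
      unfolding L_def using fb by (auto simp: disjoint_iff) metis
  qed (use Z(1) in \<open>auto simp: L_def\<close>)
  also have "\<dots> \<le> mass p n \<rho>"
    unfolding mass_def using cross by (intro sum_mono2) (auto simp: cross_def)
  finally show "(2 * 3 powr (1 - p)) ^ n \<le> mass p n \<rho>" .
qed

subsection \<open>Existence of an exponent with bounded modulus\<close>

text \<open>By sub- and supermultiplicativity, a modulus below \<open>1 / C\<close> at some level forces decay and one
  above \<open>K\<close> forces growth. Both conditions are open in the exponent and exclude each other, so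
  they cannot exhaust an interval whose ends they occupy.\<close>
lemma critical_exponent:
  fixes a b :: "'i::finite"
  assumes ab: "a \<noteq> b"
  shows "\<exists>p c C. p > 1 \<and> c > 0 \<and> (\<forall>n. c \<le> cross_mod a p n \<and> cross_mod a p n \<le> C)"
proof -
  let ?d = "real CARD('i)" and ?D = "real (3 ^ CARD('i))"
  define P where "P = ?d + 1"
  define C where "C = ?D powr P * (?d powr P * ?d * ?D)"
  define K where "K = ?d powr P * ?d"
  let ?M = "cross_mod a"
  have d1: "?d \<ge> 1" by (simp add: Suc_le_eq card_gt_0_iff)
  have D1: "?D \<ge> 1" by simp
  have "CARD('i) \<ge> 2"
  proof -
    have "card {a, b} \<le> CARD('i)" by (intro card_mono) auto
    then show ?thesis using ab by simp
  qed
  then have P3: "P \<ge> 3" by (simp add: P_def)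
  have pos: "?M p n > 0" if "p > 1" for p n using cross_mod_pos[of p a n] that by simp
  have C0: "C > 0" and K0: "K > 0" using d1 D1 by (auto simp: C_def K_def)
  have sub: "?M p (n + m) \<le> C * (?M p n * ?M p m)" if "n \<ge> 2" "1 < p" "p \<le> P" for n m p
  proof -
    have "?D powr p * (?d powr p * ?d * ?D) \<le> C"
      unfolding C_def using d1 D1 that by (intro mult_mono powr_mono) auto
    moreover have "0 \<le> ?M p n * ?M p m" using pos that(2) by (simp add: less_imp_le)
    ultimately show ?thesis
      using cross_mod_submult[of n p a m] that by (meson mult_right_mono order.trans zero_less_one less_trans)
  qed
  have super: "?M p n * ?M p m \<le> K * ?M p (n + m)" if "1 < p" "p \<le> P" for n m p
  proof -
    have "?d powr p * ?d \<le> K" unfolding K_def using d1 that by (intro mult_right_mono powr_mono) auto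
    then show ?thesis
      using cross_mod_supermult[of p a n m] pos[OF that(1), of "n + m"] that
      by (meson mult_right_mono order.trans less_imp_le)
  qed
  have sub_pow: "C * ?M p (n * Suc k) \<le> (C * ?M p n) ^ Suc k" if "n \<ge> 2" "1 < p" "p \<le> P" for n k p
  proof (induction k)
    case (Suc k)
    have "C * ?M p (n * Suc (Suc k)) \<le> C * (C * (?M p n * ?M p (n * Suc k)))"
      using sub[OF that, of "n * Suc k"] C0 by simp
    also have "\<dots> = (C * ?M p n) * (C * ?M p (n * Suc k))" by simp
    also have "\<dots> \<le> (C * ?M p n) * (C * ?M p n) ^ Suc k"
      using Suc C0 pos[OF that(2), of n] by (intro mult_left_mono) auto
    finally show ?case by simp
  qed simp
  have super_pow: "(?M p n / K) ^ Suc k \<le> ?M p (n * Suc k) / K" if "1 < p" "p \<le> P" for n k p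
  proof (induction k)
    case (Suc k)
    have "(?M p n / K) ^ Suc (Suc k) = (?M p n / K) * (?M p n / K) ^ Suc k" by simp
    also have "\<dots> \<le> (?M p n / K) * (?M p (n * Suc k) / K)"
      using Suc K0 pos[OF that(1), of n] by (intro mult_left_mono) auto
    also have "\<dots> = (?M p n * ?M p (n * Suc k)) / K / K" by simp
    also have "\<dots> \<le> (K * ?M p (n + n * Suc k)) / K / K"
      using super[OF that] K0 by (intro divide_right_mono) auto
    finally show ?case using K0 by simp
  qed simp
  have excl: False if "1 < p" "p \<le> P" "n \<ge> 2" "C * ?M p n < 1" "K < ?M p m" for p n m
  proof -
    have m0: "m > 0"
    proof (rule ccontr)
      assume "\<not> m > 0"
      then have "?M p m * ?M p m \<le> K * ?M p m" using super[OF that(1,2), of 0 0] by simp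
      then show False using that(5) pos[OF that(1), of m] by simp
    qed
    have "(\<lambda>k. (C * ?M p n) ^ k) \<longlonglongrightarrow> 0"
      using that(4) C0 pos[OF that(1), of n] by (intro LIMSEQ_power_zero) auto
    then have "eventually (\<lambda>k. (C * ?M p n) ^ k < C * K) sequentially"
      using C0 K0 by (intro order_tendstoD(2)[where y = 0]) auto
    then obtain k0 where k0: "\<And>k. k \<ge> k0 \<Longrightarrow> (C * ?M p n) ^ k < C * K"
      by (auto simp: eventually_sequentially)
    define k where "k = Suc k0 * m - 1"
    have k: "Suc k = Suc k0 * m" using m0 by (simp add: k_def)
    then have "Suc k \<ge> k0" using m0 by (metis Suc_leD le_add1 mult.commute mult_le_mono1 nat_mult_1 Suc_leI One_nat_def le_trans)
    then have "C * ?M p (n * Suc k) < C * K" using sub_pow[OF that(3,1,2), of k] k0 by (meson le_less_trans)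
    then have small: "?M p (n * Suc k) < K" using C0 by simp
    define l where "l = n * Suc k0 - 1"
    have l: "Suc l = n * Suc k0" using that(3) by (simp add: l_def)
    have "1 \<le> (?M p m / K) ^ Suc l" using that(5) K0 by (intro one_le_power) simp
    also have "\<dots> \<le> ?M p (m * Suc l) / K" by (rule super_pow[OF that(1,2)])
    also have "m * Suc l = n * Suc k" unfolding k l by (simp only: mult_ac)
    finally show False using small K0 by simp
  qed
  define B where "B = {p. 1 < p \<and> p \<le> P \<and> (\<exists>m. K < ?M p m)}"
  have start: "3 / 2 \<in> B"
  proof -
    have "3 powr (1 / 2 :: real) < 2" using real_sqrt_less_iff[of 3 4] by (simp add: powr_half_sqrt)
    then have "1 < 2 * 3 powr (1 - 3 / 2 :: real)"
      by (simp add: powr_minus_divide)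
    then obtain n where "K < (2 * 3 powr (1 - 3 / 2)) ^ n" using real_arch_pow by blast
    also have "\<dots> \<le> ?M (3 / 2) n" by (rule cross_mod_small_exponent[OF ab]) simp
    finally have "\<exists>m. K < ?M (3 / 2) m" by blast
    then show ?thesis unfolding B_def using P3 by simp
  qed
  have bdd: "bdd_above B" by (rule bdd_aboveI[of _ P]) (auto simp: B_def)
  define p where "p = Sup B"
  have p1: "3 / 2 \<le> p" unfolding p_def by (rule cSup_upper[OF start bdd])
  have pP: "p \<le> P" unfolding p_def using start by (intro cSup_least) (auto simp only: B_def empty_iff mem_Collect_eq)
  obtain N where N: "N \<ge> 2" "C * ?M P N < 1"
  proof -
    have "(\<lambda>n. C * (1 / 3 :: real) ^ n) \<longlonglongrightarrow> C * 0"
      by (intro tendsto_mult tendsto_const LIMSEQ_power_zero) simp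
    then have "eventually (\<lambda>n. C * (1 / 3 :: real) ^ n < 1) sequentially"
      by (intro order_tendstoD(2)[where y = "C * 0"]) auto
    then obtain n0 where "\<And>n. n \<ge> n0 \<Longrightarrow> C * (1 / 3 :: real) ^ n < 1"
      by (auto simp: eventually_sequentially)
    then have "C * (1 / 3 :: real) ^ (n0 + 2) < 1" using le_add1 by blast
    moreover have "C * ?M P (n0 + 2) \<le> C * (1 / 3) ^ (n0 + 2)"
      unfolding P_def using cross_mod_large_exponent[of a "n0 + 2"] C0 by (intro mult_left_mono) auto
    ultimately show ?thesis by (intro that[of "n0 + 2"]) auto
  qed
  have upper: "?M p n \<le> K" for n
  proof (rule ccontr)
    assume "\<not> ?M p n \<le> K"
    then have K': "K < ?M p n" by simp
    have "p \<noteq> P" using excl[of P N n] N K' P3 by auto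
    then have "p < P" using pP by simp
    obtain c where c: "c > 0" and cc: "c = real (card (cells n :: ('i \<Rightarrow> nat) set))"
      using card_cells_pos by blast
    define \<epsilon> where "\<epsilon> = min (P - p) ((?M p n - K) / (2 * c))"
    have e: "\<epsilon> > 0" "\<epsilon> \<le> P - p" "\<epsilon> \<le> (?M p n - K) / (2 * c)"
      using \<open>p < P\<close> K' c by (auto simp: \<epsilon>_def)
    then have "c * \<epsilon> \<le> c * ((?M p n - K) / (2 * c))" using c by (intro mult_left_mono) auto
    also have "\<dots> = (?M p n - K) / 2" using c by simp
    also have "\<dots> < ?M p n - K" using K' by simp
    finally have "c * \<epsilon> < ?M p n - K" .
    moreover have "?M p n \<le> ?M (p + \<epsilon>) n + c * \<epsilon>"
      using cross_mod_exponent[of p "p + \<epsilon>" a n] p1 e by (simp add: cc)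
    ultimately have "K < ?M (p + \<epsilon>) n" by simp
    then have "p + \<epsilon> \<in> B" using p1 e by (auto simp: B_def)
    then have "p + \<epsilon> \<le> p" unfolding p_def by (rule cSup_upper[OF _ bdd])
    then show False using e by simp
  qed
  have lower: "1 / C \<le> ?M p n" if n: "n \<ge> 2" for n
  proof (rule ccontr)
    assume "\<not> 1 / C \<le> ?M p n"
    then obtain \<rho> where \<rho>: "adm a n \<rho>" "mass p n \<rho> < 1 / C" using cross_mod_approx[of a p n "1 / C"] by auto
    have "isCont (\<lambda>p. mass p n \<rho>) p" using \<rho>(1) by (intro mass_continuous) (simp add: adm_def)
    then have "eventually (\<lambda>x. mass x n \<rho> < 1 / C) (at p)"
      using \<rho>(2) order_tendstoD(2) unfolding isCont_def by blast
    then obtain \<epsilon> where e: "\<epsilon> > 0" "\<And>x. x \<noteq> p \<Longrightarrow> dist x p < \<epsilon> \<Longrightarrow> mass x n \<rho> < 1 / C"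
      by (auto simp: eventually_at)
    obtain x where x: "x \<in> B" "p - \<epsilon> < x"
      using less_cSup_iff[of B "p - \<epsilon>"] start bdd e(1) unfolding p_def by auto
    have "x \<le> p" unfolding p_def by (rule cSup_upper[OF x(1) bdd])
    then have "mass x n \<rho> < 1 / C"
      using e(2)[of x] \<rho>(2) x(2) by (cases "x = p") (auto simp: dist_real_def)
    then have "?M x n < 1 / C" using cross_mod_le[OF \<rho>(1), of x] by simp
    then have "C * ?M x n < 1" using C0 by (simp add: field_simps)
    then show False using excl[of x n] x(1) n by (auto simp: B_def)
  qed
  define c where "c = min (1 / C) (min (?M p 0) (?M p 1))"
  have "c > 0" using C0 pos[of p] p1 by (simp add: c_def)
  moreover have "c \<le> ?M p n" for n
  proof -
    consider "n = 0" | "n = 1" | "n \<ge> 2" by linarith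
    then show ?thesis using lower[of n] by cases (auto simp: c_def)
  qed
  ultimately show ?thesis using upper p1 by (intro exI[of _ p] exI[of _ c] exI[of _ K]) auto
qed


section \<open>Short connections\<close>

lemma conn_ivt:
  fixes g :: "('i \<Rightarrow> nat) \<Rightarrow> nat"
  assumes S: "conn S" "x \<in> S" "y \<in> S" and g: "\<And>u v. adj u v \<Longrightarrow> g v \<le> g u + 1"
    and t: "g x \<le> t" "t \<le> g y"
  shows "\<exists>v\<in>S. g v = t"
proof (cases "t = g y")
  case False
  then have "\<not> g y \<le> t" using t by simp
  then obtain u v where "u \<in> S" "v \<in> S" "adj u v" "g u \<le> t" "\<not> g v \<le> t"
    using conn_exit[OF S(1,2), of "\<lambda>u. g u \<le> t" y] t S(3) by blast
  then show ?thesis using g[of u v] by (intro bexI[of _ u]) auto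
qed (use S in blast)

lemma near_anc: "near r u v \<Longrightarrow> r \<le> 3 ^ s \<Longrightarrow> near 1 (anc s u) (anc s v)"
proof -
  have *: "a div 3 ^ s \<le> b div 3 ^ s + 1" if "a \<le> b + r" "r \<le> 3 ^ s" for a b :: nat
  proof -
    have "a div 3 ^ s \<le> (b + 3 ^ s) div 3 ^ s" using that by (intro div_le_mono) auto
    then show ?thesis by simp
  qed
  assume "near r u v" "r \<le> 3 ^ s"
  then show ?thesis by (auto simp: near_def anc_def intro: * simp del: One_nat_def)
qed

lemma near_not_both:
  assumes "near 1 f u" "near 1 f v" "2 \<le> s"
  shows "near 1 (anc s u) (anc s v)"
proof -
  have "near (1 + 1) u v" using assms near_sym near_trans by blast
  moreover have "(1 + 1 :: nat) \<le> 3 ^ s"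
    using power_increasing[OF assms(3), of "3::nat"] by simp
  ultimately show ?thesis by (rule near_anc)
qed

lemma leaves_near:
  fixes e :: "'i::finite \<Rightarrow> nat"
  assumes e: "e \<in> cells j" and s: "2 \<le> s"
    and Q: "\<And>g. g \<in> cells (j + s) \<Longrightarrow> anc s g = e \<Longrightarrow> \<exists>v\<in>Q. anc m v = g"
  shows "\<exists>y\<in>Q. \<not> near 1 f (anc m y)"
proof (rule ccontr)
  assume no: "\<not> ?thesis"
  fix i :: 'i
  obtain u0 u1 where u: "u0 \<in> cells s" "u0 i = 0" "u1 \<in> cells s" "u1 i = 3 ^ s - 1"
    using cells_faces[of s i] by blast
  let ?f0 = "lift_cell s e u0" and ?f1 = "lift_cell s e u1"
  have "\<exists>v\<in>Q. anc m v = ?f0" "\<exists>v\<in>Q. anc m v = ?f1"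
    using u e by (auto intro!: Q lift_cells simp: anc_lift)
  then have "near 1 f ?f0" "near 1 f ?f1" using no by metis+
  then have "near (1 + 1) ?f0 ?f1" using near_sym near_trans by blast
  then have "3 ^ s - 1 \<le> (2::nat)"
    using u by (auto simp: near_def lift_cell_def unzigzag_def dest!: spec[of _ i] split: if_splits)
  moreover have "(9::nat) \<le> 3 ^ s" using power_increasing[OF s, of "3::nat"] by simp
  ultimately show False by simp
qed

lemma exists_short_crossing:
  fixes a :: "'i::finite"
  assumes g: "\<And>u. 0 \<le> g u" and p: "p > 0" and c: "0 < c" "c \<le> cross_mod a p m"
  shows "\<exists>S\<in>cross a m. sum g S \<le> (mass p m g / c) powr (1 / p)"
proof (rule ccontr)
  assume no: "\<not> ?thesis"
  let ?t = "(mass p m g / c) powr (1 / p)"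
  define L where "L = Min (sum g ` cross a m)"
  have ne: "cross a m \<noteq> {}" using cells_cross by blast
  have "L \<in> sum g ` cross a m" unfolding L_def using ne by (intro Min_in) auto
  then have L: "?t < L" using no by auto
  have t0: "0 \<le> ?t" by simp
  then have L0: "L > 0" using L by linarith
  have "adm a m (\<lambda>v. g v / L)"
    unfolding adm_def
  proof (intro conjI allI ballI)
    fix S assume "S \<in> cross a m"
    then have "L \<le> sum g S" unfolding L_def by (intro Min_le) auto
    then show "1 \<le> (\<Sum>v\<in>S. g v / L)" using L0 by (simp add: sum_divide_distrib[symmetric])
  qed (use g L0 in auto)
  then have "cross_mod a p m \<le> mass p m (\<lambda>v. g v / L)" by (rule cross_mod_le)
  also have "\<dots> = mass p m g / L powr p"
    using g L0 by (simp add: mass_def powr_divide sum_divide_distrib)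
  finally have "cross_mod a p m * L powr p \<le> mass p m g" using L0 by (simp add: pos_le_divide_eq)
  moreover have "c * L powr p \<le> cross_mod a p m * L powr p" using c(2) by (intro mult_right_mono) auto
  ultimately have "c * L powr p \<le> mass p m g" by linarith
  moreover have "?t powr p < L powr p" using L t0 p by (intro powr_less_mono2) auto
  moreover have "?t powr p = mass p m g / c"
    using p c mass_nonneg[of p m g] by (simp add: powr_powr)
  ultimately show False using c by (simp add: divide_less_eq mult.commute)
qed

lemma connected_chain:
  fixes a :: "'i::finite" and E :: "('i \<Rightarrow> nat) set"
  assumes E: "E \<subseteq> cells j" "conn E" and \<rho>: "\<And>v. 0 \<le> \<rho> v" and p: "p > 0"
    and c: "0 < c" "c \<le> cross_mod a p m"
  shows "\<exists>O'. O' \<subseteq> cells (j + m) \<and> conn O' \<and> (\<forall>v\<in>O'. anc m v \<in> E) \<and> (\<forall>e\<in>E. \<exists>v\<in>O'. anc m v = e) \<and>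
    sum \<rho> O' \<le> (real (card E * CARD('i)) powr p * real CARD('i) / c) powr (1 / p) *
      (\<Sum>v\<in>{v \<in> cells (j + m). anc m v \<in> E}. \<rho> v powr p) powr (1 / p)"
proof -
  let ?g = "fold_weight a m E \<rho>"
  let ?R = "\<Sum>v\<in>{v \<in> cells (j + m). anc m v \<in> E}. \<rho> v powr p"
  let ?K = "real (card E * CARD('i)) powr p * real CARD('i)"
  obtain S where S: "S \<in> cross a m" "sum ?g S \<le> (mass p m ?g / c) powr (1 / p)"
    using exists_short_crossing[of ?g p c a m] fold_weight_nonneg[of \<rho>] \<rho> p c by blast
  have fE: "finite E" using E(1) finite_subset by blast
  have "sum \<rho> (unfold_set a j m E S) \<le> sum ?g S" by (rule sum_unfold_set_le[OF S(1) fE \<rho>])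
  also note S(2)
  also have "(mass p m ?g / c) powr (1 / p) \<le> (?K * ?R / c) powr (1 / p)"
    using mass_fold_weight_le[OF E(1) \<rho> p, of m a] mass_nonneg[of p m ?g] c p
    by (intro powr_mono2 divide_right_mono) (auto simp: divide_nonneg_pos)
  also have "\<dots> = (?K / c * ?R) powr (1 / p)" by simp
  also have "\<dots> = (?K / c) powr (1 / p) * ?R powr (1 / p)"
    by (rule powr_mult)
  finally have "sum \<rho> (unfold_set a j m E S) \<le> (?K / c) powr (1 / p) * ?R powr (1 / p)" .
  moreover have "\<exists>v\<in>unfold_set a j m E S. anc m v = e" if "e \<in> E" for e
  proof -
    obtain u where u: "u \<in> swaps a S" using swaps_props(3)[OF S(1)] by blast
    then have "u \<in> cells m" using swaps_props(2)[OF S(1)] by blast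
    then show ?thesis using unfold_set_I[OF S(1) E(1) that u] anc_lift by blast
  qed
  ultimately show ?thesis
    using conn_unfold_set[OF S(1) E] by (intro exI[of _ "unfold_set a j m E S"]) (auto simp: unfold_set_def)
qed

definition near_mass :: "real \<Rightarrow> nat \<Rightarrow> nat \<Rightarrow> (('i::finite \<Rightarrow> nat) \<Rightarrow> real) \<Rightarrow> ('i \<Rightarrow> nat) \<Rightarrow> real" where
  "near_mass p l m \<rho> e = (\<Sum>v\<in>{v \<in> cells l. near 2 e (anc m v)}. \<rho> v powr p)"

lemma near_mass_nonneg: "0 \<le> near_mass p l m \<rho> e"
  by (simp add: near_mass_def sum_nonneg)

lemma sum_le_card_powr:
  assumes "finite P" "\<And>v. v \<in> P \<Longrightarrow> \<rho> v powr p \<le> R" "\<And>v. 0 \<le> \<rho> v" "p > (0::real)"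
  shows "sum \<rho> P \<le> real (card P) * R powr (1 / p)"
proof (rule sum_bounded_above)
  fix v assume "v \<in> P"
  then have "(\<rho> v powr p) powr (1 / p) \<le> R powr (1 / p)" using assms by (intro powr_mono2) auto
  then show "\<rho> v \<le> R powr (1 / p)" using assms(3)[of v] assms(4) by (simp add: powr_powr)
qed

lemma card_anc_le:
  fixes E :: "('i::finite \<Rightarrow> nat) set"
  assumes "finite E"
  shows "card {v \<in> cells l. anc s v \<in> E} \<le> card E * (3 ^ s) ^ CARD('i)"
proof -
  have "real (card {v \<in> cells l. anc s v \<in> E}) = (\<Sum>v\<in>{v \<in> cells l. anc s v \<in> E}. (\<lambda>_. 1) (fold_cell s v))"
    by simp
  also have "\<dots> \<le> real (card E) * (\<Sum>u\<in>(cells s :: ('i \<Rightarrow> nat) set). 1)"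
    by (rule sum_fold_le[OF assms]) auto
  also have "\<dots> = real (card E * card (cells s :: ('i \<Rightarrow> nat) set))" by simp
  finally have "card {v \<in> cells l. anc s v \<in> E} \<le> card E * card (cells s :: ('i \<Rightarrow> nat) set)"
    by (simp only: of_nat_le_iff)
  also have "\<dots> \<le> card E * (3 ^ s) ^ CARD('i)" by (intro mult_left_mono card_cells_le) simp
  finally show ?thesis .
qed

text \<open>A set leaving the neighbourhood of \<open>e\<close> runs through a whole row of \<open>3 ^ s\<close> subblocks. Their
  neighbourhoods overlap at most five times, so one of them carries little mass.\<close>
lemma light_subblock:
  fixes e :: "'i::finite \<Rightarrow> nat"
  assumes s: "2 \<le> s" and X: "X \<subseteq> cells l" "conn X"
    and x: "x \<in> X" "anc (s + m') x = e" and y: "y \<in> X" "\<not> near 1 e (anc (s + m') y)"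
  shows "\<exists>v\<in>X. near 1 e (anc (s + m') v) \<and>
    near_mass p l m' \<rho> (anc m' v) \<le> 5 / 3 ^ s * near_mass p l (s + m') \<rho> e"
proof -
  let ?m = "s + m'"
  have x': "near 0 e (anc ?m x)" using x(2) by simp
  obtain S0 w i where S0: "conn S0" "S0 \<subseteq> X" "x \<in> S0" and w: "w \<in> S0"
    and near0: "\<And>v. v \<in> S0 \<Longrightarrow> near 1 e (anc ?m v)"
    and edge: "w i div 3 ^ ?m = e i + 1 \<and> w i mod 3 ^ ?m = 3 ^ ?m - 1 \<or>
      e i = w i div 3 ^ ?m + 1 \<and> w i mod 3 ^ ?m = 0"
    using exit_block[OF X(2) x(1) x', of y thesis] y by (simp only: add_0) blast
  define q where "q = w i div 3 ^ ?m"
  define g where "g v = v i div 3 ^ m'" for v :: "'i \<Rightarrow> nat"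
  have g_adj: "g v \<le> g u + 1" if "adj u v" for u v
  proof -
    have "v i \<le> u i + 1" using adj_near[OF that] unfolding near_def by blast
    then show ?thesis unfolding g_def by (rule div_step)
  qed
  have m: "(3::nat) ^ ?m = 3 ^ s * 3 ^ m'" by (simp add: power_add)
  have gq: "g v div 3 ^ s = v i div 3 ^ ?m" for v by (simp add: g_def m div_mult2_eq mult.commute)
  have xi: "x i div 3 ^ ?m = e i" using x(2) by (auto simp: anc_def)
  have row: "\<exists>v\<in>S0. g v = q * 3 ^ s + r" if r: "r < 3 ^ s" for r
  proof (cases "w i div 3 ^ ?m = e i + 1 \<and> w i mod 3 ^ ?m = 3 ^ ?m - 1")
    case True
    have "w i = q * 3 ^ ?m + (3 ^ ?m - 1)" using True div_mult_mod_eq[of "w i" "3 ^ ?m"] by (simp add: q_def)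
    then have "w i + 1 = q * 3 ^ ?m + 3 ^ ?m" by simp
    then have "w i + 1 = (q * 3 ^ s + 3 ^ s) * 3 ^ m'" unfolding m by (simp only: algebra_simps)
    moreover have "(q * 3 ^ s + r) * 3 ^ m' + 3 ^ m' \<le> (q * 3 ^ s + 3 ^ s) * 3 ^ m'"
    proof -
      have "(q * 3 ^ s + r + 1) * 3 ^ m' \<le> (q * 3 ^ s + 3 ^ s) * 3 ^ m'" using r by (intro mult_right_mono) auto
      then show ?thesis by (simp add: algebra_simps)
    qed
    moreover have "(1::nat) \<le> 3 ^ m'" by simp
    ultimately have "(q * 3 ^ s + r) * 3 ^ m' \<le> w i" by linarith
    then have "q * 3 ^ s + r \<le> g w" unfolding g_def by (simp add: less_eq_div_iff_mult_less_eq)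
    moreover have "g x \<le> q * 3 ^ s + r"
    proof -
      have "g x div 3 ^ s < q" using gq[of x] xi True by (simp add: q_def)
      then have "g x < q * 3 ^ s" by (simp add: div_less_iff_less_mult)
      then show ?thesis by simp
    qed
    ultimately show ?thesis by (intro conn_ivt[OF S0(1,3) w] g_adj)
  next
    case False
    then have ew: "e i = q + 1" "w i mod 3 ^ ?m = 0" using edge by (auto simp: q_def)
    have "w i = q * 3 ^ ?m" using ew div_mult_mod_eq[of "w i" "3 ^ ?m"] by (simp add: q_def)
    then have "g w = q * 3 ^ s" by (simp add: g_def m)
    then have "g w \<le> q * 3 ^ s + r" by simp
    moreover have "q * 3 ^ s + r \<le> g x"
    proof -
      have "q + 1 \<le> g x div 3 ^ s" using gq[of x] xi ew by simp
      then have "(q + 1) * 3 ^ s \<le> g x" by (simp add: less_eq_div_iff_mult_less_eq)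
      then show ?thesis using r by simp
    qed
    ultimately show ?thesis by (intro conn_ivt[OF S0(1) w S0(3)] g_adj)
  qed
  then obtain v where v: "\<And>r. r < 3 ^ s \<Longrightarrow> v r \<in> S0 \<and> g (v r) = q * 3 ^ s + r" by metis
  let ?A = "\<lambda>r. {u \<in> cells l. near 2 (anc m' (v r)) (anc m' u)}"
  let ?B = "{u \<in> cells l. near 2 e (anc ?m u)}"
  have sub: "?A r \<subseteq> ?B" if r: "r < 3 ^ s" for r
  proof
    fix u assume u: "u \<in> ?A r"
    have "(2::nat) \<le> 3 ^ s" using power_increasing[OF s, of "3::nat"] by simp
    then have "near 1 (anc s (anc m' (v r))) (anc s (anc m' u))" using u by (intro near_anc[of 2]) auto
    then have "near 1 (anc ?m (v r)) (anc ?m u)" by (simp add: anc_anc add.commute)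
    moreover have "near 1 e (anc ?m (v r))" using v[OF r] near0 by blast
    ultimately have "near (1 + 1) e (anc ?m u)" using near_trans by blast
    then show "u \<in> ?B" using u by (simp add: numeral_2_eq_2)
  qed
  have "(\<Sum>r<3 ^ s. near_mass p l m' \<rho> (anc m' (v r))) = (\<Sum>r<3 ^ s. \<Sum>u\<in>?B. if u \<in> ?A r then \<rho> u powr p else 0)"
    unfolding near_mass_def
  proof (rule sum.cong)
    fix r :: nat assume "r \<in> {..<3 ^ s}"
    then have "?A r \<subseteq> ?B" using sub by blast
    then show "sum (\<lambda>u. \<rho> u powr p) (?A r) = (\<Sum>u\<in>?B. if u \<in> ?A r then \<rho> u powr p else 0)"
      by (intro sum.mono_neutral_cong_left) auto
  qed simp
  also have "\<dots> = (\<Sum>u\<in>?B. \<Sum>r<3 ^ s. if u \<in> ?A r then \<rho> u powr p else 0)" by (rule sum.swap)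
  also have "\<dots> \<le> (\<Sum>u\<in>?B. 5 * \<rho> u powr p)"
  proof (rule sum_mono)
    fix u assume u: "u \<in> ?B"
    have "{r. r < 3 ^ s \<and> u \<in> ?A r} \<subseteq> {g u - q * 3 ^ s - 2..g u - q * 3 ^ s + 2}"
    proof
      fix r assume "r \<in> {r. r < 3 ^ s \<and> u \<in> ?A r}"
      then have "r < 3 ^ s" "near 2 (anc m' (v r)) (anc m' u)" by auto
      then have "anc m' (v r) i \<le> anc m' u i + 2 \<and> anc m' u i \<le> anc m' (v r) i + 2"
        unfolding near_def by blast
      then have "g (v r) \<le> g u + 2" "g u \<le> g (v r) + 2" unfolding g_def anc_def by auto
      moreover have "g (v r) = q * 3 ^ s + r" using v \<open>r < 3 ^ s\<close> by blast
      ultimately show "r \<in> {g u - q * 3 ^ s - 2..g u - q * 3 ^ s + 2}" by auto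
    qed
    then have "card {r. r < 3 ^ s \<and> u \<in> ?A r} \<le> card {g u - q * 3 ^ s - 2..g u - q * 3 ^ s + 2}"
      by (intro card_mono) auto
    also have "\<dots> \<le> 5" by simp
    finally have c5: "card {r. r < 3 ^ s \<and> u \<in> ?A r} \<le> 5" .
    have "(\<Sum>r<3 ^ s. if u \<in> ?A r then \<rho> u powr p else 0) = (\<Sum>r\<in>{r. r < 3 ^ s \<and> u \<in> ?A r}. \<rho> u powr p)"
      by (rule sum.mono_neutral_cong_right) auto
    also have "\<dots> = real (card {r. r < 3 ^ s \<and> u \<in> ?A r}) * \<rho> u powr p" by (rule sum_constant)
    also have "\<dots> \<le> 5 * \<rho> u powr p" using c5 by (intro mult_right_mono) (simp_all del: mem_Collect_eq)
    finally show "(\<Sum>r<3 ^ s. if u \<in> ?A r then \<rho> u powr p else 0) \<le> 5 * \<rho> u powr p" .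
  qed
  also have "\<dots> = 5 * near_mass p l ?m \<rho> e" by (simp add: near_mass_def sum_distrib_left)
  finally have total: "(\<Sum>r<3 ^ s. near_mass p l m' \<rho> (anc m' (v r))) \<le> 5 * near_mass p l ?m \<rho> e" .
  have "\<exists>r<3 ^ s. near_mass p l m' \<rho> (anc m' (v r)) \<le> 5 / 3 ^ s * near_mass p l ?m \<rho> e"
  proof (rule ccontr)
    assume "\<not> ?thesis"
    then have "(\<Sum>r<(3 ^ s::nat). 5 / 3 ^ s * near_mass p l ?m \<rho> e) < (\<Sum>r<3 ^ s. near_mass p l m' \<rho> (anc m' (v r)))"
      by (intro sum_strict_mono) (auto simp: not_le lessThan_empty_iff)
    moreover have "(\<Sum>r<(3 ^ s::nat). 5 / 3 ^ s * near_mass p l ?m \<rho> e) = 5 * near_mass p l ?m \<rho> e" by simp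
    ultimately show False using total by linarith
  qed
  then show ?thesis using v near0 S0(2) by blast
qed

definition crosses_block :: "nat \<Rightarrow> nat \<Rightarrow> ('i::finite \<Rightarrow> nat) \<Rightarrow> ('i \<Rightarrow> nat) set \<Rightarrow> bool" where
  "crosses_block l m e E \<longleftrightarrow> E \<subseteq> cells l \<and> conn E \<and> (\<exists>x\<in>E. anc m x = e) \<and> (\<exists>y\<in>E. \<not> near 1 e (anc m y))"

text \<open>Two sets crossing the same block are joined by a short connection: a chain through all
  subblocks runs close to both of them; the two remaining gaps are closed recursively inside a light
  subblock on each side. The lengths form a geometric series.\<close>
lemma short_connection:
  fixes a :: "'i::finite"
  assumes p: "p > 0" and c: "c > 0" "\<And>m. c \<le> cross_mod a p m"
  shows "\<exists>H\<ge>0. \<forall>m j e \<rho> E F. e \<in> cells j \<longrightarrow> (\<forall>v. 0 \<le> \<rho> v) \<longrightarrow>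
    crosses_block (j + m) m e E \<longrightarrow> crosses_block (j + m) m e F \<longrightarrow>
    (\<exists>P \<subseteq> cells (j + m). conn P \<and> P \<inter> E \<noteq> {} \<and> P \<inter> F \<noteq> {} \<and>
       (\<forall>v\<in>P. near 2 e (anc m v)) \<and> sum \<rho> P \<le> H * near_mass p (j + m) m (\<rho> :: ('i \<Rightarrow> nat) \<Rightarrow> real) e powr (1 / p))"
proof -
  let ?d = "CARD('i)"
  have "(\<lambda>s. 2 * (5 * (1 / 3 :: real) ^ s) powr (1 / p)) \<longlonglongrightarrow> 2 * (5 * 0) powr (1 / p)"
    using p by (intro tendsto_mult tendsto_const tendsto_powr' LIMSEQ_power_zero) auto
  then have "eventually (\<lambda>s. 2 * (5 * (1 / 3 :: real) ^ s) powr (1 / p) < 1 / 2) sequentially"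
    by (intro order_tendstoD(2)[where y = "2 * (5 * 0) powr (1 / p)"]) auto
  then obtain s0 where "\<And>s. s \<ge> s0 \<Longrightarrow> 2 * (5 * (1 / 3 :: real) ^ s) powr (1 / p) < 1 / 2"
    by (auto simp: eventually_sequentially)
  then have "2 * (5 * (1 / 3 :: real) ^ (s0 + 2)) powr (1 / p) < 1 / 2" using le_add1 by blast
  then obtain s where s: "s \<ge> 2" "2 * (5 / 3 ^ s) powr (1 / p) \<le> (1 / 2 :: real)"
    by (intro that[of "s0 + 2"]) (simp_all add: power_one_over)
  define N :: nat where "N = 3 ^ ?d * (3 ^ s) ^ ?d"
  define K where "K = (real (N * ?d) powr p * real ?d / c) powr (1 / p)"
  define H where "H = max (2 * K) (real ((3 ^ s) ^ ?d))"
  have K0: "K \<ge> 0" by (simp add: K_def)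
  have H: "H \<ge> 0" "2 * K \<le> H" "real ((3 ^ s) ^ ?d) \<le> H" by (auto simp: H_def le_max_iff_disj)
  have "\<exists>P \<subseteq> cells (j + m). conn P \<and> P \<inter> E \<noteq> {} \<and> P \<inter> F \<noteq> {} \<and>
       (\<forall>v\<in>P. near 2 e (anc m v)) \<and> sum \<rho> P \<le> H * near_mass p (j + m) m \<rho> e powr (1 / p)"
    if e: "e \<in> cells j" and \<rho>: "\<forall>v. 0 \<le> \<rho> v"
      and E: "E \<subseteq> cells (j + m)" "conn E" "\<exists>x\<in>E. anc m x = e" "\<exists>y\<in>E. \<not> near 1 e (anc m y)"
      and F: "F \<subseteq> cells (j + m)" "conn F" "\<exists>x\<in>F. anc m x = e" "\<exists>y\<in>F. \<not> near 1 e (anc m y)"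
    for m j e E F and \<rho> :: "('i \<Rightarrow> nat) \<Rightarrow> real"
    using e E F
  proof (induction m arbitrary: j e E F rule: less_induct)
    case (less m)
    note E = less.prems(2-5) and F = less.prems(6-9) and e = less.prems(1)
    let ?l = "j + m"
    define R where "R = near_mass p ?l m \<rho> e"
    have R0: "R \<ge> 0" unfolding R_def by (rule near_mass_nonneg)
    show ?case
    proof (cases "m < s")
      case True
      define P where "P = {v \<in> cells ?l. anc m v \<in> {e}}"
      have "card P \<le> card {e} * (3 ^ m) ^ ?d" unfolding P_def by (rule card_anc_le) simp
      also have "\<dots> \<le> (3 ^ s) ^ ?d" using True by (simp add: power_mono)
      finally have cP: "real (card P) \<le> H" using H(3) by (meson of_nat_le_iff order.trans)
      have conn: "conn P" unfolding P_def by (rule conn_subcells) (use e in auto)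
      have "sum \<rho> P \<le> real (card P) * R powr (1 / p)"
      proof (rule sum_le_card_powr)
        show "\<rho> v powr p \<le> R" if "v \<in> P" for v
          unfolding R_def near_mass_def using that by (intro member_le_sum) (auto simp: P_def)
      qed (use \<rho> p in \<open>auto simp: P_def\<close>)
      also have "\<dots> \<le> H * R powr (1 / p)" using cP by (intro mult_right_mono) auto
      finally show ?thesis
        using conn E F unfolding R_def by (intro exI[of _ P]) (auto simp: P_def)
    next
      case False
      define m' where "m' = m - s"
      have m: "m = s + m'" using False by (simp add: m'_def)
      have m'_less: "m' < m" using s(1) m by simp
      have l: "?l = (j + s) + m'" by (simp add: m)
      have anc2: "anc s (anc m' v) = anc m v" for v :: "'i \<Rightarrow> nat"
        by (simp add: anc_anc m add.commute)
      define W where "W = {w \<in> cells j. near 1 e w}"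
      define EE where "EE = {f \<in> cells (j + s). anc s f \<in> W}"
      have EE: "EE \<subseteq> cells (j + s)" "conn EE"
      proof -
        have "conn W" "W \<subseteq> cells j" unfolding W_def by (auto simp del: One_nat_def intro: conn_near e)
        then show "conn EE" unfolding EE_def by (rule conn_subcells)
      qed (auto simp: EE_def)
      have "card W \<le> card {w. near 1 e w}" unfolding W_def using card_near(1) by (intro card_mono) auto
      also have "\<dots> \<le> 3 ^ ?d" using card_near(2)[of 1 e] by (simp add: numeral_3_eq_3)
      finally have "card W \<le> 3 ^ ?d" .
      moreover have "finite W" by (simp add: W_def)
      then have "card EE \<le> card W * (3 ^ s) ^ ?d" unfolding EE_def by (rule card_anc_le)
      ultimately have "card EE \<le> N" unfolding N_def by (meson mult_le_mono1 order.trans)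
      then have "card EE * ?d \<le> N * ?d" by simp
      then have cEE: "real (card EE * ?d) \<le> real (N * ?d)" by (simp only: of_nat_le_iff)
      have \<rho>': "\<And>v. 0 \<le> \<rho> v" using \<rho> by blast
      obtain Q where Q: "Q \<subseteq> cells ?l" "conn Q" "\<forall>v\<in>Q. anc m' v \<in> EE" "\<forall>f\<in>EE. \<exists>v\<in>Q. anc m' v = f"
        and Qsum: "sum \<rho> Q \<le> (real (card EE * ?d) powr p * real ?d / c) powr (1 / p) *
          (\<Sum>v\<in>{v \<in> cells ?l. anc m' v \<in> EE}. \<rho> v powr p) powr (1 / p)"
        using connected_chain[OF EE, of \<rho> p c a m', OF \<rho>' p c] l by auto
      have near2: "near 2 e (anc m v)" if "anc m' v \<in> EE" for v
      proof -
        have "near 1 e (anc m v)" using that anc2[of v] by (auto simp: EE_def W_def)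
        then show ?thesis by (rule near_mono) simp
      qed
      have "(\<Sum>v\<in>{v \<in> cells ?l. anc m' v \<in> EE}. \<rho> v powr p) \<le> R"
        unfolding R_def near_mass_def using near2 by (intro sum_mono2) auto
      then have "(\<Sum>v\<in>{v \<in> cells ?l. anc m' v \<in> EE}. \<rho> v powr p) powr (1 / p) \<le> R powr (1 / p)"
        using p by (intro powr_mono2) (auto simp: sum_nonneg)
      moreover have "(real (card EE * ?d) powr p * real ?d / c) powr (1 / p) \<le> K"
        unfolding K_def using cEE p c(1)
        by (intro powr_mono2 divide_right_mono mult_right_mono) auto
      ultimately have "sum \<rho> Q \<le> K * R powr (1 / p)"
        using Qsum K0 by (meson mult_mono order.trans powr_ge_zero)
      also have "\<dots> \<le> (H / 2) * R powr (1 / p)" using H(2) by (intro mult_right_mono) auto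
      finally have Qs: "sum \<rho> Q \<le> (H / 2) * R powr (1 / p)" .
      have branch: "\<exists>P \<subseteq> cells ?l. conn P \<and> P \<inter> X \<noteq> {} \<and> P \<inter> Q \<noteq> {} \<and> (\<forall>v\<in>P. near 2 e (anc m v)) \<and>
          sum \<rho> P \<le> (H / 4) * R powr (1 / p)"
        if X: "X \<subseteq> cells ?l" "conn X" "\<exists>x\<in>X. anc m x = e" "\<exists>y\<in>X. \<not> near 1 e (anc m y)" for X
      proof -
        obtain x y where x: "x \<in> X" "anc m x = e" and y: "y \<in> X" "\<not> near 1 e (anc m y)" using X by blast
        obtain v where v: "v \<in> X" "near 1 e (anc m v)"
          and light: "near_mass p ?l m' \<rho> (anc m' v) \<le> 5 / 3 ^ s * R"
          using light_subblock[OF s(1) X(1,2), of x m' e y p \<rho>] x y unfolding R_def m by blast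
        define f where "f = anc m' v"
        have vl: "v \<in> cells ((j + s) + m')" using v(1) X(1) l by auto
        have f: "f \<in> cells (j + s)" unfolding f_def by (rule anc_cells[OF vl])
        have "anc m v \<in> cells j" using v(1) X(1) anc_cells by blast
        then have fEE: "f \<in> EE" using f v(2) anc2[of v] by (simp add: EE_def W_def f_def)
        have X4: "\<exists>y\<in>X. \<not> near 1 f (anc m' y)"
        proof (rule ccontr)
          assume "\<not> ?thesis"
          then have "near 1 (anc s (anc m' x)) (anc s (anc m' y))"
            using x y s(1) by (intro near_not_both[of f]) auto
          then show False using x y by (simp add: anc2)
        qed
        have Q4: "\<exists>y\<in>Q. \<not> near 1 f (anc m' y)"
        proof (rule leaves_near[OF e s(1)])
          fix g assume "g \<in> cells (j + s)" "anc s g = e"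
          then have "g \<in> EE" using e by (simp add: EE_def W_def)
          then show "\<exists>v\<in>Q. anc m' v = g" using Q(4) by blast
        qed
        have X3: "\<exists>x\<in>X. anc m' x = f" using v(1) f_def by blast
        have Q3: "\<exists>x\<in>Q. anc m' x = f" using Q(4) fEE by blast
        obtain P where P: "P \<subseteq> cells ?l" "conn P" "P \<inter> X \<noteq> {}" "P \<inter> Q \<noteq> {}" "\<forall>v\<in>P. near 2 f (anc m' v)"
          and Ps: "sum \<rho> P \<le> H * near_mass p ?l m' \<rho> f powr (1 / p)"
          using less.IH[OF m'_less f, of X Q] X Q X3 X4 Q3 Q4 unfolding l by blast
        have "near 2 e (anc m u)" if "u \<in> P" for u
        proof -
          have "(2::nat) \<le> 3 ^ s" using power_increasing[OF s(1), of "3::nat"] by simp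
          then have "near 1 (anc s f) (anc s (anc m' u))" using P(5) that by (intro near_anc[of 2]) auto
          then have "near 1 (anc m v) (anc m u)" by (simp add: anc2 f_def)
          then have "near (1 + 1) e (anc m u)" using v(2) near_trans by blast
          then show ?thesis by (simp add: numeral_2_eq_2)
        qed
        moreover have "sum \<rho> P \<le> (H / 4) * R powr (1 / p)"
        proof -
          have "near_mass p ?l m' \<rho> f powr (1 / p) \<le> (5 / 3 ^ s * R) powr (1 / p)"
            using light p near_mass_nonneg unfolding f_def by (intro powr_mono2) auto
          also have "\<dots> = (5 / 3 ^ s) powr (1 / p) * R powr (1 / p)" by (rule powr_mult)
          also have "\<dots> \<le> (1 / 4) * R powr (1 / p)" using s(2) by (intro mult_right_mono) auto
          finally have "H * near_mass p ?l m' \<rho> f powr (1 / p) \<le> H * ((1 / 4) * R powr (1 / p))"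
            using H(1) by (rule mult_left_mono)
          then show ?thesis using Ps by simp
        qed
        ultimately show ?thesis using P by blast
      qed
      obtain P1 where P1: "P1 \<subseteq> cells ?l" "conn P1" "P1 \<inter> E \<noteq> {}" "P1 \<inter> Q \<noteq> {}"
        "\<forall>v\<in>P1. near 2 e (anc m v)" "sum \<rho> P1 \<le> (H / 4) * R powr (1 / p)"
        using branch[OF E] by blast
      obtain P2 where P2: "P2 \<subseteq> cells ?l" "conn P2" "P2 \<inter> F \<noteq> {}" "P2 \<inter> Q \<noteq> {}"
        "\<forall>v\<in>P2. near 2 e (anc m v)" "sum \<rho> P2 \<le> (H / 4) * R powr (1 / p)"
        using branch[OF F] by blast
      define P where "P = (P1 \<union> Q) \<union> P2"
      have fin: "finite P1" "finite P2" "finite Q" using P1(1) P2(1) Q(1) finite_subset by blast+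
      have "conn (P1 \<union> Q)" by (rule conn_Un_meet[OF P1(2) Q(2) P1(4)])
      then have "conn P" unfolding P_def by (rule conn_Un_meet[OF _ P2(2)]) (use P2(4) in blast)
      moreover have "sum \<rho> P \<le> sum \<rho> P1 + sum \<rho> Q + sum \<rho> P2"
      proof -
        have "sum \<rho> (A \<union> B) \<le> sum \<rho> A + sum \<rho> B" if "finite A" "finite B" for A B
          using sum.union_inter[OF that, of \<rho>] sum_nonneg[of "A \<inter> B" \<rho>] \<rho>' by simp
        then show ?thesis unfolding P_def using fin by (smt (verit) finite_UnI)
      qed
      then have "sum \<rho> P \<le> H * R powr (1 / p)" using P1(6) P2(6) Qs by argo
      moreover have "\<forall>v\<in>P. near 2 e (anc m v)" using P1(5) P2(5) Q(3) near2 by (auto simp: P_def)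
      moreover have "P \<subseteq> cells ?l" using P1(1) P2(1) Q(1) by (auto simp: P_def)
      moreover have "P \<inter> E \<noteq> {}" "P \<inter> F \<noteq> {}" using P1(3) P2(3) by (auto simp: P_def)
      ultimately show ?thesis unfolding R_def by blast
    qed
  qed
  note main = this
  show ?thesis
    unfolding crosses_block_def by (rule exI[of _ H], intro conjI allI impI H(1), elim conjE, rule main)
qed


section \<open>Geometry of the carpets\<close>

lemma joined_limit_path:
  fixes A :: "nat \<Rightarrow> 'a::{complete_space, real_normed_vector} set"
  assumes dec: "\<And>k. A (Suc k) \<subseteq> A k" and cl: "closed (A 0)"
    and g: "\<And>k. path (g k)" "\<And>k. path_image (g k) \<subseteq> A k"
      "\<And>k. pathstart (g k) = c k" "\<And>k. pathfinish (g k) = c (Suc k)"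
    and diam: "\<And>k u v. u \<in> A k \<Longrightarrow> v \<in> A k \<Longrightarrow> dist u v \<le> r k" and r: "r \<longlonglongrightarrow> 0"
    and x: "\<And>k. x \<in> A k"
  shows "path_component (A 0) (c 0) x"
proof -
  define H where "H = (\<lambda>N k. rec_nat (\<lambda>_. c N) (\<lambda>j h. g (N - Suc j) +++ h) (N - k))"
  have H_N: "H N N = (\<lambda>_. c N)" for N by (simp add: H_def)
  have H_step: "H N k = g k +++ H N (Suc k)" if "k < N" for N k
  proof -
    obtain j where j: "N - k = Suc j" using \<open>k < N\<close> by (metis Suc_diff_Suc)
    then have "N - Suc k = j" "N - Suc j = k" using that by auto
    then show ?thesis by (simp add: H_def j)
  qed
  have cA: "c k \<in> A k" for k using g(2)[of k] pathstart_in_path_image[of "g k"] by (auto simp: g(3))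
  have props: "path (H N k) \<and> path_image (H N k) \<subseteq> A k \<and> pathstart (H N k) = c k \<and> pathfinish (H N k) = c N"
    if "k \<le> N" for N k
    using that
  proof (induction "N - k" arbitrary: k)
    case 0
    then have "k = N" by simp
    then show ?case using cA by (auto simp: H_N path_def pathstart_def pathfinish_def path_image_def)
  next
    case (Suc j)
    then have "k < N" "j = N - Suc k" by auto
    then have IH: "path (H N (Suc k))" "path_image (H N (Suc k)) \<subseteq> A (Suc k)"
      "pathstart (H N (Suc k)) = c (Suc k)" "pathfinish (H N (Suc k)) = c N"
      using Suc.hyps(1)[of "Suc k"] by auto
    then have "path_image (H N k) \<subseteq> A k"
      unfolding H_step[OF \<open>k < N\<close>] using g(2)[of k] dec[of k] by (intro subset_path_image_join) (auto dest: subsetD)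
    then show ?case using IH g by (simp add: H_step[OF \<open>k < N\<close>])
  qed
  have dec': "A M \<subseteq> A k" if "k \<le> M" for k M
    using that by (induction rule: dec_induct) (use dec in auto)
  have close: "dist (H N k t) (H M k t) \<le> r N" if "k \<le> N" "N \<le> M" "t \<in> {0..1}" for k N M t
    using that
  proof (induction "N - k" arbitrary: k t)
    case 0
    then have "k = N" by simp
    moreover have "H M N t \<in> A N" using props[OF 0(3)] 0 by (auto simp: path_image_def)
    ultimately show ?case using cA diam by (simp add: H_N)
  next
    case (Suc j)
    then have k: "k < N" "k < M" "j = N - Suc k" by auto
    have rN: "0 \<le> r N" using diam[OF cA cA, of N] by simp
    show ?case
      unfolding H_step[OF k(1)] H_step[OF k(2)] joinpaths_def
      using Suc.hyps(1)[OF k(3), of "2 * t - 1"] k Suc.prems rN by auto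
  qed
  have "\<forall>e>0. \<exists>N. \<forall>n m t. N \<le> n \<and> N \<le> m \<and> t \<in> {0..1} \<longrightarrow> dist (H n 0 t) (H m 0 t) < e"
  proof (intro allI impI)
    fix e :: real assume "e > 0"
    then obtain N where N: "r n < e" if "n \<ge> N" for n
      using order_tendstoD(2)[OF r, of e] by (auto simp: eventually_sequentially)
    have "dist (H n 0 t) (H m 0 t) < e" if "N \<le> n" "N \<le> m" "t \<in> {0..1}" for n m t
      using close[of 0 n m t] close[of 0 m n t] N[of n] N[of m] that
      by (cases "n \<le> m") (auto simp: dist_commute intro: le_less_trans)
    then show "\<exists>N. \<forall>n m t. N \<le> n \<and> N \<le> m \<and> t \<in> {0..1} \<longrightarrow> dist (H n 0 t) (H m 0 t) < e" by blast
  qed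
  then obtain f where f: "\<forall>e>0. \<exists>N. \<forall>n t. N \<le> n \<and> t \<in> {0..1} \<longrightarrow> dist (H n 0 t) (f t) < e"
    using uniformly_convergent_eq_cauchy[of "\<lambda>t. t \<in> {0..1}" "\<lambda>n. H n 0"] by auto
  then have unif: "uniform_limit {0..1} (\<lambda>n. H n 0) f sequentially"
    unfolding uniform_limit_iff eventually_sequentially by blast
  have lim: "(\<lambda>n. H n 0 t) \<longlonglongrightarrow> f t" if "t \<in> {0..1}" for t
    using tendsto_uniform_limitI[OF unif that] .
  have "continuous_on {0..1} f"
    using props by (intro uniform_limit_theorem[OF _ unif]) (auto simp: path_def)
  then have "path f" by (simp add: path_def)
  moreover have "path_image f \<subseteq> A 0"
  proof
    fix y assume "y \<in> path_image f"
    then obtain t where t: "t \<in> {0..1}" "y = f t" by (auto simp: path_image_def)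
    have "H n 0 t \<in> A 0" for n using props[of 0 n] t(1) by (auto simp: path_image_def)
    then show "y \<in> A 0" using closed_sequentially[OF cl _ lim[OF t(1)]] t(2) by blast
  qed
  moreover have "pathstart f = c 0"
  proof -
    have "H n 0 0 = c 0" for n using props[of 0 n] by (simp add: pathstart_def)
    then show ?thesis using lim[of 0] by (simp add: pathstart_def LIMSEQ_const_iff)
  qed
  moreover have "pathfinish f = x"
  proof -
    have "H n 0 1 = c n" for n using props[of 0 n] by (simp add: pathfinish_def)
    then have "c \<longlonglongrightarrow> f 1" using lim[of 1] by simp
    moreover have "c \<longlonglongrightarrow> x"
    proof (rule metric_tendsto_imp_tendsto[OF r])
      show "eventually (\<lambda>n. dist (c n) x \<le> dist (r n) 0) sequentially"
        using diam[OF cA x] by (intro always_eventually allI) (metis abs_ge_self dist_real_def diff_zero order.trans)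
    qed
    ultimately show ?thesis by (simp add: pathfinish_def LIMSEQ_unique)
  qed
  ultimately show ?thesis unfolding path_component_def by blast
qed

locale carpet_coordinates =
  fixes \<beta> :: "'i::finite \<Rightarrow> 'a::euclidean_space"
  assumes bij: "bij_betw \<beta> UNIV Basis"
begin

definition crd :: "'a \<Rightarrow> 'i \<Rightarrow> real" where "crd x i = x \<bullet> \<beta> i"

definition pt :: "('i \<Rightarrow> real) \<Rightarrow> 'a" where "pt f = (\<Sum>i\<in>UNIV. f i *\<^sub>R \<beta> i)"

definition cube :: "nat \<Rightarrow> ('i \<Rightarrow> nat) \<Rightarrow> 'a set" where
  "cube n v = {x. \<forall>i. real (v i) / 3 ^ n \<le> crd x i \<and> crd x i \<le> (real (v i) + 1) / 3 ^ n}"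

definition carpet :: "'a set" where
  "carpet = {x. \<forall>n. \<exists>v\<in>cells n. x \<in> cube n v}"

definition cset :: "nat \<Rightarrow> ('i \<Rightarrow> nat) \<Rightarrow> 'a set" where
  "cset n v = carpet \<inter> cube n v"

definition hit :: "nat \<Rightarrow> 'a set \<Rightarrow> ('i \<Rightarrow> nat) set" where
  "hit n C = {v \<in> cells n. C \<inter> cube n v \<noteq> {}}"

definition corner :: "nat \<Rightarrow> ('i \<Rightarrow> nat) \<Rightarrow> 'a" where
  "corner n v = pt (\<lambda>i. real (v i) / 3 ^ n)"

lemma d_ge: "real CARD('i) \<ge> 1"
  by (simp add: Suc_le_eq card_gt_0_iff)

lemma beta_Basis: "\<beta> i \<in> Basis"
  using bij by (auto simp: bij_betw_def)

lemma beta_inner: "\<beta> i \<bullet> \<beta> j = (if i = j then 1 else 0)"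
  using bij inner_Basis[OF beta_Basis beta_Basis, of i j] by (auto simp: bij_betw_def inj_on_def)

lemma crd_pt [simp]: "crd (pt f) i = f i"
  by (simp add: crd_def pt_def inner_sum_left beta_inner if_distrib cong: if_cong)

lemma continuous_crd [continuous_intros]: "continuous_on S (\<lambda>x. crd x i)"
  unfolding crd_def by (intro continuous_intros)


lemma crd_le_dist: "\<bar>crd x i - crd y i\<bar> \<le> dist x y"
  using Basis_le_norm[OF beta_Basis, of "x - y" i]
  by (simp add: crd_def dist_norm inner_diff_left)

lemma dist_le_crd: "dist x y \<le> (\<Sum>i\<in>UNIV. \<bar>crd x i - crd y i\<bar>)"
proof -
  have "dist x y \<le> (\<Sum>b\<in>Basis. \<bar>(x - y) \<bullet> b\<bar>)"
    unfolding dist_norm by (rule norm_le_l1)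
  also have "\<dots> = (\<Sum>i\<in>UNIV. \<bar>crd x i - crd y i\<bar>)"
    unfolding sum.reindex_bij_betw[OF bij, symmetric] by (simp add: crd_def inner_diff_left)
  finally show ?thesis .
qed

lemma dist_le_uniform: "(\<And>i. \<bar>crd x i - crd y i\<bar> \<le> h) \<Longrightarrow> dist x y \<le> real CARD('i) * h"
  using dist_le_crd[of x y] sum_bounded_above[of UNIV "\<lambda>i. \<bar>crd x i - crd y i\<bar>" h] by force

lemma closed_cube: "closed (cube n v)"
proof -
  have "cube n v = (\<Inter>i. {x. real (v i) / 3 ^ n \<le> crd x i} \<inter> {x. crd x i \<le> (real (v i) + 1) / 3 ^ n})"
    by (auto simp: cube_def)
  then show ?thesis
    by (auto intro!: closed_INT closed_Int closed_Collect_le continuous_intros)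
qed

lemma cube_iff: "x \<in> cube n v \<longleftrightarrow> (\<forall>i. real (v i) \<le> crd x i * 3 ^ n \<and> crd x i * 3 ^ n \<le> real (v i) + 1)"
  by (simp add: cube_def pos_divide_le_eq pos_le_divide_eq)

lemma cube_anc:
  assumes "x \<in> cube (n + m) v"
  shows "x \<in> cube n (anc m v)"
  unfolding cube_iff
proof
  fix i
  have v: "real (v i) \<le> crd x i * 3 ^ n * 3 ^ m" "crd x i * 3 ^ n * 3 ^ m \<le> real (v i) + 1"
    using assms by (auto simp: cube_iff power_add mult.assoc)
  have "anc m v i * 3 ^ m \<le> v i" by (simp add: anc_def)
  then have "real (anc m v i * 3 ^ m) \<le> real (v i)" by (simp only: of_nat_le_iff)
  then have "real (anc m v i) * 3 ^ m \<le> real (v i)" by simp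
  then have "real (anc m v i) * 3 ^ m \<le> (crd x i * 3 ^ n) * 3 ^ m" using v(1) by linarith
  moreover have "v i + 1 \<le> (anc m v i + 1) * 3 ^ m"
    by (metis Suc_eq_plus1 Suc_leI anc_def dividend_less_times_div mult.commute mult_Suc zero_less_numeral zero_less_power add.commute)
  then have "real (v i + 1) \<le> real ((anc m v i + 1) * 3 ^ m)" by (simp only: of_nat_le_iff)
  then have "real (v i) + 1 \<le> (real (anc m v i) + 1) * 3 ^ m" by (simp add: distrib_right)
  then have "(crd x i * 3 ^ n) * 3 ^ m \<le> (real (anc m v i) + 1) * 3 ^ m" using v(2) by linarith
  ultimately show "real (anc m v i) \<le> crd x i * 3 ^ n \<and> crd x i * 3 ^ n \<le> real (anc m v i) + 1"
    by (simp only: mult_le_cancel_right_pos zero_less_power zero_less_numeral)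
qed

lemma cube_touch:
  assumes "x \<in> cube n v" "y \<in> cube n w" "\<And>i. \<bar>crd x i - crd y i\<bar> < 1 / 3 ^ n"
  shows "near 1 v w"
  unfolding near_def
proof
  fix i
  have "\<bar>crd x i * 3 ^ n - crd y i * 3 ^ n\<bar> < 1"
    using assms(3)[of i] by (simp add: pos_less_divide_eq abs_mult flip: left_diff_distrib)
  then have "real (v i) < real (w i) + 2" "real (w i) < real (v i) + 2"
    using assms(1,2)[unfolded cube_iff, THEN spec, of i] by linarith+
  then show "v i \<le> w i + 1 \<and> w i \<le> v i + 1" by linarith
qed

lemma cube_near_dist:
  assumes "x \<in> cube n v" "y \<in> cube n w" "near r v w"
  shows "dist x y \<le> real CARD('i) * ((real r + 1) / 3 ^ n)"
proof (rule dist_le_uniform)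
  fix i
  have "v i \<le> w i + r" "w i \<le> v i + r" using assms(3) by (auto simp: near_def)
  then have "real (v i) \<le> real (w i) + real r" "real (w i) \<le> real (v i) + real r" by linarith+
  then have "\<bar>crd x i * 3 ^ n - crd y i * 3 ^ n\<bar> \<le> real r + 1"
    using assms(1,2)[unfolded cube_iff, THEN spec, of i] by linarith
  then show "\<bar>crd x i - crd y i\<bar> \<le> (real r + 1) / 3 ^ n"
    by (simp add: pos_le_divide_eq abs_mult flip: left_diff_distrib)
qed

subsection \<open>Points of the carpet\<close>

lemma edge_in_carpet:
  assumes v: "v \<in> cells n" and others: "\<And>j. j \<noteq> i \<Longrightarrow> crd x j = real (v j) / 3 ^ n"
    and axis: "real (v i) / 3 ^ n \<le> crd x i" "crd x i \<le> (real (v i) + 1) / 3 ^ n"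
  shows "x \<in> carpet"
proof -
  have refine: "\<exists>w\<in>cells (n + k). x \<in> cube (n + k) w" for k
  proof -
    define y where "y = (crd x i * 3 ^ n - real (v i)) * 3 ^ k"
    have y: "0 \<le> y" "y \<le> 3 ^ k"
    proof -
      have "0 \<le> crd x i * 3 ^ n - real (v i)" "crd x i * 3 ^ n - real (v i) \<le> 1"
        using axis by (simp_all add: pos_divide_le_eq pos_le_divide_eq)
      then show "0 \<le> y" "y \<le> 3 ^ k" unfolding y_def by (auto intro: mult_left_le_one_le)
    qed
    obtain t where t: "t < 3 ^ k" "real t \<le> y" "y \<le> real t + 1"
    proof (cases "y = 3 ^ k")
      case True
      then show ?thesis by (intro that[of "3 ^ k - 1"]) (auto simp: of_nat_diff)
    next
      case False
      define t where "t = nat \<lfloor>y\<rfloor>"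
      have "real t = of_int \<lfloor>y\<rfloor>" using y(1) by (simp add: t_def)
      then have "real t \<le> y" "y < real t + 1" by linarith+
      moreover have "real t < 3 ^ k" using calculation(1) y(2) False by linarith
      then have "real t < real (3 ^ k)" by (simp only: of_nat_power of_nat_numeral)
      then have "t < 3 ^ k" unfolding of_nat_less_iff .
      ultimately show ?thesis by (intro that[of t]) auto
    qed
    define u where "u = (\<lambda>j. if j = i then t else 0)"
    have "u \<in> cells k" using t(1) by (auto simp: cells_def u_def)
    then have "(\<lambda>j. v j * 3 ^ k + u j) \<in> cells (n + k)" by (rule block_cells[OF v])
    moreover have "x \<in> cube (n + k) (\<lambda>j. v j * 3 ^ k + u j)"
      unfolding cube_iff
    proof
      fix j
      show "real (v j * 3 ^ k + u j) \<le> crd x j * 3 ^ (n + k) \<and> crd x j * 3 ^ (n + k) \<le> real (v j * 3 ^ k + u j) + 1"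
      proof (cases "j = i")
        case True
        have "crd x i * 3 ^ (n + k) = real (v i) * 3 ^ k + y"
          by (simp add: y_def power_add algebra_simps)
        then show ?thesis using t True by (simp add: u_def)
      next
        case False
        then have "crd x j * 3 ^ (n + k) = real (v j) * 3 ^ k" by (simp add: others power_add)
        then show ?thesis using False by (simp add: u_def)
      qed
    qed
    ultimately show ?thesis by blast
  qed
  have "\<exists>w\<in>cells N. x \<in> cube N w" for N
  proof (cases "n \<le> N")
    case True
    then show ?thesis using refine[of "N - n"] by simp
  next
    case False
    then have nN: "n = N + (n - N)" by simp
    have "x \<in> cube n v"
      unfolding cube_def
    proof (intro CollectI allI)
      fix j show "real (v j) / 3 ^ n \<le> crd x j \<and> crd x j \<le> (real (v j) + 1) / 3 ^ n"
        using others[of j] axis by (cases "j = i") (auto simp: divide_right_mono)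
    qed
    then show ?thesis using cube_anc[of x N "n - N" v] anc_cells[of v N "n - N"] v nN by auto
  qed
  then show ?thesis by (simp add: carpet_def)
qed

lemma corner_in_cset:
  assumes "v \<in> cells n"
  shows "corner n v \<in> cset n v"
proof -
  have "corner n v \<in> carpet" using assms by (rule edge_in_carpet) (auto simp: corner_def divide_right_mono)
  then show ?thesis by (auto simp: cset_def corner_def cube_def divide_right_mono)
qed

lemma child_cube:
  assumes v: "v \<in> cells n" and x: "x \<in> cset n v"
  shows "\<exists>w\<in>cells (n + k). anc k w = v \<and> x \<in> cube (n + k) w"
proof -
  obtain u where u: "u \<in> cells (n + k)" "x \<in> cube (n + k) u" using x by (auto simp: cset_def carpet_def)
  define r where "r i = (if crd x i * 3 ^ n = real (v i) then 0
    else if crd x i * 3 ^ n = real (v i) + 1 then 3 ^ k - 1 else u i mod 3 ^ k)" for i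
  have xv: "real (v i) \<le> crd x i * 3 ^ n" "crd x i * 3 ^ n \<le> real (v i) + 1" for i
    using x by (auto simp: cset_def cube_iff)
  have xu: "real (u i) \<le> crd x i * 3 ^ n * 3 ^ k" "crd x i * 3 ^ n * 3 ^ k \<le> real (u i) + 1" for i
    using u(2) by (auto simp: cube_iff power_add mult.assoc)
  have rl: "r i < 3 ^ k" for i by (auto simp: r_def)
  have "ones (r i) \<subseteq> ones (u i)" for i
    using ones_div_mod[of "u i" k] by (auto simp: r_def)
  then have "ones (r i) \<inter> ones (r j) = {}" if "i \<noteq> j" for i j
    using u(1) that unfolding cells_def by blast
  then have "r \<in> cells k" using rl by (simp add: cells_def)
  then have w: "(\<lambda>i. v i * 3 ^ k + r i) \<in> cells (n + k)" by (rule block_cells[OF v])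
  have "anc k (\<lambda>i. v i * 3 ^ k + r i) = v" using rl by (simp add: anc_def)
  moreover have "x \<in> cube (n + k) (\<lambda>i. v i * 3 ^ k + r i)"
    unfolding cube_iff
  proof
    fix i
    let ?y = "crd x i * 3 ^ n"
    have eq: "crd x i * 3 ^ (n + k) = ?y * 3 ^ k" by (simp add: power_add)
    consider "?y = real (v i)" | "?y = real (v i) + 1" | "real (v i) < ?y" "?y < real (v i) + 1"
      using xv[of i] by linarith
    then show "real (v i * 3 ^ k + r i) \<le> crd x i * 3 ^ (n + k) \<and> crd x i * 3 ^ (n + k) \<le> real (v i * 3 ^ k + r i) + 1"
      unfolding eq
    proof cases
      case 1
      then show "real (v i * 3 ^ k + r i) \<le> ?y * 3 ^ k \<and> ?y * 3 ^ k \<le> real (v i * 3 ^ k + r i) + 1"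
        by (simp add: r_def)
    next
      case 2
      then have "real (r i) = 3 ^ k - 1" by (simp add: r_def of_nat_diff)
      then show "real (v i * 3 ^ k + r i) \<le> ?y * 3 ^ k \<and> ?y * 3 ^ k \<le> real (v i * 3 ^ k + r i) + 1"
        by (simp add: 2 distrib_right)
    next
      case 3
      have "real (v i) * 3 ^ k < ?y * 3 ^ k" "?y * 3 ^ k < (real (v i) + 1) * 3 ^ k"
        using 3 by simp_all
      then have "real (v i) * 3 ^ k < real (u i) + 1" "real (u i) < (real (v i) + 1) * 3 ^ k"
        using xu[of i] by linarith+
      then have "real (v i * 3 ^ k) < real (u i + 1)" "real (u i) < real ((v i + 1) * 3 ^ k)"
        by (simp_all add: distrib_right)
      then have "v i * 3 ^ k < u i + 1" "u i < (v i + 1) * 3 ^ k" by (simp_all only: of_nat_less_iff)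
      then have "u i div 3 ^ k = v i" by (intro div_nat_eqI) (auto simp: mult.commute)
      then have "v i * 3 ^ k + u i mod 3 ^ k = u i" by (metis div_mult_mod_eq)
      then have "real (v i * 3 ^ k + r i) = real (u i)" using 3 by (simp add: r_def)
      then show "real (v i * 3 ^ k + r i) \<le> ?y * 3 ^ k \<and> ?y * 3 ^ k \<le> real (v i * 3 ^ k + r i) + 1"
        using xu[of i] by simp
    qed
  qed
  ultimately show ?thesis using w by blast
qed

lemma closed_carpet: "closed carpet"
proof -
  have "carpet = (\<Inter>n. \<Union>v\<in>cells n. cube n v)" by (auto simp: carpet_def)
  then show ?thesis by (auto intro!: closed_INT closed_UN closed_cube)
qed

lemma carpet_unit: "x \<in> carpet \<Longrightarrow> 0 \<le> crd x i \<and> crd x i \<le> 1"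
proof -
  assume "x \<in> carpet"
  then obtain v where "v \<in> cells 0" "x \<in> cube 0 v" by (auto simp: carpet_def)
  then show ?thesis by (auto simp: cells_0 cube_iff)
qed

lemma carpet_dist: "x \<in> carpet \<Longrightarrow> y \<in> carpet \<Longrightarrow> dist x y \<le> real CARD('i)"
proof -
  assume "x \<in> carpet" "y \<in> carpet"
  then have "\<bar>crd x i - crd y i\<bar> \<le> 1" for i
    using carpet_unit[of x i] carpet_unit[of y i] by linarith
  then have "dist x y \<le> real CARD('i) * 1" by (rule dist_le_uniform)
  then show ?thesis by simp
qed

lemma compact_carpet: "compact carpet"
proof (cases "carpet = {}")
  case False
  then obtain x where "x \<in> carpet" by blast
  then have "carpet \<subseteq> cball x (real CARD('i))" using carpet_dist by auto
  then show ?thesis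
    using closed_carpet by (metis bounded_cball bounded_subset compact_eq_bounded_closed)
qed simp

subsection \<open>Cells met by a connected set\<close>

lemma conn_hit:
  assumes C: "connected C" "C \<subseteq> carpet"
  shows "conn (hit n C)"
proof (rule connI)
  fix T assume T: "T \<subseteq> hit n C" "T \<noteq> {}" and cl: "\<And>x y. x \<in> T \<Longrightarrow> y \<in> hit n C \<Longrightarrow> adj x y \<Longrightarrow> y \<in> T"
  show "hit n C \<subseteq> T"
  proof (rule ccontr)
    assume "\<not> hit n C \<subseteq> T"
    then obtain w0 where w0: "w0 \<in> hit n C" "w0 \<notin> T" by blast
    let ?A = "\<Union>v\<in>T. cube n v" and ?B = "\<Union>v\<in>hit n C - T. cube n v"
    have fin: "finite (hit n C)" by (simp add: hit_def)
    have clA: "closed ?A" using T(1) fin finite_subset by (intro closed_UN ballI closed_cube) auto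
    have clB: "closed ?B" using fin by (intro closed_UN ballI closed_cube) auto
    have "C \<subseteq> ?A \<union> ?B"
    proof
      fix x assume x: "x \<in> C"
      then obtain v where "v \<in> cells n" "x \<in> cube n v" using C(2) by (auto simp: carpet_def)
      then have "v \<in> hit n C" using x by (auto simp: hit_def)
      then show "x \<in> ?A \<union> ?B" using \<open>x \<in> cube n v\<close> by blast
    qed
    moreover have "?A \<inter> C \<noteq> {}" "?B \<inter> C \<noteq> {}" using T w0 by (auto simp: hit_def)
    ultimately have "?A \<inter> ?B \<inter> C \<noteq> {}"
      using connected_closedD[OF C(1) _ _ clA clB] by blast
    then obtain x v w where x: "x \<in> C" "x \<in> cube n v" "x \<in> cube n w" and v: "v \<in> T" and w: "w \<in> hit n C" "w \<notin> T"
      by blast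
    have near: "near 1 v w" by (rule cube_touch[OF x(2,3)]) simp
    have cells: "v \<in> cells n" "w \<in> cells n" using v w T(1) by (auto simp: hit_def)
    let ?Z = "{z \<in> cells n. \<forall>i. z i \<in> {v i, w i}}"
    have "?Z \<subseteq> T"
    proof (rule conn_subset_closed[OF conn_box[OF cells near], where S = "hit n C"])
      show "?Z \<subseteq> hit n C"
      proof
        fix z assume z: "z \<in> ?Z"
        have "x \<in> cube n z"
          unfolding cube_iff
        proof
          fix i
          have "z i = v i \<or> z i = w i" using z by auto
          then show "real (z i) \<le> crd x i * 3 ^ n \<and> crd x i * 3 ^ n \<le> real (z i) + 1"
            using x(2,3) unfolding cube_iff by metis
        qed
        then show "z \<in> hit n C" using z x(1) by (auto simp: hit_def)
      qed
      show "?Z \<inter> T \<noteq> {}" using v cells by auto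
    qed (use cl in blast)
    then show False using w cells by auto
  qed
qed

subsection \<open>Path connectedness\<close>

lemma segment_edge:
  assumes v: "u \<in> cells n" and w: "\<And>j. j \<noteq> i \<Longrightarrow> w j = u j" "w i = u i + 1"
  shows "closed_segment (corner n u) (corner n w) \<subseteq> cset n u"
proof
  fix x assume "x \<in> closed_segment (corner n u) (corner n w)"
  then obtain t where t: "0 \<le> t" "t \<le> 1" "x = (1 - t) *\<^sub>R corner n u + t *\<^sub>R corner n w"
    by (auto simp: closed_segment_def)
  have crd: "crd x j = (1 - t) * (real (u j) / 3 ^ n) + t * (real (w j) / 3 ^ n)" for j
    using crd_pt[of "\<lambda>i. real (u i) / 3 ^ n" j] crd_pt[of "\<lambda>i. real (w i) / 3 ^ n" j]
    by (simp add: t(3) crd_def corner_def inner_add_left)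
  have others: "crd x j = real (u j) / 3 ^ n" if "j \<noteq> i" for j
    unfolding crd w(1)[OF that] by (simp add: left_diff_distrib diff_divide_distrib)
  have ci: "crd x i = (real (u i) + t) / 3 ^ n"
    unfolding crd w(2) by (simp add: field_simps)
  have axis: "real (u i) / 3 ^ n \<le> crd x i" "crd x i \<le> (real (u i) + 1) / 3 ^ n"
    unfolding ci using t by (auto simp: divide_right_mono)
  have "x \<in> carpet" by (rule edge_in_carpet[OF v others axis])
  moreover have "x \<in> cube n u"
    unfolding cube_def
  proof (intro CollectI allI)
    fix j show "real (u j) / 3 ^ n \<le> crd x j \<and> crd x j \<le> (real (u j) + 1) / 3 ^ n"
      using others[of j] axis by (cases "j = i") (auto simp: divide_right_mono)
  qed
  ultimately show "x \<in> cset n u" by (simp add: cset_def)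
qed

lemma corners_path_component:
  assumes P: "conn P" "P \<subseteq> cells n" and uv: "u \<in> P" "v \<in> P"
  shows "path_component (\<Union>w\<in>P. cset n w) (corner n u) (corner n v)"
proof -
  let ?U = "\<Union>w\<in>P. cset n w"
  have in_U: "corner n w \<in> ?U" if "w \<in> P" for w using corner_in_cset that P by blast
  have step: "path_component ?U (corner n x) (corner n y)"
    if xy: "x \<in> P" "y \<in> P" "adj x y" for x y
  proof -
    obtain i where i: "\<forall>j. j \<noteq> i \<longrightarrow> x j = y j" "x i \<le> y i + 1" "y i \<le> x i + 1"
      using xy(3) by (auto simp: adj_def)
    consider "x i = y i" | "y i = x i + 1" | "x i = y i + 1" using i by linarith
    then have "closed_segment (corner n x) (corner n y) \<subseteq> ?U"
    proof cases
      case 1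
      then have "x = y" using i(1) by (metis ext)
      then show ?thesis using in_U xy by simp
    next
      case 2
      then have "closed_segment (corner n x) (corner n y) \<subseteq> cset n x"
        using i P xy by (intro segment_edge[where i = i]) auto
      then show ?thesis using xy by blast
    next
      case 3
      then have "closed_segment (corner n y) (corner n x) \<subseteq> cset n y"
        using i P xy by (intro segment_edge[where i = i]) auto
      then show ?thesis using xy by (auto simp: closed_segment_commute)
    qed
    then show ?thesis
      unfolding path_component_def by (intro exI[of _ "linepath (corner n x) (corner n y)"]) auto
  qed
  have "{w \<in> P. path_component ?U (corner n u) (corner n w)} = P"
  proof (rule connD[OF P(1)])
    show "{w \<in> P. path_component ?U (corner n u) (corner n w)} \<noteq> {}"
      using uv(1) in_U path_component_refl by blast
  qed (use step path_component_trans in \<open>blast+\<close>)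
  then show ?thesis using uv(2) by blast
qed

lemma cset_anc: "w \<in> cells (n + k) \<Longrightarrow> cset (n + k) w \<subseteq> cset n (anc k w)"
  using cube_anc by (auto simp: cset_def)

lemma closed_cset: "closed (cset n v)"
  unfolding cset_def by (intro closed_Int closed_carpet closed_cube)

lemma cset_path_component:
  assumes v: "v \<in> cells n" and x: "x \<in> cset n v"
  shows "path_component (cset n v) (corner n v) x"
proof -
  have "\<exists>f. \<forall>k. (f k \<in> cells (n + k) \<and> x \<in> cube (n + k) (f k) \<and> (k = 0 \<longrightarrow> f k = v)) \<and> anc 1 (f (Suc k)) = f k"
  proof (rule dependent_nat_choice)
    show "\<exists>w. w \<in> cells (n + 0) \<and> x \<in> cube (n + 0) w \<and> (0 = (0::nat) \<longrightarrow> w = v)"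
      using v x by (auto simp: cset_def)
  next
    fix w k assume w: "w \<in> cells (n + k) \<and> x \<in> cube (n + k) w \<and> (k = 0 \<longrightarrow> w = v)"
    have "x \<in> carpet" using x by (simp add: cset_def)
    then have "\<exists>z\<in>cells (n + k + 1). anc 1 z = w \<and> x \<in> cube (n + k + 1) z"
      using w by (intro child_cube) (auto simp: cset_def)
    then show "\<exists>z. (z \<in> cells (n + Suc k) \<and> x \<in> cube (n + Suc k) z \<and> (Suc k = 0 \<longrightarrow> z = v)) \<and> anc 1 z = w"
      by auto
  qed
  then obtain f where f: "\<And>k. f k \<in> cells (n + k)" "\<And>k. x \<in> cube (n + k) (f k)" "f 0 = v"
    "\<And>k. anc 1 (f (Suc k)) = f k" by blast
  define A where "A k = cset (n + k) (f k)" for k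
  have "\<exists>g. path g \<and> path_image g \<subseteq> A k \<and> pathstart g = corner (n + k) (f k) \<and>
      pathfinish g = corner (n + Suc k) (f (Suc k))" for k
  proof -
    let ?P = "{w \<in> cells (n + k + 1). anc 1 w \<in> {f k}}"
    have conn: "conn ?P" using f(1)[of k] by (intro conn_subcells) auto
    let ?c = "\<lambda>i. f k i * 3 ^ 1 + 0"
    have c: "?c \<in> ?P"
    proof -
      have "(\<lambda>_. 0) \<in> (cells 1 :: ('i \<Rightarrow> nat) set)" by (rule const_cells) auto
      from block_cells[OF f(1) this] have "?c \<in> cells (n + k + 1)" .
      then show ?thesis by (simp add: anc_def)
    qed
    have "f (Suc k) \<in> ?P" using f(1)[of "Suc k"] f(4) by simp
    then have pc: "path_component (\<Union>w\<in>?P. cset (n + k + 1) w) (corner (n + k + 1) ?c) (corner (n + k + 1) (f (Suc k)))"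
      using conn c by (intro corners_path_component) auto
    have "corner (n + k + 1) ?c = corner (n + k) (f k)" by (simp add: corner_def)
    moreover have "(\<Union>w\<in>?P. cset (n + k + 1) w) \<subseteq> A k"
    proof (rule UN_least)
      fix w assume "w \<in> ?P"
      then show "cset (n + k + 1) w \<subseteq> A k" using cset_anc[of w "n + k" 1] by (auto simp: A_def)
    qed
    ultimately have "path_component (A k) (corner (n + k) (f k)) (corner (n + Suc k) (f (Suc k)))"
      using path_component_of_subset[OF _ pc] by simp
    then show ?thesis by (auto simp: path_component_def)
  qed
  then obtain g where g: "\<And>k. path (g k)" "\<And>k. path_image (g k) \<subseteq> A k"
    "\<And>k. pathstart (g k) = corner (n + k) (f k)" "\<And>k. pathfinish (g k) = corner (n + Suc k) (f (Suc k))"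
    by metis
  have "path_component (A 0) (corner (n + 0) (f 0)) x"
  proof (rule joined_limit_path[where g = g and c = "\<lambda>k. corner (n + k) (f k)" and r = "\<lambda>k. real CARD('i) / 3 ^ (n + k)"])
    show "A (Suc k) \<subseteq> A k" for k
      unfolding A_def using cset_anc[of "f (Suc k)" "n + k" 1] f(1)[of "Suc k"] f(4)[of k] by simp
    show "closed (A 0)" unfolding A_def by (rule closed_cset)
    show "dist u w \<le> real CARD('i) / 3 ^ (n + k)" if "u \<in> A k" "w \<in> A k" for k u w
      using cube_near_dist[of u "n + k" "f k" w "f k" 0] that by (auto simp: A_def cset_def)
    have "(\<lambda>k. real CARD('i) / 3 ^ n * (1 / 3) ^ k) \<longlonglongrightarrow> real CARD('i) / 3 ^ n * 0"
      by (intro tendsto_mult tendsto_const LIMSEQ_power_zero) simp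
    then show "(\<lambda>k. real CARD('i) / 3 ^ (n + k)) \<longlonglongrightarrow> 0" by (simp add: power_add power_one_over divide_simps)
    show "x \<in> A k" for k using f(2) x by (auto simp: A_def cset_def)
  qed (use g in auto)
  then show ?thesis using f(3) by (simp add: A_def)
qed

lemma path_connected_cells:
  assumes P: "conn P" "P \<subseteq> cells n"
  shows "path_connected (\<Union>v\<in>P. cset n v)"
  unfolding path_connected_component
proof (intro ballI)
  let ?U = "\<Union>v\<in>P. cset n v"
  have to_corner: "path_component ?U (corner n v) x" if "v \<in> P" "x \<in> cset n v" for v x
    using cset_path_component[of v n x] that P by (intro path_component_of_subset[of "cset n v" ?U]) auto
  fix x y assume "x \<in> ?U" "y \<in> ?U"
  then obtain v w where v: "v \<in> P" "x \<in> cset n v" and w: "w \<in> P" "y \<in> cset n w" by blast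
  show "path_component ?U x y"
    using to_corner[OF v] to_corner[OF w] corners_path_component[OF P v(1) w(1)]
      path_component_sym path_component_trans by blast
qed

lemma arcwise_connected_carpet: "arcwise_connected carpet"
proof -
  have "carpet = (\<Union>v\<in>cells 0. cset 0 v)" by (auto simp: carpet_def cset_def)
  then have "path_connected carpet" using path_connected_cells[OF conn_cells order_refl] by metis
  then show ?thesis unfolding arcwise_connected_def path_connected_arcwise .
qed

subsection \<open>Doubling\<close>

lemma doubling_any: "doubling (Z :: 'a set)"
proof -
  let ?D = "int CARD('i)"
  let ?N = "card (PiE (UNIV::'i set) (\<lambda>_. {- 2 * ?D..2 * ?D}))"
  have fin: "finite (PiE (UNIV::'i set) (\<lambda>_. {- 2 * ?D..2 * ?D}))" by (intro finite_PiE) auto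
  have "\<exists>C. C \<subseteq> Z \<and> finite C \<and> card C \<le> ?N \<and> sball Z x r \<subseteq> (\<Union>c\<in>C. sball Z c (r / 2))"
    if "x \<in> Z" "r > 0" for x and r :: real
  proof -
    define h where "h = r / (2 * real CARD('i))"
    have h: "h > 0" "2 * real CARD('i) * h = r" using that(2) d_ge by (auto simp: h_def)
    define G where "G y = (\<lambda>i. \<lfloor>(crd y i - crd x i) / h\<rfloor>)" for y
    have same: "dist y z < r / 2" if "G y = G z" for y z
    proof -
      have "\<bar>crd y i - crd z i\<bar> < h" for i
      proof -
        have "\<lfloor>(crd y i - crd x i) / h\<rfloor> = \<lfloor>(crd z i - crd x i) / h\<rfloor>" using that by (metis G_def)
        then have "\<bar>(crd y i - crd x i) / h - (crd z i - crd x i) / h\<bar> < 1" by linarith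
        then have "\<bar>(crd y i - crd z i) / h\<bar> < 1" by (simp add: diff_divide_distrib)
        then show ?thesis using h(1) by simp
      qed
      then have "(\<Sum>i\<in>UNIV. \<bar>crd y i - crd z i\<bar>) < (\<Sum>i\<in>(UNIV::'i set). h)" by (intro sum_strict_mono) auto
      then show ?thesis using dist_le_crd[of y z] h(2) by simp
    qed
    have range: "G ` sball Z x r \<subseteq> PiE UNIV (\<lambda>_. {- 2 * ?D..2 * ?D})"
    proof
      fix q assume "q \<in> G ` sball Z x r"
      then obtain y where y: "dist x y < r" "q = G y" by (auto simp: sball_def)
      have "q i \<in> {- 2 * ?D..2 * ?D}" for i
      proof -
        have "\<bar>crd y i - crd x i\<bar> < 2 * real CARD('i) * h" using crd_le_dist[of y i x] y(1) h(2) by (simp add: dist_commute)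
        then have "\<bar>(crd y i - crd x i) / h\<bar> < 2 * real CARD('i)" using h(1) by (simp add: pos_divide_less_eq)
        then have "- (2 * real CARD('i)) \<le> (crd y i - crd x i) / h" "(crd y i - crd x i) / h < 2 * real CARD('i) + 1"
          by linarith+
        then show ?thesis unfolding y(2) G_def by (auto simp: le_floor_iff floor_le_iff)
      qed
      then show "q \<in> PiE UNIV (\<lambda>_. {- 2 * ?D..2 * ?D})" by auto
    qed
    define rep where "rep q = (SOME y. y \<in> sball Z x r \<and> G y = q)" for q
    have rep: "rep (G y) \<in> sball Z x r \<and> G (rep (G y)) = G y" if "y \<in> sball Z x r" for y
      unfolding rep_def by (rule someI[of _ y]) (use that in auto)
    define C where "C = rep ` G ` sball Z x r"
    have fG: "finite (G ` sball Z x r)" by (rule finite_subset[OF range fin])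
    then have "card C \<le> card (G ` sball Z x r)" unfolding C_def by (rule card_image_le)
    also have "\<dots> \<le> ?N" by (rule card_mono[OF fin range])
    finally have "card C \<le> ?N" .
    moreover have "C \<subseteq> Z" using rep by (auto simp: C_def sball_def)
    moreover have "sball Z x r \<subseteq> (\<Union>c\<in>C. sball Z c (r / 2))"
    proof
      fix y assume y: "y \<in> sball Z x r"
      then have "dist (rep (G y)) y < r / 2" using rep[OF y] by (intro same) auto
      moreover have "y \<in> Z" using y by (simp add: sball_def)
      ultimately show "y \<in> (\<Union>c\<in>C. sball Z c (r / 2))"
        using y unfolding C_def sball_def by blast
    qed
    ultimately show ?thesis using fG by (intro exI[of _ C]) (auto simp: C_def)
  qed
  then show ?thesis unfolding doubling_def by blast
qed

end


section \<open>Approximations and discrete modulus\<close>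

definition collar_bound :: "nat \<Rightarrow> real \<Rightarrow> real \<Rightarrow> nat \<Rightarrow> real" where
  "collar_bound d p C r = real d powr p * real d * real ((2 * r + 3) ^ d) * (C + 1)"

text \<open>The factor 27 makes continua of diameter \<open>(1/2)^k\<close> large compared with the cells covering them.\<close>
definition scale_level :: "nat \<Rightarrow> nat \<Rightarrow> nat" where
  "scale_level d k = (LEAST n. 27 * real d / 3 ^ n < (1 / 2) ^ k)"

context carpet_coordinates
begin

abbreviation level :: "nat \<Rightarrow> nat" where
  "level \<equiv> scale_level (card (range \<beta>))"

lemma card_range: "card (range \<beta>) = CARD('i)"
  using bij_betw_same_card[OF bij] bij_betw_imp_surj_on[OF bij] by simp

definition cover :: "nat \<Rightarrow> 'a set set" where
  "cover n = cset n ` cells n"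

text \<open>Appending the digits 02 to all coordinates of \<open>v\<close> gives a carpet point in the interior of its cube;
  the midpoint of the cube is not in the carpet.\<close>
definition mid :: "nat \<Rightarrow> ('i \<Rightarrow> nat) \<Rightarrow> 'a" where
  "mid n v = corner (n + 2) (\<lambda>i. v i * 3 ^ 2 + 2)"

lemma least_power:
  fixes x B :: real
  assumes x: "0 < x" "x \<le> B"
  obtains n where "B / 3 ^ n < x" "x \<le> 3 * (B / 3 ^ n)" "\<And>j. j < n \<Longrightarrow> x \<le> B / 3 ^ j"
proof -
  have B: "B > 0" using x by simp
  obtain n0 where "(1 / 3 :: real) ^ n0 < x / B"
    using real_arch_pow_inv[of "x / B" "1 / 3"] x B by auto
  then have ex: "B / 3 ^ n0 < x" using B by (simp add: power_one_over pos_less_divide_eq mult.commute)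
  define n where "n = (LEAST n. B / 3 ^ n < x)"
  have n: "B / 3 ^ n < x" unfolding n_def by (rule LeastI[of "\<lambda>n. B / 3 ^ n < x", OF ex])
  have less: "x \<le> B / 3 ^ j" if "j < n" for j
    using not_less_Least[of j "\<lambda>n. B / 3 ^ n < x"] that unfolding n_def by (simp add: not_less)
  have "n \<noteq> 0" using n x by (metis div_by_1 not_less power_0)
  then obtain m where m: "n = Suc m" by (metis not0_implies_Suc)
  then have "x \<le> 3 * (B / 3 ^ n)" using less[of m] by simp
  then show ?thesis using that n less by blast
qed

lemma level_bounds:
  "27 * real CARD('i) / 3 ^ level k < (1 / 2) ^ k" "(1 / 2) ^ k \<le> 81 * real CARD('i) / 3 ^ level k"
proof -
  have half: "(1 / 2 :: real) ^ k \<le> 1" by (simp add: power_le_one)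
  have "(1 / 2 :: real) ^ k \<le> 27 * real CARD('i)" using half d_ge by linarith
  then obtain n where n: "27 * real CARD('i) / 3 ^ n < (1 / 2) ^ k" "(1 / 2) ^ k \<le> 3 * (27 * real CARD('i) / 3 ^ n)"
    "\<And>j. j < n \<Longrightarrow> (1 / 2) ^ k \<le> 27 * real CARD('i) / 3 ^ j"
    using least_power[of "(1 / 2) ^ k" "27 * real CARD('i)"] by auto
  have "level k = n"
    unfolding scale_level_def card_range using n(1,3) by (intro Least_equality) (auto simp: not_less[symmetric])
  then show "27 * real CARD('i) / 3 ^ level k < (1 / 2) ^ k" "(1 / 2) ^ k \<le> 81 * real CARD('i) / 3 ^ level k"
    using n(1,2) by simp_all
qed

lemma crd_mid: "crd (mid n v) i * 3 ^ n = real (v i) + 2 / 9"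
  by (simp add: mid_def corner_def power_add field_simps)

lemma mid_carpet: "v \<in> cells n \<Longrightarrow> mid n v \<in> carpet"
proof -
  assume v: "v \<in> cells n"
  have "(\<lambda>_. 2) \<in> (cells 2 :: ('i \<Rightarrow> nat) set)" by (rule const_cells) (auto simp: ones_small)
  from corner_in_cset[OF block_cells[OF v this]] show ?thesis by (simp add: mid_def cset_def)
qed

lemma mid_cset: "v \<in> cells n \<Longrightarrow> mid n v \<in> cset n v"
  using mid_carpet by (auto simp: cset_def cube_iff crd_mid)

lemma near_mid:
  assumes "dist (mid n v) y < (2 / 9) / 3 ^ n"
  shows "real (v i) < crd y i * 3 ^ n" "crd y i * 3 ^ n < real (v i) + 1"
proof -
  have "\<bar>crd (mid n v) i - crd y i\<bar> < (2 / 9) / 3 ^ n" using crd_le_dist[of "mid n v" i y] assms by linarith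
  then have "\<bar>crd (mid n v) i * 3 ^ n - crd y i * 3 ^ n\<bar> < 2 / 9"
    by (simp add: pos_less_divide_eq abs_mult flip: left_diff_distrib)
  then show "real (v i) < crd y i * 3 ^ n" "crd y i * 3 ^ n < real (v i) + 1"
    unfolding crd_mid by linarith+
qed

lemma interior_unique:
  assumes "\<And>i. real (v i) < crd y i * 3 ^ n \<and> crd y i * 3 ^ n < real (v i) + 1" "y \<in> cube n w"
  shows "v = w"
proof
  fix i
  have "real (w i) \<le> crd y i * 3 ^ n" "crd y i * 3 ^ n \<le> real (w i) + 1" using assms(2) by (auto simp: cube_iff)
  then have "real (v i) < real (w i) + 1" "real (w i) < real (v i) + 1" using assms(1)[of i] by linarith+
  then show "v i = w i" by linarith
qed

lemma inj_cset: "inj_on (cset n) (cells n)"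
proof (rule inj_onI)
  fix v w assume "v \<in> cells n" "w \<in> cells n" "cset n v = cset n w"
  then have "mid n v \<in> cube n w" using mid_cset by (auto simp: cset_def)
  then show "v = w" by (intro interior_unique[of v "mid n v" n w]) (auto simp: crd_mid)
qed

lemma is_approx_cover: "is_approx carpet (1000 * real CARD('i)) (\<lambda>k. cover (level k))"
  unfolding is_approx_def
proof (intro conjI allI)
  let ?\<kappa> = "1000 * real CARD('i)"
  show \<kappa>: "1 \<le> ?\<kappa>" using d_ge by linarith
  fix k
  define n where "n = level k"
  have n: "27 * real CARD('i) / 3 ^ n < (1 / 2) ^ k" "(1 / 2) ^ k \<le> 81 * real CARD('i) / 3 ^ n"
    unfolding n_def by (rule level_bounds)+
  have small: "inverse ?\<kappa> * (1 / 2) ^ k \<le> (2 / 9) / 3 ^ n"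
  proof -
    have "inverse ?\<kappa> * (1 / 2) ^ k \<le> inverse ?\<kappa> * (81 * real CARD('i) / 3 ^ n)"
      using n(2) \<kappa> by (intro mult_left_mono) auto
    also have "\<dots> = (81 / 1000) / 3 ^ n" using d_ge by (simp add: field_simps)
    also have "\<dots> \<le> (2 / 9) / 3 ^ n" by (intro divide_right_mono) auto
    finally show ?thesis .
  qed
  define c where "c S = mid n (inv_into (cells n) (cset n) S)" for S
  have c: "c (cset n v) = mid n v" if "v \<in> cells n" for v
    using inv_into_f_f[OF inj_cset that] by (simp add: c_def)
  have inside: "\<forall>i. real (v i) < crd y i * 3 ^ n \<and> crd y i * 3 ^ n < real (v i) + 1"
    if "y \<in> sball carpet (mid n v) (inverse ?\<kappa> * (1 / 2) ^ k)" for y v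
    using near_mid[of n v y] that small by (auto simp: sball_def)
  show "is_approx_scale carpet ?\<kappa> k (cover (level k))"
    unfolding is_approx_scale_def n_def[symmetric]
  proof (intro conjI exI[of _ c] ballI impI)
    show "finite (cover n)" by (simp add: cover_def)
    show "\<Union> (cover n) = carpet" by (auto simp: cover_def cset_def carpet_def)
    fix S assume "S \<in> cover n"
    then obtain v where v: "v \<in> cells n" "S = cset n v" by (auto simp: cover_def)
    show "S \<subseteq> carpet" by (simp add: v cset_def)
    show "c S \<in> carpet" using v mid_carpet by (simp add: c)
    show "sball carpet (c S) (inverse ?\<kappa> * (1 / 2) ^ k) \<subseteq> S"
    proof
      fix y assume y: "y \<in> sball carpet (c S) (inverse ?\<kappa> * (1 / 2) ^ k)"
      then have "y \<in> cube n v" using inside[of y v] v by (auto simp: c cube_iff less_imp_le)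
      then show "y \<in> S" using y v by (simp add: cset_def sball_def)
    qed
    show "S \<subseteq> sball carpet (c S) (?\<kappa> * (1 / 2) ^ k)"
    proof
      fix y assume y: "y \<in> S"
      then have "dist (mid n v) y \<le> real CARD('i) * ((real 0 + 1) / 3 ^ n)"
        using mid_cset[OF v(1)] v by (intro cube_near_dist[of _ n v _ v]) (auto simp: cset_def)
      also have "\<dots> \<le> 27 * real CARD('i) / 3 ^ n" by (simp add: divide_right_mono)
      also have "\<dots> < (1 / 2) ^ k" by (rule n(1))
      also have "\<dots> \<le> ?\<kappa> * (1 / 2) ^ k" using \<kappa> by simp
      finally show "y \<in> sball carpet (c S) (?\<kappa> * (1 / 2) ^ k)"
        using y v(2) unfolding v(2) c[OF v(1)] by (simp add: sball_def cset_def)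
    qed
    fix S' assume "S' \<in> cover n" "S \<noteq> S'"
    then obtain w where w: "w \<in> cells n" "S' = cset n w" by (auto simp: cover_def)
    have False if y: "y \<in> sball carpet (c S) (inverse ?\<kappa> * (1 / 2) ^ k)" "y \<in> sball carpet (c S') (inverse ?\<kappa> * (1 / 2) ^ k)" for y
    proof -
      have "y \<in> cube n w" using inside[of y w] y w by (auto simp: c cube_iff less_imp_le)
      then have "v = w" using inside[of y v] y v by (intro interior_unique[of v y n w]) (auto simp: c)
      then show False using v w \<open>S \<noteq> S'\<close> by simp
    qed
    then show "sball carpet (c S) (inverse ?\<kappa> * (1 / 2) ^ k) \<inter> sball carpet (c S') (inverse ?\<kappa> * (1 / 2) ^ k) = {}"
      by blast
  qed
qed

lemma cset_meets: "G \<subseteq> carpet \<Longrightarrow> {S \<in> cover n. S \<inter> G \<noteq> {}} = cset n ` hit n G"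
  by (auto simp: cover_def hit_def cset_def)

lemma hit_subset: "hit n G \<subseteq> cells n"
  by (auto simp: hit_def)

lemma finite_hit [simp]: "finite (hit n G)"
  using hit_subset finite_subset by blast

lemma hit_nonempty:
  assumes x: "x \<in> G" and G: "G \<subseteq> carpet"
  shows "\<exists>v. v \<in> hit n G \<and> x \<in> cube n v"
  using assms by (fastforce simp: carpet_def hit_def)

lemma rho_length_cover:
  "G \<subseteq> carpet \<Longrightarrow> rho_length (cover n) \<rho> G = (\<Sum>v\<in>hit n G. \<rho> (cset n v))"
  unfolding rho_length_def cset_meets
  by (subst sum.reindex[OF inj_on_subset[OF inj_cset hit_subset]]) simp

lemma rho_mass_cover: "rho_mass p (cover n) \<rho> = mass p n (\<lambda>v. \<rho> (cset n v))"
  unfolding rho_mass_def mass_def cover_def by (subst sum.reindex[OF inj_cset]) simp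

lemma comb_mod_le:
  assumes \<tau>: "\<And>v. 0 \<le> \<tau> v" and F: "\<And>\<gamma>. \<gamma> \<in> F \<Longrightarrow> path_image \<gamma> \<subseteq> carpet \<and> 1 \<le> sum \<tau> (hit n (path_image \<gamma>))"
  shows "comb_mod p F (cover n) \<le> mass p n \<tau>"
proof (cases "F = {}")
  case False
  define \<rho> where "\<rho> S = \<tau> (inv_into (cells n) (cset n) S)" for S
  have \<rho>: "\<rho> (cset n v) = \<tau> v" if "v \<in> cells n" for v
    using inv_into_f_f[OF inj_cset that] by (simp add: \<rho>_def)
  have "rho_mass p (cover n) \<rho> = mass p n \<tau>"
    unfolding rho_mass_cover unfolding mass_def by (intro sum.cong) (auto simp: \<rho>)
  moreover have "rho_length (cover n) \<rho> (path_image \<gamma>) = sum \<tau> (hit n (path_image \<gamma>))" if "\<gamma> \<in> F" for \<gamma>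
    unfolding rho_length_cover[OF conjunct1[OF F[OF that]]]
    by (intro sum.cong refl \<rho>) (simp add: hit_def)
  ultimately have "mass p n \<tau> \<in> {rho_mass p (cover n) \<rho> | \<rho>. (\<forall>v\<in>cover n. \<rho> v \<ge> 0) \<and>
      (\<forall>\<gamma>\<in>F. rho_length (cover n) \<rho> (path_image \<gamma>) \<ge> 1)}"
    using F \<tau> by (intro CollectI exI[of _ \<rho>]) (auto simp: \<rho>_def)
  then have "Inf {rho_mass p (cover n) \<rho> | \<rho>. (\<forall>v\<in>cover n. \<rho> v \<ge> 0) \<and>
      (\<forall>\<gamma>\<in>F. rho_length (cover n) \<rho> (path_image \<gamma>) \<ge> 1)} \<le> mass p n \<tau>"
    by (rule cInf_lower) (auto intro!: bdd_belowI[of _ 0] simp: rho_mass_def sum_nonneg)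
  then show ?thesis using False by (simp add: comb_mod_def)
qed (simp add: comb_mod_def mass_nonneg)

lemma comb_mod_ge:
  assumes ne: "F \<noteq> {}" and F: "\<And>\<gamma>. \<gamma> \<in> F \<Longrightarrow> path_image \<gamma> \<subseteq> carpet"
    and x: "\<And>\<tau>. (\<And>v. 0 \<le> \<tau> v) \<Longrightarrow> (\<And>\<gamma>. \<gamma> \<in> F \<Longrightarrow> 1 \<le> sum \<tau> (hit n (path_image \<gamma>))) \<Longrightarrow> x \<le> mass p n \<tau>"
  shows "x \<le> comb_mod p F (cover n)"
proof -
  let ?S = "{rho_mass p (cover n) \<rho> | \<rho>. (\<forall>v\<in>cover n. \<rho> v \<ge> 0) \<and>
      (\<forall>\<gamma>\<in>F. rho_length (cover n) \<rho> (path_image \<gamma>) \<ge> 1)}"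
  have "x \<le> Inf ?S"
  proof (rule cInf_greatest)
    have "1 \<le> rho_length (cover n) (\<lambda>_. 1) (path_image \<gamma>)" if "\<gamma> \<in> F" for \<gamma>
    proof -
      have "hit n (path_image \<gamma>) \<noteq> {}"
        using hit_nonempty[OF pathstart_in_path_image F[OF that], of n] by blast
      then have "card (hit n (path_image \<gamma>)) \<noteq> 0" by simp
      then show ?thesis unfolding rho_length_cover[OF F[OF that]] by (simp add: Suc_le_eq card_gt_0_iff)
    qed
    then have "rho_mass p (cover n) (\<lambda>_. 1) \<in> ?S" by (intro CollectI exI[of _ "\<lambda>_. 1"]) auto
    then show "?S \<noteq> {}" by blast
    fix y assume "y \<in> ?S"
    then obtain \<rho> where y: "y = rho_mass p (cover n) \<rho>" and nn: "\<forall>v\<in>cover n. \<rho> v \<ge> 0"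
      and len: "\<forall>\<gamma>\<in>F. rho_length (cover n) \<rho> (path_image \<gamma>) \<ge> 1" by blast
    define \<tau> where "\<tau> v = (if v \<in> cells n then \<rho> (cset n v) else 0)" for v
    have "x \<le> mass p n \<tau>"
    proof (rule x)
      show "0 \<le> \<tau> v" for v using nn by (auto simp: \<tau>_def cover_def)
      fix \<gamma> assume g: "\<gamma> \<in> F"
      have "sum \<tau> (hit n (path_image \<gamma>)) = (\<Sum>v\<in>hit n (path_image \<gamma>). \<rho> (cset n v))"
        using hit_subset by (intro sum.cong) (auto simp: \<tau>_def)
      then show "1 \<le> sum \<tau> (hit n (path_image \<gamma>))"
        using len g unfolding rho_length_cover[OF F[OF g], symmetric] by simp
    qed
    also have "mass p n \<tau> = y"
      unfolding y rho_mass_cover mass_def by (intro sum.cong) (auto simp: \<tau>_def)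
    finally show "x \<le> y" .
  qed
  then show ?thesis using ne by (simp add: comb_mod_def)
qed

section \<open>Upper bounds\<close>

lemma collar_bound_pos: "C \<ge> 0 \<Longrightarrow> 0 < collar_bound CARD('i) p C r"
  by (simp add: collar_bound_def)

definition is_collar :: "real \<Rightarrow> real \<Rightarrow> nat \<Rightarrow> nat \<Rightarrow> nat \<Rightarrow> ('i \<Rightarrow> nat) \<Rightarrow> (('i \<Rightarrow> nat) \<Rightarrow> real) \<Rightarrow> bool" where
  "is_collar p M n m r e \<tau> \<longleftrightarrow> (\<forall>v. 0 \<le> \<tau> v) \<and> mass p n \<tau> \<le> M \<and>
    (\<forall>v. \<tau> v \<noteq> 0 \<longrightarrow> near (r + 1) e (anc m v) \<and> \<not> near r e (anc m v)) \<and>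
    (\<forall>S x y. S \<subseteq> cells n \<longrightarrow> conn S \<longrightarrow> x \<in> S \<longrightarrow> near r e (anc m x) \<longrightarrow> y \<in> S \<longrightarrow>
       \<not> near (r + 1) e (anc m y) \<longrightarrow> 1 \<le> sum \<tau> S)"

lemma is_collarD:
  assumes "is_collar p M n m r e \<tau>"
  shows "0 \<le> \<tau> v" "mass p n \<tau> \<le> M"
    "\<tau> v \<noteq> 0 \<Longrightarrow> near (r + 1) e (anc m v)" "\<tau> v \<noteq> 0 \<Longrightarrow> \<not> near r e (anc m v)"
    "S \<subseteq> cells n \<Longrightarrow> conn S \<Longrightarrow> x \<in> S \<Longrightarrow> near r e (anc m x) \<Longrightarrow> y \<in> S \<Longrightarrow>
       \<not> near (r + 1) e (anc m y) \<Longrightarrow> 1 \<le> sum \<tau> S"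
  using assms unfolding is_collar_def by blast+

lemma collar_exists:
  fixes a :: 'i and e :: "'i \<Rightarrow> nat"
  assumes p: "p > 0" and C: "\<And>n. cross_mod a p n \<le> C"
  shows "\<exists>\<tau>. is_collar p (collar_bound CARD('i) p C r) n m r e \<tau>"
proof -
  have "cross_mod a p m < C + 1" using C[of m] by linarith
  then obtain \<rho> where \<rho>: "adm a m \<rho>" "mass p m \<rho> < C + 1" using cross_mod_approx by blast
  have "mass p n (collar a m \<rho> r e) \<le> real CARD('i) powr p * real CARD('i) * real ((2 * r + 3) ^ CARD('i)) * mass p m \<rho>"
    unfolding mass_def[of p n] by (rule collar_mass[OF \<rho>(1) p])
  also have "\<dots> \<le> collar_bound CARD('i) p C r"
    unfolding collar_bound_def using \<rho>(2) by (intro mult_left_mono) auto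
  finally have "mass p n (collar a m \<rho> r e) \<le> collar_bound CARD('i) p C r" .
  moreover have "\<forall>v. collar a m \<rho> r e v \<noteq> 0 \<longrightarrow> near (r + 1) e (anc m v) \<and> \<not> near r e (anc m v)"
    by (auto simp: collar_def)
  moreover have "\<forall>v. 0 \<le> collar a m \<rho> r e v" using collar_nonneg[OF \<rho>(1)] by blast
  moreover have "\<forall>S x y. S \<subseteq> cells n \<longrightarrow> conn S \<longrightarrow> x \<in> S \<longrightarrow> near r e (anc m x) \<longrightarrow> y \<in> S \<longrightarrow>
      \<not> near (r + 1) e (anc m y) \<longrightarrow> 1 \<le> sum (collar a m \<rho> r e) S"
    by (intro allI impI collar_length[OF \<rho>(1)])
  ultimately have "is_collar p (collar_bound CARD('i) p C r) n m r e (collar a m \<rho> r e)"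
    unfolding is_collar_def by (intro conjI)
  then show ?thesis by (intro exI[of _ "collar a m \<rho> r e"])
qed

definition separating :: "nat \<Rightarrow> (('i \<Rightarrow> nat) \<Rightarrow> real) \<Rightarrow> 'a set \<Rightarrow> 'a set \<Rightarrow> bool" where
  "separating n \<tau> A B \<longleftrightarrow> (\<forall>v. 0 \<le> \<tau> v) \<and>
     (\<forall>G\<subseteq>carpet. connected G \<longrightarrow> G \<inter> A \<noteq> {} \<longrightarrow> G \<inter> B \<noteq> {} \<longrightarrow> 1 \<le> sum \<tau> (hit n G))"

lemma separating_comb_mod_le:
  assumes "separating n \<tau> A B"
  shows "comb_mod p (joining_curves carpet A B) (cover n) \<le> mass p n \<tau>"
    "comb_mod p (joining_curves carpet B A) (cover n) \<le> mass p n \<tau>"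
proof -
  have nn: "0 \<le> \<tau> v" for v using assms by (simp add: separating_def)
  have *: "1 \<le> sum \<tau> (hit n (path_image \<gamma>))"
    if "\<gamma> \<in> joining_curves carpet A B \<union> joining_curves carpet B A" for \<gamma>
  proof -
    have "path_image \<gamma> \<subseteq> carpet" "connected (path_image \<gamma>)"
      using that by (auto simp: joining_curves_def connected_path_image)
    moreover have "pathstart \<gamma> \<in> path_image \<gamma>" "pathfinish \<gamma> \<in> path_image \<gamma>" by auto
    then have "path_image \<gamma> \<inter> A \<noteq> {}" "path_image \<gamma> \<inter> B \<noteq> {}"
      using that by (auto simp: joining_curves_def)
    ultimately show ?thesis using assms by (simp add: separating_def)
  qed
  show "comb_mod p (joining_curves carpet A B) (cover n) \<le> mass p n \<tau>"
    "comb_mod p (joining_curves carpet B A) (cover n) \<le> mass p n \<tau>"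
    using nn * by (auto intro!: comb_mod_le simp: joining_curves_def)
qed

lemma card_hit_le:
  assumes A: "A \<subseteq> carpet" "A \<noteq> {}" "bounded A" and r: "diameter A * 3 ^ l \<le> real r"
  shows "card (hit l A) \<le> (2 * (r + 1) + 1) ^ CARD('i)"
proof -
  obtain x where x: "x \<in> A" using A by blast
  obtain u where u: "x \<in> cube l u" using hit_nonempty[OF x A(1)] by blast
  have "hit l A \<subseteq> {v. near (r + 1) u v}"
  proof
    fix v assume "v \<in> hit l A"
    then obtain y where y: "y \<in> A" "y \<in> cube l v" by (auto simp: hit_def)
    have "u i \<le> v i + (r + 1) \<and> v i \<le> u i + (r + 1)" for i
    proof -
      have "\<bar>crd x i - crd y i\<bar> \<le> diameter A"
        using crd_le_dist[of x i y] diameter_bounded_bound[OF A(3) x y(1)] by linarith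
      then have "\<bar>crd x i * 3 ^ l - crd y i * 3 ^ l\<bar> \<le> diameter A * 3 ^ l"
        by (simp add: abs_mult flip: left_diff_distrib)
      then have "\<bar>crd x i * 3 ^ l - crd y i * 3 ^ l\<bar> \<le> real r" using r by linarith
      moreover have "real (u i) \<le> crd x i * 3 ^ l" "crd x i * 3 ^ l \<le> real (u i) + 1"
        "real (v i) \<le> crd y i * 3 ^ l" "crd y i * 3 ^ l \<le> real (v i) + 1"
        using u y(2) by (auto simp: cube_iff)
      ultimately show ?thesis by linarith
    qed
    then show "v \<in> {v. near (r + 1) u v}" by (simp add: near_def)
  qed
  then have "card (hit l A) \<le> card {v. near (r + 1) u v}" by (intro card_mono card_near(1))
  also have "\<dots> \<le> (2 * (r + 1) + 1) ^ CARD('i)" by (rule card_near(2))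
  finally show ?thesis .
qed

lemma setdist_far:
  assumes "x \<in> A" "y \<in> B" "x \<in> cube l v" "y \<in> cube l w" "near r v w"
  shows "setdist A B \<le> real CARD('i) * ((real r + 1) / 3 ^ l)"
  using setdist_le_dist[OF assms(1,2)] cube_near_dist[OF assms(3-5)] by linarith

lemma crude_separation:
  fixes a :: 'i
  assumes p: "p > 0" and C: "\<And>n. cross_mod a p n \<le> C" "C \<ge> 0" and \<delta>: "\<delta> > 0"
  shows "\<exists>M. \<forall>A B n. A \<subseteq> carpet \<longrightarrow> B \<subseteq> carpet \<longrightarrow> bounded A \<longrightarrow> 0 < diameter A \<longrightarrow>
    \<delta> * diameter A \<le> setdist A B \<longrightarrow> (\<exists>\<tau>. separating n \<tau> A B \<and> mass p n \<tau> \<le> M)"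
proof -
  let ?D = "real CARD('i)"
  define \<delta>' where "\<delta>' = min \<delta> 1"
  have \<delta>': "0 < \<delta>'" "\<delta>' \<le> 1" "\<delta>' \<le> \<delta>" using \<delta> by (auto simp: \<delta>'_def)
  define r where "r = nat \<lceil>9 * ?D / \<delta>'\<rceil>"
  have r: "9 * ?D / \<delta>' \<le> real r" unfolding r_def by linarith
  define N where "N = real ((2 * (r + 1) + 1) ^ CARD('i))"
  define M where "M = N powr p * (N * collar_bound CARD('i) p C 0) + N"
  have N0: "N \<ge> 0" by (simp add: N_def)
  have B0: "collar_bound CARD('i) p C 0 > 0" by (rule collar_bound_pos[OF C(2)])
  have "\<exists>\<tau>. separating n \<tau> A B \<and> mass p n \<tau> \<le> M"
    if A: "A \<subseteq> carpet" and B: "B \<subseteq> carpet" and bA: "bounded A" and diam: "0 < diameter A"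
      and sep: "\<delta> * diameter A \<le> setdist A B" for A B n
  proof -
    have neA: "A \<noteq> {}" using diam by auto
    define R where "R = diameter A"
    have R: "0 < R" using diam by (simp add: R_def)
    have "R \<le> ?D"
    proof -
      have "diameter A \<le> ?D" using A carpet_dist by (intro diameter_le) (auto simp: dist_norm neA)
      then show ?thesis by (simp add: R_def)
    qed
    then have "\<delta>' * R \<le> 3 * ?D" using \<delta>' R d_ge mult_left_le_one_le[of R \<delta>'] by linarith
    then obtain l where l: "3 * ?D / 3 ^ l < \<delta>' * R" "\<delta>' * R \<le> 3 * (3 * ?D / 3 ^ l)"
      using least_power[of "\<delta>' * R" "3 * ?D"] \<delta>'(1) R by (metis mult_pos_pos)
    have Rl: "R * 3 ^ l \<le> real r"
    proof -
      have "\<delta>' * (R * 3 ^ l) \<le> 9 * ?D" using l(2) by (simp add: pos_le_divide_eq mult_ac)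
      then have "R * 3 ^ l \<le> 9 * ?D / \<delta>'" using \<delta>'(1) by (simp add: pos_le_divide_eq mult.commute)
      then show ?thesis using r by linarith
    qed
    have sep': "\<delta>' * R \<le> setdist A B"
    proof -
      have "\<delta>' * R \<le> \<delta> * R" using \<delta>' R by (intro mult_right_mono) auto
      then show ?thesis using sep by (simp add: R_def)
    qed
    have count: "real (card (hit k A)) \<le> N" if "k \<le> l" for k
    proof -
      have "R * 3 ^ k \<le> R * 3 ^ l" using R that by (intro mult_left_mono power_increasing) auto
      then have "diameter A * 3 ^ k \<le> real r" using Rl by (simp add: R_def)
      from card_hit_le[OF A neA bA this] show ?thesis unfolding N_def by (simp only: of_nat_le_iff)
    qed
    show ?thesis
    proof (cases "l \<le> n")
      case False
      define \<tau> where "\<tau> v = (if v \<in> hit n A then 1 else 0 :: real)" for v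
      have "separating n \<tau> A B"
        unfolding separating_def
      proof (intro conjI allI impI)
        fix G assume G: "G \<subseteq> carpet" "G \<inter> A \<noteq> {}"
        then obtain x where x: "x \<in> G" "x \<in> A" by blast
        obtain v where v: "v \<in> hit n G" "x \<in> cube n v" using hit_nonempty[OF x(1) G(1)] by blast
        then have "v \<in> hit n A" using x by (auto simp: hit_def)
        then have "1 = \<tau> v" by (simp add: \<tau>_def)
        also have "\<dots> \<le> sum \<tau> (hit n G)" using v by (intro member_le_sum) (auto simp: \<tau>_def)
        finally show "1 \<le> sum \<tau> (hit n G)" .
      qed (simp add: \<tau>_def)
      moreover have "mass p n \<tau> = real (card (hit n A))"
      proof -
        have "mass p n \<tau> = (\<Sum>v\<in>cells n. if v \<in> hit n A then 1 else 0)"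
          unfolding mass_def by (intro sum.cong) (auto simp: \<tau>_def)
        also have "\<dots> = (\<Sum>v\<in>cells n \<inter> hit n A. 1)" by (rule sum.inter_restrict[symmetric]) simp
        also have "cells n \<inter> hit n A = hit n A" using hit_subset by blast
        finally show ?thesis by simp
      qed
      then have "mass p n \<tau> \<le> M"
        using count[of n] False N0 B0 by (simp add: M_def add_increasing)
      ultimately show ?thesis by blast
    next
      case True
      define m where "m = n - l"
      have n: "n = l + m" using True by (simp add: m_def)
      define T where "T = hit l A"
      have "\<forall>e. \<exists>\<tau>. is_collar p (collar_bound CARD('i) p C 0) n m 0 e \<tau>"
        by (intro allI collar_exists[OF p C(1)])
      then obtain t where col: "\<And>e. is_collar p (collar_bound CARD('i) p C 0) n m 0 e (t e)" by metis
      note t = is_collarD(1,2)[OF col]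
      define \<tau> where "\<tau> v = (\<Sum>e\<in>T. t e v)" for v
      have "separating n \<tau> A B"
        unfolding separating_def
      proof (intro conjI allI impI)
        show "0 \<le> \<tau> v" for v unfolding \<tau>_def by (intro sum_nonneg t(1))
        fix G assume G: "G \<subseteq> carpet" "connected G" "G \<inter> A \<noteq> {}" "G \<inter> B \<noteq> {}"
        obtain x y where x: "x \<in> G" "x \<in> A" and y: "y \<in> G" "y \<in> B" using G by blast
        obtain v where v: "v \<in> hit n G" "x \<in> cube n v" using hit_nonempty[OF x(1) G(1)] by blast
        obtain w where w: "w \<in> hit n G" "y \<in> cube n w" using hit_nonempty[OF y(1) G(1)] by blast
        define e where "e = anc m v"
        have xe: "x \<in> cube l e" and yw: "y \<in> cube l (anc m w)"
          unfolding e_def using v(2) w(2) cube_anc n by blast+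
        have "v \<in> cells (l + m)" using v(1) hit_subset n by blast
        then have "e \<in> cells l" unfolding e_def by (rule anc_cells)
        then have eT: "e \<in> T" using xe x by (auto simp: T_def hit_def)
        have far: "\<not> near (0 + 1) e (anc m w)"
        proof
          assume "near (0 + 1) e (anc m w)"
          then have "setdist A B \<le> ?D * ((real (0 + 1) + 1) / 3 ^ l)"
            by (rule setdist_far[OF x(2) y(2) xe yw])
          also have "\<dots> \<le> 3 * ?D / 3 ^ l" by (simp add: divide_right_mono)
          also note l(1)
          finally show False using sep' by simp
        qed
        have "1 \<le> sum (t e) (hit n G)"
          by (rule is_collarD(5)[OF col hit_subset conn_hit[OF G(2,1)] v(1) _ w(1) far]) (simp add: e_def)
        also have "\<dots> \<le> sum \<tau> (hit n G)"
          unfolding \<tau>_def using eT t(1) by (intro sum_mono member_le_sum) (auto simp: T_def)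
        finally show "1 \<le> sum \<tau> (hit n G)" .
      qed
      moreover have "mass p n \<tau> \<le> M"
      proof -
        have cT: "real (card T) \<le> N" unfolding T_def by (rule count) simp
        have "mass p n \<tau> \<le> (\<Sum>v\<in>cells n. N powr p * (\<Sum>e\<in>T. t e v powr p))"
          unfolding mass_def \<tau>_def
        proof (intro sum_mono powr_sum_le)
          fix v
          have "card {e \<in> T. t e v \<noteq> 0} \<le> card T" by (intro card_mono) (auto simp: T_def)
          then show "real (card {e \<in> T. t e v \<noteq> 0}) \<le> N" using cT by linarith
        qed (use t(1) p in \<open>auto simp: T_def\<close>)
        also have "\<dots> = N powr p * (\<Sum>v\<in>cells n. \<Sum>e\<in>T. t e v powr p)" by (simp add: sum_distrib_left)
        also have "(\<Sum>v\<in>cells n. \<Sum>e\<in>T. t e v powr p) = (\<Sum>e\<in>T. mass p n (t e))"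
          unfolding mass_def by (rule sum.swap)
        also have "\<dots> \<le> real (card T) * collar_bound CARD('i) p C 0"
          using t(2) by (rule sum_bounded_above)
        also have "\<dots> \<le> N * collar_bound CARD('i) p C 0" using cT B0 by (intro mult_right_mono) auto
        finally have "mass p n \<tau> \<le> N powr p * (N * collar_bound CARD('i) p C 0)" by (simp add: mult_left_mono)
        then show ?thesis using N0 by (simp add: M_def)
      qed
      ultimately show ?thesis by blast
    qed
  qed
  then show ?thesis by blast
qed

text \<open>Collars at consecutive scales around a point of the smaller continuum are disjointly
  supported, so averaging \<open>J\<close> of them costs only \<open>J powr (1 - p)\<close>.\<close>
lemma fine_separation:
  fixes a :: 'i
  assumes p: "p > 1" and C: "\<And>n. cross_mod a p n \<le> C" "C \<ge> 0" and \<epsilon>: "\<epsilon> > 0"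
  shows "\<exists>T>0. \<forall>A B n. A \<subseteq> carpet \<longrightarrow> B \<subseteq> carpet \<longrightarrow> bounded A \<longrightarrow> B \<noteq> {} \<longrightarrow>
    1 / 3 ^ n \<le> diameter A \<longrightarrow> T * diameter A \<le> setdist A B \<longrightarrow> (\<exists>\<tau>. separating n \<tau> A B \<and> mass p n \<tau> \<le> \<epsilon>)"
proof -
  let ?D = "real CARD('i)"
  define K where "K = collar_bound CARD('i) p C 1"
  have K: "K > 0" unfolding K_def by (rule collar_bound_pos[OF C(2)])
  have "((\<lambda>J. K * real J powr (1 - p)) \<longlongrightarrow> K * 0) sequentially"
    using p by (intro tendsto_mult tendsto_const tendsto_neg_powr filterlim_real_sequentially) auto
  then have "eventually (\<lambda>J. K * real J powr (1 - p) < \<epsilon>) sequentially"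
    using \<epsilon> by (intro order_tendstoD(2)[where y = "K * 0"]) auto
  then obtain J0 where "\<And>J. J \<ge> J0 \<Longrightarrow> K * real J powr (1 - p) < \<epsilon>" by (auto simp: eventually_sequentially)
  then have "K * real (Suc J0) powr (1 - p) < \<epsilon>" using le_SucI[OF order_refl] by blast
  then obtain J where J: "J > 0" "K * real J powr (1 - p) < \<epsilon>" by blast
  define T where "T = 9 * ?D * 3 ^ J"
  have "T \<ge> 9"
  proof -
    have "1 * 1 \<le> ?D * 3 ^ J" using d_ge by (intro mult_mono) auto
    then show ?thesis by (simp add: T_def)
  qed
  have "\<exists>\<tau>. separating n \<tau> A B \<and> mass p n \<tau> \<le> \<epsilon>"
    if A: "A \<subseteq> carpet" and B: "B \<subseteq> carpet" "B \<noteq> {}" and bA: "bounded A" and fine: "1 / 3 ^ n \<le> diameter A"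
      and sep: "T * diameter A \<le> setdist A B" for A B n
  proof -
    define R where "R = diameter A"
    have "0 < 1 / (3::real) ^ n" by simp
    then have R: "0 < R" using fine unfolding R_def by linarith
    then have "A \<noteq> {}" by (auto simp: R_def)
    then obtain x0 where x0: "x0 \<in> A" by blast
    obtain y0 where y0: "y0 \<in> B" using B by blast
    have TR: "T * R \<le> ?D"
    proof -
      have "T * R \<le> dist x0 y0" using sep setdist_le_dist[OF x0 y0] by (simp add: R_def)
      also have "\<dots> \<le> ?D" using x0 y0 A B carpet_dist by blast
      finally show ?thesis .
    qed
    have "R \<le> 1"
    proof -
      have "9 * ?D * R \<le> T * R"
      proof (rule mult_right_mono)
        have "9 * ?D * 1 \<le> 9 * ?D * 3 ^ J" by (intro mult_left_mono) auto
        then show "9 * ?D \<le> T" by (simp add: T_def)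
      qed (use R in simp)
      moreover have "?D * (9 * R) = 9 * ?D * R" by (simp only: mult_ac)
      ultimately have "?D * (9 * R) \<le> ?D * 1" using TR by linarith
      then have "9 * R \<le> 1" by (rule mult_left_le_imp_le) (use d_ge in linarith)
      then show ?thesis using R by linarith
    qed
    then obtain L where L: "1 / 3 ^ L < R" "R \<le> 3 * (1 / 3 ^ L)" "\<And>j. j < L \<Longrightarrow> R \<le> 1 / 3 ^ j"
      using least_power[of R 1] R by metis
    have "J + 1 < L"
    proof (rule ccontr)
      assume "\<not> J + 1 < L"
      then have "(3::real) ^ L \<le> 3 ^ (J + 1)" by (intro power_increasing) auto
      then have "1 / 3 ^ (J + 1) \<le> 1 / (3::real) ^ L" by (intro divide_left_mono) auto
      then have "1 / 3 ^ (J + 1) < R" using L(1) by linarith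
      then have "T * (1 / 3 ^ (J + 1)) < T * R" using \<open>T \<ge> 9\<close> by (intro mult_strict_left_mono) auto
      moreover have "T * (1 / 3 ^ (J + 1)) = 3 * ?D" by (simp add: T_def)
      ultimately show False using TR d_ge by linarith
    qed
    define l0 where "l0 = L - 2"
    have l0: "L = l0 + 2" "J \<le> l0" using \<open>J + 1 < L\<close> by (auto simp: l0_def)
    have R_l0: "R < 1 / 3 ^ l0"
    proof -
      have "R \<le> 3 * (1 / 3 ^ L)" by (rule L(2))
      also have "\<dots> = (1 / 3) * (1 / 3 ^ l0)" by (simp add: l0(1) power_add)
      also have "\<dots> < 1 * (1 / 3 ^ l0)" by (intro mult_strict_right_mono) auto
      finally show ?thesis by simp
    qed
    have l0_n: "l0 \<le> n"
    proof (rule ccontr)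
      assume "\<not> l0 \<le> n"
      then have "(3::real) ^ n \<le> 3 ^ l0" by (intro power_increasing) auto
      then have "1 / 3 ^ l0 \<le> 1 / (3::real) ^ n" by (intro divide_left_mono) auto
      then show False using R_l0 fine by (simp add: R_def)
    qed
    obtain v0 where v0: "v0 \<in> hit n A" "x0 \<in> cube n v0" using hit_nonempty[OF x0 A] by blast
    define m where "m t = n - (l0 - t)" for t
    define e where "e t = anc (m t) v0" for t
    have n_split: "n = (l0 - t) + m t" if "t < J" for t using that l0 l0_n by (simp add: m_def)
    have "\<forall>t. \<exists>\<tau>. is_collar p K n (m t) 1 (e t) \<tau>"
      unfolding K_def by (intro allI collar_exists[OF _ C(1)]) (use p in simp)
    then obtain c where col: "\<And>t. is_collar p K n (m t) 1 (e t) (c t)" by metis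
    note c = is_collarD(1,2)[OF col]
    define \<tau> where "\<tau> v = (\<Sum>t<J. c t v) / real J" for v
    have nested: "c t v = 0 \<or> c t' v = 0" if "t < t'" "t' < J" for t t' v
    proof (rule ccontr)
      assume "\<not> ?thesis"
      then have nz: "c t v \<noteq> 0" "c t' v \<noteq> 0" by auto
      define s where "s = t' - t"
      have mt: "m t' = m t + s" using that l0 l0_n by (simp add: m_def s_def)
      have "s \<ge> 1" using that by (simp add: s_def)
      then have "(2::nat) \<le> 3 ^ s" using power_increasing[of 1 s "3::nat"] by simp
      moreover have "near 2 (e t) (anc (m t) v)" using is_collarD(3)[OF col nz(1)] by (simp add: numeral_2_eq_2)
      ultimately have "near 1 (anc s (e t)) (anc s (anc (m t) v))" by (intro near_anc[of 2])
      then have "near 1 (e t') (anc (m t') v)" by (simp add: e_def anc_anc mt)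
      then show False using is_collarD(4)[OF col nz(2)] by simp
    qed
    have "separating n \<tau> A B"
      unfolding separating_def
    proof (intro conjI allI impI)
      show "0 \<le> \<tau> v" for v unfolding \<tau>_def by (intro divide_nonneg_nonneg sum_nonneg c(1)) simp
      fix G assume G: "G \<subseteq> carpet" "connected G" "G \<inter> A \<noteq> {}" "G \<inter> B \<noteq> {}"
      obtain x y where x: "x \<in> G" "x \<in> A" and y: "y \<in> G" "y \<in> B" using G by blast
      obtain v where v: "v \<in> hit n G" "x \<in> cube n v" using hit_nonempty[OF x(1) G(1)] by blast
      obtain w where w: "w \<in> hit n G" "y \<in> cube n w" using hit_nonempty[OF y(1) G(1)] by blast
      have each: "1 \<le> sum (c t) (hit n G)" if t: "t < J" for t
      proof -
        have pow: "1 / 3 ^ l0 \<le> 1 / (3::real) ^ (l0 - t)" by (intro divide_left_mono power_increasing) auto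
        have x0e: "x0 \<in> cube (l0 - t) (e t)" unfolding e_def using v0(2) n_split[OF t] cube_anc by metis
        have xv: "x \<in> cube (l0 - t) (anc (m t) v)" using v(2) n_split[OF t] cube_anc by metis
        have yw: "y \<in> cube (l0 - t) (anc (m t) w)" using w(2) n_split[OF t] cube_anc by metis
        have near: "near 1 (e t) (anc (m t) v)"
        proof (rule cube_touch[OF x0e xv])
          fix i
          have "\<bar>crd x0 i - crd x i\<bar> \<le> R"
            using crd_le_dist[of x0 i x] diameter_bounded_bound[OF bA x0 x(2)] by (simp add: R_def)
          then show "\<bar>crd x0 i - crd x i\<bar> < 1 / 3 ^ (l0 - t)" using R_l0 pow by linarith
        qed
        have far: "\<not> near (1 + 1) (e t) (anc (m t) w)"
        proof
          assume "near (1 + 1) (e t) (anc (m t) w)"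
          then have "setdist A B \<le> ?D * ((real (1 + 1) + 1) / 3 ^ (l0 - t))"
            by (rule setdist_far[OF x0 y(2) x0e yw])
          also have "\<dots> = ?D * 3 ^ (t + 1) / 3 ^ l0" using t l0 by (simp add: power_diff)
          also have "\<dots> \<le> ?D * 3 ^ J / 3 ^ l0"
            using t by (intro divide_right_mono mult_left_mono power_increasing) auto
          also have "\<dots> = T * (1 / 3 ^ L)" by (simp add: T_def l0(1) power_add)
          also have "\<dots> < T * R" using L(1) \<open>T \<ge> 9\<close> by (intro mult_strict_left_mono) auto
          finally show False using sep by (simp add: R_def)
        qed
        show ?thesis
          by (rule is_collarD(5)[OF col hit_subset conn_hit[OF G(2,1)] v(1) near w(1) far])
      qed
      have "real J = (\<Sum>t<J. 1)" by simp
      also have "\<dots> \<le> (\<Sum>t<J. sum (c t) (hit n G))" using each by (intro sum_mono) auto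
      also have "\<dots> = (\<Sum>v\<in>hit n G. \<Sum>t<J. c t v)" by (rule sum.swap)
      finally show "1 \<le> sum \<tau> (hit n G)"
        using J(1) unfolding \<tau>_def by (simp add: sum_divide_distrib[symmetric])
    qed
    moreover have "mass p n \<tau> \<le> \<epsilon>"
    proof -
      have one: "(\<Sum>t<J. c t v) powr p \<le> 1 powr p * (\<Sum>t<J. c t v powr p)" for v
      proof (rule powr_sum_le)
        have "card {t \<in> {..<J}. c t v \<noteq> 0} \<le> 1"
        proof (rule ccontr)
          assume "\<not> ?thesis"
          then obtain t t' where "t < J" "c t v \<noteq> 0" "t' < J" "c t' v \<noteq> 0" "t \<noteq> t'"
            by (auto simp: card_le_Suc0_iff_eq)
          then show False using nested[of t t' v] nested[of t' t v] by (metis nat_neq_iff)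
        qed
        then show "real (card {t \<in> {..<J}. c t v \<noteq> 0}) \<le> 1" by simp
      qed (use c p in auto)
      have "mass p n \<tau> = (\<Sum>v\<in>cells n. (\<Sum>t<J. c t v) powr p / real J powr p)"
        unfolding mass_def \<tau>_def using c(1) by (intro sum.cong) (auto simp: powr_divide sum_nonneg)
      also have "\<dots> \<le> (\<Sum>v\<in>cells n. (\<Sum>t<J. c t v powr p) / real J powr p)"
        using one by (intro sum_mono divide_right_mono) auto
      also have "\<dots> = (\<Sum>t<J. mass p n (c t)) / real J powr p"
        unfolding mass_def sum_divide_distrib[symmetric] by (subst sum.swap) simp
      also have "\<dots> \<le> (real J * K) / real J powr p"
        using sum_bounded_above[of "{..<J}" "\<lambda>t. mass p n (c t)" K] c(2) by (intro divide_right_mono) auto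
      also have "\<dots> = K * real J powr (1 - p)" using J(1) by (simp add: powr_diff)
      finally show ?thesis using J(2) by simp
    qed
    ultimately show ?thesis by blast
  qed
  then show ?thesis using \<open>T \<ge> 9\<close> by (intro exI[of _ T]) auto
qed

section \<open>Lower bounds\<close>

lemma path_through_cells:
  assumes P: "P \<subseteq> cells n" "conn P" and A: "P \<inter> hit n A \<noteq> {}" and B: "P \<inter> hit n B \<noteq> {}"
    and AB: "A \<subseteq> carpet" "B \<subseteq> carpet"
  shows "\<exists>\<gamma>\<in>joining_curves carpet A B. hit n (path_image \<gamma>) \<subseteq> {w \<in> cells n. \<exists>v\<in>P. near 1 v w}"
proof -
  obtain u x where u: "u \<in> P" "x \<in> A" "x \<in> cube n u" using A by (auto simp: hit_def)
  obtain w y where w: "w \<in> P" "y \<in> B" "y \<in> cube n w" using B by (auto simp: hit_def)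
  let ?U = "\<Union>v\<in>P. cset n v"
  have "x \<in> ?U" "y \<in> ?U" using u w AB by (auto simp: cset_def)
  then obtain \<gamma> where \<gamma>: "path \<gamma>" "path_image \<gamma> \<subseteq> ?U" "pathstart \<gamma> = x" "pathfinish \<gamma> = y"
    using path_connected_cells[OF P(2,1)] unfolding path_connected_def by blast
  have "\<gamma> \<in> joining_curves carpet A B"
    using \<gamma> u w by (auto simp: joining_curves_def cset_def)
  moreover have "hit n (path_image \<gamma>) \<subseteq> {w \<in> cells n. \<exists>v\<in>P. near 1 v w}"
  proof
    fix z assume "z \<in> hit n (path_image \<gamma>)"
    then obtain q where q: "z \<in> cells n" "q \<in> path_image \<gamma>" "q \<in> cube n z" by (auto simp: hit_def)
    then obtain v where "v \<in> P" "q \<in> cube n v" using \<gamma>(2) by (auto simp: cset_def)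
    then have "near 1 v z" using q(3) by (intro cube_touch[of q n v q z]) auto
    then show "z \<in> {w \<in> cells n. \<exists>v\<in>P. near 1 v w}" using q(1) \<open>v \<in> P\<close> by blast
  qed
  ultimately show ?thesis by blast
qed

lemma mass_near_sum_le:
  fixes \<tau> :: "('i \<Rightarrow> nat) \<Rightarrow> real"
  assumes \<tau>: "\<And>v. 0 \<le> \<tau> v" and p: "p > 0"
  shows "mass p n (\<lambda>v. \<Sum>w\<in>{w \<in> cells n. near 1 v w}. \<tau> w) \<le>
    real (3 ^ CARD('i)) powr p * real (3 ^ CARD('i)) * mass p n \<tau>"
proof -
  let ?N = "real (3 ^ CARD('i))"
  have three: "(2 * 1 + 1 :: nat) = 3" by simp
  have card: "real (card {w \<in> cells n. near 1 v w}) \<le> ?N" for v :: "'i \<Rightarrow> nat"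
  proof -
    have "card {w \<in> cells n. near 1 v w} \<le> card {w. near 1 v w}" by (intro card_mono card_near(1)) auto
    also have "\<dots> \<le> 3 ^ CARD('i)" using card_near(2)[of 1 v] unfolding three .
    finally show ?thesis by (simp only: of_nat_le_iff)
  qed
  have "mass p n (\<lambda>v. \<Sum>w\<in>{w \<in> cells n. near 1 v w}. \<tau> w) \<le>
      (\<Sum>v\<in>cells n. ?N powr p * (\<Sum>w\<in>{w \<in> cells n. near 1 v w}. \<tau> w powr p))"
    unfolding mass_def
  proof (intro sum_mono powr_sum_le)
    fix v :: "'i \<Rightarrow> nat"
    have "card {w \<in> {w \<in> cells n. near 1 v w}. \<tau> w \<noteq> 0} \<le> card {w \<in> cells n. near 1 v w}"
      by (intro card_mono) auto
    then show "real (card {w \<in> {w \<in> cells n. near 1 v w}. \<tau> w \<noteq> 0}) \<le> ?N" using card[of v] by linarith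
  qed (use \<tau> p in auto)
  also have "\<dots> = ?N powr p * (\<Sum>v\<in>cells n. \<Sum>w\<in>cells n. if near 1 v w then \<tau> w powr p else 0)"
    by (simp add: sum_distrib_left sum.inter_filter)
  also have "(\<Sum>v\<in>cells n. \<Sum>w\<in>cells n. if near 1 v w then \<tau> w powr p else 0)
      = (\<Sum>w\<in>cells n. \<Sum>v\<in>cells n. if near 1 v w then \<tau> w powr p else 0)" by (rule sum.swap)
  also have "\<dots> \<le> (\<Sum>w\<in>cells n. ?N * \<tau> w powr p)"
  proof (rule sum_mono)
    fix w :: "'i \<Rightarrow> nat"
    have "(\<Sum>v\<in>cells n. if near 1 v w then \<tau> w powr p else 0) = (\<Sum>v\<in>{v \<in> cells n. near 1 v w}. \<tau> w powr p)"
      by (rule sum.inter_filter[symmetric]) simp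
    also have "{v \<in> cells n. near 1 v w} = {v \<in> cells n. near 1 w v}" using near_sym by blast
    also have "(\<Sum>v\<in>{v \<in> cells n. near 1 w v}. \<tau> w powr p) = real (card {v \<in> cells n. near 1 w v}) * \<tau> w powr p"
      by (rule sum_constant)
    also have "\<dots> \<le> ?N * \<tau> w powr p" using card[of w] by (rule mult_right_mono) simp
    finally show "(\<Sum>v\<in>cells n. if near 1 v w then \<tau> w powr p else 0) \<le> ?N * \<tau> w powr p" .
  qed
  also have "\<dots> = ?N * mass p n \<tau>" by (simp add: mass_def sum_distrib_left)
  finally show ?thesis by (simp add: mult_left_mono mult.assoc)
qed

lemma hit_leaves_near:
  assumes A: "A \<subseteq> carpet" and n: "n = j + m" and big: "4 * real CARD('i) / 3 ^ j < diameter A"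
  shows "\<exists>y\<in>hit n A. \<not> near 1 f (anc m y)"
proof (rule ccontr)
  assume no: "\<not> ?thesis"
  have "diameter A \<le> 4 * real CARD('i) / 3 ^ j"
  proof (rule diameter_le)
    fix x y assume x: "x \<in> A" and y: "y \<in> A"
    obtain v where v: "v \<in> hit n A" "x \<in> cube n v" using hit_nonempty[OF x A] by blast
    obtain w where w: "w \<in> hit n A" "y \<in> cube n w" using hit_nonempty[OF y A] by blast
    have "near 1 f (anc m v)" "near 1 f (anc m w)" using no v w by blast+
    then have "near (1 + 1) (anc m v) (anc m w)" using near_sym near_trans by blast
    moreover have "x \<in> cube j (anc m v)" "y \<in> cube j (anc m w)" using v w n cube_anc by blast+
    ultimately have "dist x y \<le> real CARD('i) * ((real (1 + 1) + 1) / 3 ^ j)" by (intro cube_near_dist)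
    also have "\<dots> \<le> 4 * real CARD('i) / 3 ^ j" by (simp add: divide_right_mono)
    finally show "norm (x - y) \<le> 4 * real CARD('i) / 3 ^ j" by (simp add: dist_norm)
  qed simp
  then show False using big by simp
qed

lemma loewner_lower_bound:
  fixes a :: 'i
  assumes p: "p > 0" and c: "c > 0" "\<And>m. c \<le> cross_mod a p m" and T: "T \<ge> 0"
  shows "\<exists>c'>0. \<forall>A B n. A \<subseteq> carpet \<longrightarrow> B \<subseteq> carpet \<longrightarrow> connected A \<longrightarrow> connected B \<longrightarrow>
    27 * real CARD('i) / 3 ^ n < diameter A \<longrightarrow> 27 * real CARD('i) / 3 ^ n < diameter B \<longrightarrow>
    setdist A B \<le> T * min (diameter A) (diameter B) \<longrightarrow>
    c' \<le> comb_mod p (joining_curves carpet A B) (cover n)"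
proof -
  let ?d = "CARD('i)" and ?D = "real CARD('i)"
  obtain H where H: "H \<ge> 0" and short: "\<forall>m j e \<rho> E F. e \<in> cells j \<longrightarrow> (\<forall>v. 0 \<le> \<rho> v) \<longrightarrow>
    crosses_block (j + m) m e E \<longrightarrow> crosses_block (j + m) m e F \<longrightarrow>
    (\<exists>P \<subseteq> cells (j + m). conn P \<and> P \<inter> E \<noteq> {} \<and> P \<inter> F \<noteq> {} \<and>
       (\<forall>v\<in>P. near 2 e (anc m v)) \<and> sum \<rho> P \<le> H * near_mass p (j + m) m (\<rho> :: ('i \<Rightarrow> nat) \<Rightarrow> real) e powr (1 / p))"
    using short_connection[OF p c] by (elim exE conjE) (rule that)
  obtain s0 where "81 * ?D * (T + 1) < 3 ^ s0" using real_arch_pow[of 3] by auto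
  also have "(3::real) ^ s0 \<le> 3 ^ (s0 + 2)" by (intro power_increasing) auto
  finally obtain s where s: "2 \<le> s" "81 * ?D * (T + 1) < 3 ^ s" by (metis le_add2)
  define N :: nat where "N = 3 ^ ?d * (3 ^ s) ^ ?d"
  define K where "K = (real (N * ?d) powr p * real ?d / c) powr (1 / p)"
  define \<Lambda> where "\<Lambda> = K + 2 * H + 1"
  have K0: "K \<ge> 0" by (simp add: K_def)
  have \<Lambda>: "\<Lambda> > 0" using K0 H by (simp add: \<Lambda>_def)
  define N3 where "N3 = real (3 ^ ?d) powr p * real (3 ^ ?d)"
  have N3: "N3 > 0" by (simp add: N3_def)
  define c' where "c' = 1 / (\<Lambda> powr p * N3)"
  have c': "c' > 0" using \<Lambda> N3 by (simp add: c'_def)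
  have "c' \<le> comb_mod p (joining_curves carpet A B) (cover n)"
    if A: "A \<subseteq> carpet" and B: "B \<subseteq> carpet" and cA: "connected A" and cB: "connected B"
      and dA: "27 * ?D / 3 ^ n < diameter A" and dB: "27 * ?D / 3 ^ n < diameter B"
      and close: "setdist A B \<le> T * min (diameter A) (diameter B)" for A B n
  proof (rule comb_mod_ge)
    have pos_n: "0 < 27 * ?D / 3 ^ n" using d_ge by simp
    have "0 < diameter A" "0 < diameter B" using less_trans[OF pos_n dA] less_trans[OF pos_n dB] .
    then have neA: "A \<noteq> {}" and neB: "B \<noteq> {}" by auto
    have hitA: "hit n A \<noteq> {}" and hitB: "hit n B \<noteq> {}"
      using hit_nonempty A B neA neB by blast+
    show "joining_curves carpet A B \<noteq> {}"
      using path_through_cells[OF order_refl conn_cells _ _ A B, of n] hitA hitB hit_subset by blast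
    show "path_image \<gamma> \<subseteq> carpet" if "\<gamma> \<in> joining_curves carpet A B" for \<gamma>
      using that by (simp add: joining_curves_def)
    fix \<tau> :: "('i \<Rightarrow> nat) \<Rightarrow> real"
    assume \<tau>: "\<And>v. 0 \<le> \<tau> v" and adm: "\<And>\<gamma>. \<gamma> \<in> joining_curves carpet A B \<Longrightarrow> 1 \<le> sum \<tau> (hit n (path_image \<gamma>))"
    define R where "R = min (diameter A) (diameter B)"
    have R: "27 * ?D / 3 ^ n < R" using dA dB by (simp add: R_def)
    then have R0: "0 < R" using pos_n by linarith
    have "diameter A \<le> ?D"
      using A carpet_dist by (intro diameter_le) (auto simp: dist_norm neA)
    then have RD: "R \<le> ?D" by (simp add: R_def)
    have "R \<le> 27 * ?D" using RD d_ge by linarith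
    then obtain j where j: "27 * ?D / 3 ^ j < R" "R \<le> 3 * (27 * ?D / 3 ^ j)" "\<And>i. i < j \<Longrightarrow> R \<le> 27 * ?D / 3 ^ i"
      using least_power[OF R0] by metis
    have jn: "j \<le> n" using j(3)[of n] R by (meson not_less)
    have j2: "2 \<le> j"
    proof (rule ccontr)
      assume "\<not> 2 \<le> j"
      then have "(3::real) ^ j \<le> 3 ^ 2" by (intro power_increasing) auto
      then have "27 * ?D / 9 \<le> 27 * ?D / 3 ^ j" by (intro divide_left_mono) auto
      then show False using j(1) RD d_ge by linarith
    qed
    define m where "m = n - j"
    have n: "n = j + m" using jn by (simp add: m_def)
    define s' where "s' = min s j"
    define i where "i = j - s'"
    have s': "2 \<le> s'" "s' \<le> s" and ji: "j = i + s'" using s(1) j2 by (auto simp: s'_def i_def)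
    have "setdist A B < (T + 1) * R" using close R0 by (simp add: R_def[symmetric] distrib_right)
    then obtain x y where x: "x \<in> A" and y: "y \<in> B" and xy: "dist x y < (T + 1) * R"
      using setdist_ltE neA neB by metis
    obtain vx where vx: "vx \<in> hit n A" "x \<in> cube n vx" using hit_nonempty[OF x A] by blast
    obtain vy where vy: "vy \<in> hit n B" "y \<in> cube n vy" using hit_nonempty[OF y B] by blast
    define fx where "fx = anc m vx"
    define fy where "fy = anc m vy"
    have f: "fx \<in> cells j" "fy \<in> cells j"
      unfolding fx_def fy_def using vx(1) vy(1) hit_subset n anc_cells by blast+
    have xf: "x \<in> cube j fx" "y \<in> cube j fy"
      unfolding fx_def fy_def using vx(2) vy(2) n cube_anc by blast+
    define e where "e = anc s' fx"
    have e: "e \<in> cells i" "anc s' fy \<in> cells i" unfolding e_def using f ji anc_cells by blast+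
    have near_e: "near 1 e (anc s' fy)"
    proof (cases "s \<le> j")
      case True
      have "x \<in> cube i e" "y \<in> cube i (anc s' fy)" unfolding e_def using xf ji cube_anc by blast+
      then show ?thesis
      proof (rule cube_touch)
        fix k
        have "\<bar>crd x k - crd y k\<bar> \<le> dist x y" by (rule crd_le_dist)
        also have "\<dots> < (T + 1) * R" by (rule xy)
        also have "\<dots> \<le> (T + 1) * (3 * (27 * ?D / 3 ^ j))" using T j(2) by (intro mult_left_mono) auto
        also have "\<dots> = (81 * ?D * (T + 1)) / 3 ^ j" by simp
        also have "\<dots> < 3 ^ s / 3 ^ j" using s(2) by (intro divide_strict_right_mono) auto
        also have "\<dots> = 1 / 3 ^ i"
        proof -
          have "s' = s" using True by (simp add: s'_def)
          then have "(3::real) ^ j = 3 ^ i * 3 ^ s" unfolding ji by (simp only: power_add)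
          then show ?thesis by simp
        qed
        finally show "\<bar>crd x k - crd y k\<bar> < 1 / 3 ^ i" .
      qed
    next
      case False
      then have "i = 0" by (simp add: i_def s'_def)
      then show ?thesis using e by (simp add: cells_0)
    qed
    define W where "W = {w \<in> cells i. near 1 e w}"
    define EE where "EE = {f \<in> cells (i + s'). anc s' f \<in> W}"
    have "conn W" "W \<subseteq> cells i" unfolding W_def by (auto simp del: One_nat_def intro: conn_near e)
    then have EE: "EE \<subseteq> cells j" "conn EE" unfolding EE_def ji by (auto intro: conn_subcells)
    have "card W \<le> card {w. near 1 e w}" unfolding W_def using card_near(1) by (intro card_mono) auto
    also have "\<dots> \<le> 3 ^ ?d" using card_near(2)[of 1 e] by (simp add: numeral_3_eq_3)
    finally have "card W \<le> 3 ^ ?d" .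
    moreover have "finite W" by (simp add: W_def)
    then have "card EE \<le> card W * (3 ^ s') ^ ?d" unfolding EE_def by (rule card_anc_le)
    moreover have "(3 ^ s') ^ ?d \<le> ((3 ^ s) ^ ?d :: nat)" using s'(2) by (intro power_mono power_increasing) auto
    ultimately have "card EE \<le> N" unfolding N_def by (meson mult_le_mono order.trans)
    then have "card EE * ?d \<le> N * ?d" by simp
    then have cEE: "real (card EE * ?d) \<le> real (N * ?d)" by (simp only: of_nat_le_iff)
    have fEE: "fx \<in> EE" "fy \<in> EE"
      using f e near_e by (auto simp: EE_def W_def ji[symmetric] e_def)
    define \<rho> where "\<rho> v = (\<Sum>w\<in>{w \<in> cells n. near 1 v w}. \<tau> w)" for v
    have \<rho>: "0 \<le> \<rho> v" for v unfolding \<rho>_def using \<tau> by (intro sum_nonneg) auto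
    define M where "M = mass p n \<rho>"
    have M0: "M \<ge> 0" unfolding M_def by (rule mass_nonneg)
    have part: "(\<Sum>v\<in>{v \<in> cells n. Q v}. \<rho> v powr p) powr (1 / p) \<le> M powr (1 / p)" for Q
      unfolding M_def mass_def using p by (intro powr_mono2 sum_mono2) (auto intro: sum_nonneg)
    obtain Q where Q: "Q \<subseteq> cells n" "conn Q" "\<forall>f\<in>EE. \<exists>v\<in>Q. anc m v = f"
      and Qsum: "sum \<rho> Q \<le> (real (card EE * ?d) powr p * real ?d / c) powr (1 / p) *
        (\<Sum>v\<in>{v \<in> cells n. anc m v \<in> EE}. \<rho> v powr p) powr (1 / p)"
      using connected_chain[OF EE, of \<rho> p c a m, OF \<rho> p c] n by auto
    have "(real (card EE * ?d) powr p * real ?d / c) powr (1 / p) \<le> K"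
      unfolding K_def using cEE p c(1)
      by (intro powr_mono2 divide_right_mono mult_right_mono) auto
    then have Qs: "sum \<rho> Q \<le> K * M powr (1 / p)"
      using Qsum part K0 by (meson mult_mono order.trans powr_ge_zero)
    have branch: "\<exists>P \<subseteq> cells n. conn P \<and> P \<inter> hit n X \<noteq> {} \<and> P \<inter> Q \<noteq> {} \<and> sum \<rho> P \<le> H * M powr (1 / p)"
      if X: "X \<subseteq> carpet" "connected X" "R \<le> diameter X" and v: "v \<in> hit n X" and g: "anc m v \<in> EE" for X v
    proof -
      have "4 * ?D / 3 ^ j \<le> 27 * ?D / 3 ^ j" by (simp add: divide_right_mono)
      then have "4 * ?D / 3 ^ j < diameter X" using j(1) X(3) by linarith
      then have 1: "\<exists>y\<in>hit n X. \<not> near 1 (anc m v) (anc m y)" using X(1) n by (intro hit_leaves_near)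
      have 2: "\<exists>y\<in>Q. \<not> near 1 (anc m v) (anc m y)"
      proof (rule leaves_near[OF e(1) s'(1)])
        fix g assume "g \<in> cells (i + s')" "anc s' g = e"
        then have "g \<in> EE" using e by (simp add: EE_def W_def)
        then show "\<exists>v\<in>Q. anc m v = g" using Q(3) by blast
      qed
      have 3: "anc m v \<in> cells j" using g EE by blast
      have 4: "crosses_block (j + m) m (anc m v) (hit n X)"
        unfolding crosses_block_def using 1 conn_hit[OF X(2,1)] v hit_subset[of n X] n by blast
      have 5: "crosses_block (j + m) m (anc m v) Q"
        unfolding crosses_block_def using 2 Q g n by blast
      obtain P where P: "P \<subseteq> cells n" "conn P" "P \<inter> hit n X \<noteq> {}" "P \<inter> Q \<noteq> {}"
        and Ps: "sum \<rho> P \<le> H * near_mass p n m \<rho> (anc m v) powr (1 / p)"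
      proof -
        have "\<forall>v. 0 \<le> \<rho> v" using \<rho> by blast
        then have "\<exists>P \<subseteq> cells (j + m). conn P \<and> P \<inter> hit n X \<noteq> {} \<and> P \<inter> Q \<noteq> {} \<and>
            (\<forall>u\<in>P. near 2 (anc m v) (anc m u)) \<and> sum \<rho> P \<le> H * near_mass p (j + m) m \<rho> (anc m v) powr (1 / p)"
          by (rule short[THEN spec, THEN spec, THEN spec, THEN spec, THEN spec, THEN spec,
                THEN mp, THEN mp, THEN mp, THEN mp, OF 3 _ 4 5])
        then show ?thesis unfolding n[symmetric] by (elim exE conjE) (rule that)
      qed
      have "near_mass p n m \<rho> (anc m v) powr (1 / p) \<le> M powr (1 / p)"
        unfolding near_mass_def by (rule part)
      then have "H * near_mass p n m \<rho> (anc m v) powr (1 / p) \<le> H * M powr (1 / p)" using H by (rule mult_left_mono)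
      then show ?thesis using P Ps by (meson order.trans)
    qed
    obtain P1 where P1: "P1 \<subseteq> cells n" "conn P1" "P1 \<inter> hit n A \<noteq> {}" "P1 \<inter> Q \<noteq> {}" "sum \<rho> P1 \<le> H * M powr (1 / p)"
      using branch[OF A cA _ vx(1)] fEE(1) by (auto simp: R_def fx_def)
    obtain P2 where P2: "P2 \<subseteq> cells n" "conn P2" "P2 \<inter> hit n B \<noteq> {}" "P2 \<inter> Q \<noteq> {}" "sum \<rho> P2 \<le> H * M powr (1 / p)"
      using branch[OF B cB _ vy(1)] fEE(2) by (auto simp: R_def fy_def)
    define P where "P = (P1 \<union> Q) \<union> P2"
    have fin: "finite P1" "finite P2" "finite Q" using P1(1) P2(1) Q(1) finite_subset by blast+
    have "conn (P1 \<union> Q)" by (rule conn_Un_meet[OF P1(2) Q(2) P1(4)])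
    then have Pc: "conn P" unfolding P_def by (rule conn_Un_meet[OF _ P2(2)]) (use P2(4) in blast)
    have Pn: "P \<subseteq> cells n" using P1(1) P2(1) Q(1) by (auto simp: P_def)
    have "sum \<rho> P \<le> sum \<rho> P1 + sum \<rho> Q + sum \<rho> P2"
    proof -
      have "sum \<rho> (A \<union> B) \<le> sum \<rho> A + sum \<rho> B" if "finite A" "finite B" for A B
        using sum.union_inter[OF that, of \<rho>] sum_nonneg[of "A \<inter> B" \<rho>] \<rho> by simp
      then show ?thesis unfolding P_def using fin by (smt (verit) finite_UnI)
    qed
    also have "\<dots> \<le> (K + 2 * H) * M powr (1 / p)" using P1(5) P2(5) Qs by (simp add: distrib_right)
    also have "\<dots> \<le> \<Lambda> * M powr (1 / p)" by (intro mult_right_mono) (auto simp: \<Lambda>_def)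
    finally have Psum: "sum \<rho> P \<le> \<Lambda> * M powr (1 / p)" .
    have "P \<inter> hit n A \<noteq> {}" "P \<inter> hit n B \<noteq> {}" using P1(3) P2(3) by (auto simp: P_def)
    then obtain \<gamma> where \<gamma>: "\<gamma> \<in> joining_curves carpet A B" "hit n (path_image \<gamma>) \<subseteq> {w \<in> cells n. \<exists>v\<in>P. near 1 v w}"
      using path_through_cells[OF Pn Pc _ _ A B] by blast
    have "1 \<le> sum \<tau> (hit n (path_image \<gamma>))" by (rule adm[OF \<gamma>(1)])
    also have "\<dots> \<le> sum \<tau> {w \<in> cells n. \<exists>v\<in>P. near 1 v w}"
      using \<gamma>(2) \<tau> by (intro sum_mono2) auto
    also have "\<dots> \<le> (\<Sum>w\<in>{w \<in> cells n. \<exists>v\<in>P. near 1 v w}. \<Sum>v\<in>P. if near 1 v w then \<tau> w else 0)"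
    proof (rule sum_mono)
      fix w assume "w \<in> {w \<in> cells n. \<exists>v\<in>P. near 1 v w}"
      then obtain v where v: "v \<in> P" "near 1 v w" by blast
      have "(if near 1 v w then \<tau> w else 0) \<le> (\<Sum>v\<in>P. if near 1 v w then \<tau> w else 0)"
        using v(1) \<tau> finite_subset[OF Pn finite_cells] by (intro member_le_sum) auto
      then show "\<tau> w \<le> (\<Sum>v\<in>P. if near 1 v w then \<tau> w else 0)" using v(2) by simp
    qed
    also have "\<dots> \<le> (\<Sum>w\<in>cells n. \<Sum>v\<in>P. if near 1 v w then \<tau> w else 0)"
      using \<tau> by (intro sum_mono2) (auto intro!: sum_nonneg)
    also have "\<dots> = (\<Sum>v\<in>P. \<Sum>w\<in>cells n. if near 1 v w then \<tau> w else 0)" by (rule sum.swap)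
    also have "\<dots> = sum \<rho> P" unfolding \<rho>_def by (simp add: sum.inter_filter)
    finally have "1 \<le> \<Lambda> * M powr (1 / p)" using Psum by linarith
    then have "1 powr p \<le> (\<Lambda> * M powr (1 / p)) powr p" using p by (intro powr_mono2) auto
    also have "\<dots> = \<Lambda> powr p * M" using p M0 by (simp add: powr_mult powr_powr)
    also have "\<dots> \<le> \<Lambda> powr p * (N3 * mass p n \<tau>)"
      unfolding M_def \<rho>_def N3_def using mass_near_sum_le[of \<tau> p n] \<tau> p by (intro mult_left_mono) auto
    finally have "1 \<le> mass p n \<tau> * (\<Lambda> powr p * N3)" by (simp add: mult_ac)
    then show "c' \<le> mass p n \<tau>"
      unfolding c'_def using \<Lambda> N3 by (simp add: pos_divide_le_eq)
  qed
  then show ?thesis using c' by blast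
qed

end

section \<open>The Loewner property\<close>

lemma loewner_functions:
  fixes f t :: "'b \<Rightarrow> real"
  assumes lower: "\<And>s. s > 0 \<Longrightarrow> \<exists>c>0. \<forall>i\<in>I. s \<le> t i \<longrightarrow> c \<le> f i"
    and upper: "\<And>s. s > 0 \<Longrightarrow> \<exists>C. \<forall>i\<in>I. t i \<le> s \<longrightarrow> f i \<le> C"
    and small: "\<And>\<epsilon>. \<epsilon> > 0 \<Longrightarrow> \<exists>s>0. \<forall>i\<in>I. t i \<le> s \<longrightarrow> f i \<le> \<epsilon>"
    and pos: "\<And>i. i \<in> I \<Longrightarrow> t i > 0"
  shows "\<exists>\<phi> \<psi> :: real \<Rightarrow> real.
    (\<forall>t>0. \<phi> t > 0) \<and> mono_on {0<..} \<phi> \<and> (\<forall>t>0. \<psi> t > 0) \<and> mono_on {0<..} \<psi> \<and> (\<psi> \<longlongrightarrow> 0) (at_right 0) \<and>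
    (\<forall>i\<in>I. \<phi> (t i) \<le> f i \<and> f i \<le> \<psi> (t i))"
proof -
  define L where "L s = insert 1 (f ` {i \<in> I. s \<le> t i})" for s
  define U where "U s = insert 0 (f ` {i \<in> I. t i \<le> s})" for s
  have L: "\<exists>c>0. \<forall>y\<in>L s. c \<le> y" if s: "s > 0" for s
  proof -
    obtain c where "c > 0" "\<forall>i\<in>I. s \<le> t i \<longrightarrow> c \<le> f i" using lower[OF s] by blast
    then show ?thesis by (intro exI[of _ "min c 1"]) (auto simp: L_def min_le_iff_disj)
  qed
  then have bL: "bdd_below (L s)" if "s > 0" for s using that by (meson bdd_belowI)
  have bU: "bdd_above (U s)" if s: "s > 0" for s
  proof -
    obtain C where "\<forall>i\<in>I. t i \<le> s \<longrightarrow> f i \<le> C" using upper[OF s] by blast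
    then show ?thesis by (intro bdd_aboveI[of _ "max C 0"]) (auto simp: U_def le_max_iff_disj)
  qed
  have U0: "0 \<le> Sup (U s)" if "s > 0" for s
    using bU[OF that] by (intro cSup_upper) (auto simp: U_def)
  define \<phi> where "\<phi> s = Inf (L s)" for s
  define \<psi> where "\<psi> s = s + Sup (U s)" for s
  have "\<phi> s > 0" if s: "s > 0" for s
  proof -
    obtain c where "c > 0" "\<forall>y\<in>L s. c \<le> y" using L[OF s] by blast
    moreover from this have "c \<le> \<phi> s" unfolding \<phi>_def by (intro cInf_greatest) (auto simp: L_def)
    ultimately show ?thesis by linarith
  qed
  moreover have "mono_on {0<..} \<phi>"
    unfolding \<phi>_def by (intro mono_onI cInf_superset_mono bL) (auto simp: L_def)
  moreover have "\<psi> s > 0" if "s > 0" for s using U0[OF that] that by (simp add: \<psi>_def)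
  moreover have "mono_on {0<..} \<psi>"
    unfolding \<psi>_def by (intro mono_onI add_mono cSup_subset_mono bU) (auto simp: U_def)
  moreover have "(\<psi> \<longlongrightarrow> 0) (at_right 0)"
  proof (rule tendstoI)
    fix \<epsilon> :: real assume e: "\<epsilon> > 0"
    obtain s where s: "s > 0" "\<forall>i\<in>I. t i \<le> s \<longrightarrow> f i \<le> \<epsilon> / 2" using small[of "\<epsilon> / 2"] e by auto
    have "eventually (\<lambda>x. x \<in> {0<..<min s (\<epsilon> / 2)}) (at_right (0::real))"
      using s(1) e by (intro eventually_at_right_real) auto
    then show "eventually (\<lambda>x. dist (\<psi> x) 0 < \<epsilon>) (at_right 0)"
    proof eventually_elim
      case (elim x)
      then have "Sup (U x) \<le> \<epsilon> / 2" using s e by (intro cSup_least) (auto simp: U_def)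
      then show ?case using elim U0[of x] by (auto simp: \<psi>_def dist_real_def)
    qed
  qed
  moreover have "\<phi> (t i) \<le> f i \<and> f i \<le> \<psi> (t i)" if i: "i \<in> I" for i
  proof
    show "\<phi> (t i) \<le> f i"
      unfolding \<phi>_def using bL[OF pos[OF i]] i by (intro cInf_lower) (auto simp: L_def)
    have "f i \<le> Sup (U (t i))" using bU[OF pos[OF i]] i by (intro cSup_upper) (auto simp: U_def)
    then show "f i \<le> \<psi> (t i)" using pos[OF i] by (simp add: \<psi>_def)
  qed
  ultimately show ?thesis by blast
qed

context carpet_coordinates
begin

theorem CLP_carpet:
  fixes a b :: 'i
  assumes "a \<noteq> b"
  shows "CLP carpet"
proof -
  let ?D = "real CARD('i)"
  obtain p c C where p: "p > 1" and c: "c > 0" "\<And>n. c \<le> cross_mod a p n" and C: "\<And>n. cross_mod a p n \<le> C"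
    using critical_exponent[OF assms] by blast
  have p0: "p > 0" using p by simp
  have C0: "C \<ge> 0" using c(1) c(2)[of 0] C[of 0] by linarith
  define I where "I = {(A, B, k). A \<subseteq> carpet \<and> B \<subseteq> carpet \<and> nondegenerate_continuum A \<and>
    nondegenerate_continuum B \<and> A \<inter> B = {} \<and> (1/2)^k \<le> min (diameter A) (diameter B)}"
  define f where "f = (\<lambda>(A, B, k). comb_mod p (joining_curves carpet A B) (cover (level k)))"
  define t where "t = (\<lambda>(A, B, k :: nat). inverse (rel_dist A (B :: 'a set)))"
  have I: "connected A" "connected B" "bounded A" "bounded B" "A \<noteq> {}" "B \<noteq> {}" "A \<subseteq> carpet" "B \<subseteq> carpet"
    "27 * ?D / 3 ^ level k < diameter A" "27 * ?D / 3 ^ level k < diameter B" "0 < min (diameter A) (diameter B)"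
    "0 < setdist A B" "1 / 3 ^ level k \<le> diameter A" "1 / 3 ^ level k \<le> diameter B"
    if "(A, B, k) \<in> I" for A B k
  proof -
    have *: "compact A" "compact B" "connected A" "connected B" "A \<noteq> {}" "B \<noteq> {}" "A \<inter> B = {}"
      "A \<subseteq> carpet" "B \<subseteq> carpet" "(1/2)^k \<le> min (diameter A) (diameter B)"
      using that by (auto simp: I_def nondegenerate_continuum_def)
    then show "connected A" "connected B" "bounded A" "bounded B" "A \<noteq> {}" "B \<noteq> {}" "A \<subseteq> carpet" "B \<subseteq> carpet"
      by (auto simp: compact_imp_bounded)
    have lev: "27 * ?D / 3 ^ level k < (1 / 2) ^ k" by (rule level_bounds)
    show dA: "27 * ?D / 3 ^ level k < diameter A" and dB: "27 * ?D / 3 ^ level k < diameter B"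
      using lev *(10) by auto
    have "(0::real) < (1 / 2) ^ k" by simp
    then show "0 < min (diameter A) (diameter B)" using *(10) by linarith
    show "0 < setdist A B"
      using * compact_imp_closed by (subst setdist_gt_0_compact_closed) auto
    have "1 \<le> 27 * ?D" using d_ge by linarith
    then have "1 / 3 ^ level k \<le> 27 * ?D / 3 ^ level k" by (intro divide_right_mono) auto
    then show "1 / 3 ^ level k \<le> diameter A" "1 / 3 ^ level k \<le> diameter B" using dA dB by linarith+
  qed
  have rel: "rel_dist A B > 0" "setdist A B = rel_dist A B * min (diameter A) (diameter B)" if "(A, B, k) \<in> I" for A B k
    using I(11,12)[OF that] by (auto simp: rel_dist_def)
  have "\<exists>\<phi> \<psi> :: real \<Rightarrow> real.
    (\<forall>t>0. \<phi> t > 0) \<and> mono_on {0<..} \<phi> \<and> (\<forall>t>0. \<psi> t > 0) \<and> mono_on {0<..} \<psi> \<and> (\<psi> \<longlongrightarrow> 0) (at_right 0) \<and>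
    (\<forall>i\<in>I. \<phi> (t i) \<le> f i \<and> f i \<le> \<psi> (t i))"
  proof (rule loewner_functions)
    fix i assume "i \<in> I"
    then show "t i > 0" using rel(1) by (cases i) (auto simp: t_def)
  next
    fix s :: real assume s: "s > 0"
    obtain c' where c': "c' > 0" "\<And>A B n. A \<subseteq> carpet \<Longrightarrow> B \<subseteq> carpet \<Longrightarrow> connected A \<Longrightarrow> connected B \<Longrightarrow>
      27 * ?D / 3 ^ n < diameter A \<Longrightarrow> 27 * ?D / 3 ^ n < diameter B \<Longrightarrow>
      setdist A B \<le> inverse s * min (diameter A) (diameter B) \<Longrightarrow>
      c' \<le> comb_mod p (joining_curves carpet A B) (cover n)"
      using loewner_lower_bound[OF p0 c, of "inverse s"] s by auto
    have "c' \<le> f i" if "i \<in> I" "s \<le> t i" for i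
    proof -
      obtain A B k where i: "i = (A, B, k)" by (cases i)
      have iI: "(A, B, k) \<in> I" using that(1) i by simp
      have "s \<le> inverse (rel_dist A B)" using that(2) by (simp add: i t_def)
      then have "rel_dist A B \<le> inverse s"
        using s rel(1)[OF iI] by (metis inverse_inverse_eq le_imp_inverse_le)
      then have "setdist A B \<le> inverse s * min (diameter A) (diameter B)"
        unfolding rel(2)[OF iI] using I(11)[OF iI] by (intro mult_right_mono) auto
      then show ?thesis using c'(2) I[OF iI] by (simp add: i f_def)
    qed
    then show "\<exists>c>0. \<forall>i\<in>I. s \<le> t i \<longrightarrow> c \<le> f i" using c'(1) by blast
  next
    fix s :: real assume s: "s > 0"
    obtain M where M: "\<And>A B n. A \<subseteq> carpet \<Longrightarrow> B \<subseteq> carpet \<Longrightarrow> bounded A \<Longrightarrow> 0 < diameter A \<Longrightarrow>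
      inverse s * diameter A \<le> setdist A B \<Longrightarrow> \<exists>\<tau>. separating n \<tau> A B \<and> mass p n \<tau> \<le> M"
      using crude_separation[OF p0 C C0 positive_imp_inverse_positive[OF s]] by blast
    have "f i \<le> M" if "i \<in> I" "t i \<le> s" for i
    proof -
      obtain A B k where i: "i = (A, B, k)" by (cases i)
      have iI: "(A, B, k) \<in> I" using that(1) i by simp
      have "inverse (rel_dist A B) \<le> s" using that(2) by (simp add: i t_def)
      then have "inverse s \<le> rel_dist A B"
        using rel(1)[OF iI] by (metis inverse_inverse_eq le_imp_inverse_le positive_imp_inverse_positive)
      then have sep: "inverse s * min (diameter A) (diameter B) \<le> setdist A B"
        unfolding rel(2)[OF iI] using I(11)[OF iI] by (intro mult_right_mono) auto
      show ?thesis
      proof (cases "diameter A \<le> diameter B")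
        case True
        then obtain \<tau> where "separating (level k) \<tau> A B" "mass p (level k) \<tau> \<le> M"
          using M[of A B "level k"] I[OF iI] sep by (auto simp: min_def)
        then show ?thesis using separating_comb_mod_le(1)[of "level k" \<tau> A B p] by (simp add: i f_def)
      next
        case False
        then obtain \<tau> where "separating (level k) \<tau> B A" "mass p (level k) \<tau> \<le> M"
          using M[of B A "level k"] I[OF iI] sep by (auto simp: min_def setdist_sym)
        then show ?thesis using separating_comb_mod_le(2)[of "level k" \<tau> B A p] by (simp add: i f_def)
      qed
    qed
    then show "\<exists>C. \<forall>i\<in>I. t i \<le> s \<longrightarrow> f i \<le> C" by blast
  next
    fix \<epsilon> :: real assume e: "\<epsilon> > 0"
    obtain T where T: "T > 0" "\<And>A B n. A \<subseteq> carpet \<Longrightarrow> B \<subseteq> carpet \<Longrightarrow> bounded A \<Longrightarrow> B \<noteq> {} \<Longrightarrow>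
      1 / 3 ^ n \<le> diameter A \<Longrightarrow> T * diameter A \<le> setdist A B \<Longrightarrow> \<exists>\<tau>. separating n \<tau> A B \<and> mass p n \<tau> \<le> \<epsilon>"
      using fine_separation[OF p C C0 e] by blast
    have "f i \<le> \<epsilon>" if "i \<in> I" "t i \<le> inverse T" for i
    proof -
      obtain A B k where i: "i = (A, B, k)" by (cases i)
      have iI: "(A, B, k) \<in> I" using that(1) i by simp
      have "inverse (rel_dist A B) \<le> inverse T" using that(2) by (simp add: i t_def)
      then have "T \<le> rel_dist A B" using rel(1)[OF iI] by (rule inverse_le_imp_le)
      then have sep: "T * min (diameter A) (diameter B) \<le> setdist A B"
        unfolding rel(2)[OF iI] using I(11)[OF iI] by (intro mult_right_mono) auto
      show ?thesis
      proof (cases "diameter A \<le> diameter B")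
        case True
        then obtain \<tau> where "separating (level k) \<tau> A B" "mass p (level k) \<tau> \<le> \<epsilon>"
          using T(2)[of A B "level k"] I[OF iI] sep by (auto simp: min_def)
        then show ?thesis using separating_comb_mod_le(1)[of "level k" \<tau> A B p] by (simp add: i f_def)
      next
        case False
        then obtain \<tau> where "separating (level k) \<tau> B A" "mass p (level k) \<tau> \<le> \<epsilon>"
          using T(2)[of B A "level k"] I[OF iI] sep by (auto simp: min_def setdist_sym)
        then show ?thesis using separating_comb_mod_le(2)[of "level k" \<tau> B A p] by (simp add: i f_def)
      qed
    qed
    then show "\<exists>s>0. \<forall>i\<in>I. t i \<le> s \<longrightarrow> f i \<le> \<epsilon>" using T(1) by (intro exI[of _ "inverse T"]) auto
  qed
  then obtain \<phi> \<psi> :: "real \<Rightarrow> real" where shape: "\<forall>t>0. \<phi> t > 0" "mono_on {0<..} \<phi>" "\<forall>t>0. \<psi> t > 0"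
    "mono_on {0<..} \<psi>" "(\<psi> \<longlongrightarrow> 0) (at_right 0)" and bnd: "\<And>i. i \<in> I \<Longrightarrow> \<phi> (t i) \<le> f i \<and> f i \<le> \<psi> (t i)"
    by blast
  have "comb_p_loewner_wrt p carpet (\<lambda>k. cover (level k))"
    unfolding comb_p_loewner_wrt_def
  proof (rule exI[of _ \<phi>], rule exI[of _ \<psi>], intro conjI shape allI impI)
    fix A B k
    assume "A \<subseteq> carpet \<and> B \<subseteq> carpet \<and> nondegenerate_continuum A \<and> nondegenerate_continuum B \<and>
      A \<inter> B = {} \<and> (1/2)^k \<le> min (diameter A) (diameter B)"
    then have "(A, B, k) \<in> I" by (simp add: I_def)
    from bnd[OF this] show "\<phi> (inverse (rel_dist A B)) \<le> comb_mod p (joining_curves carpet A B) (cover (level k))"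
      "comb_mod p (joining_curves carpet A B) (cover (level k)) \<le> \<psi> (inverse (rel_dist A B))"
      by (simp_all add: t_def f_def)
  qed
  then show ?thesis
    unfolding CLP_def using compact_carpet arcwise_connected_carpet doubling_any is_approx_cover p by blast
qed

end

section \<open>The square carpet and the Menger sponge\<close>

definition square_meets :: "nat \<Rightarrow> real \<Rightarrow> real \<Rightarrow> bool" where
  "square_meets n x y \<longleftrightarrow> (\<exists>a b. a < 3 ^ n \<and> b < 3 ^ n \<and> ones a \<inter> ones b = {} \<and>
     real a \<le> x * 3 ^ n \<and> x * 3 ^ n \<le> real a + 1 \<and> real b \<le> y * 3 ^ n \<and> y * 3 ^ n \<le> real b + 1)"

lemma square_meets_sym: "square_meets n x y \<Longrightarrow> square_meets n y x"
  unfolding square_meets_def by (metis inf_commute)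

lemma carpet_level_eq:
  "carpet_level n = {(real a / 3 ^ n, real b / 3 ^ n, 1 / 3 ^ n) | a b. a < 3 ^ n \<and> b < 3 ^ n \<and> ones a \<inter> ones b = {}}"
proof (induction n)
  case 0
  then show ?case by auto
next
  case (Suc n)
  have digit: "ones (3 * a + i) \<inter> ones (3 * b + j) = {} \<longleftrightarrow> ones a \<inter> ones b = {} \<and> (i, j) \<noteq> (1, 1)"
    if "i < 3" "j < 3" for a b i j :: nat
    using ones_digit[of i a] ones_digit[of j b] that by (auto simp: mult.commute)
  show ?case (is "?L = ?R")
  proof
    show "?L \<subseteq> ?R"
    proof
      fix z assume "z \<in> ?L"
      then obtain x y s i j where z: "z = (x + real i * s / 3, y + real j * s / 3, s / 3)"
        "(x, y, s) \<in> carpet_level n" and ij: "i < 3" "j < 3" "(i, j) \<noteq> (1, 1)"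
        unfolding carpet_level.simps by blast
      then obtain a b where ab: "x = real a / 3 ^ n" "y = real b / 3 ^ n" "s = 1 / 3 ^ n"
        "a < 3 ^ n" "b < 3 ^ n" "ones a \<inter> ones b = {}" unfolding Suc.IH by blast
      have "z = (real (3 * a + i) / 3 ^ Suc n, real (3 * b + j) / 3 ^ Suc n, 1 / 3 ^ Suc n)"
        unfolding z(1) ab(1-3) by (simp add: field_simps)
      moreover have "3 * a + i < 3 ^ Suc n" "3 * b + j < 3 ^ Suc n" using ab(4,5) ij by auto
      ultimately show "z \<in> ?R" using digit[OF ij(1,2)] ab(6) ij(3) by blast
    qed
    show "?R \<subseteq> ?L"
    proof
      fix z assume "z \<in> ?R"
      then obtain c d where z: "z = (real c / 3 ^ Suc n, real d / 3 ^ Suc n, 1 / 3 ^ Suc n)"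
        and cd: "c < 3 ^ Suc n" "d < 3 ^ Suc n" "ones c \<inter> ones d = {}" by blast
      define a b i j where "a = c div 3" and "b = d div 3" and "i = c mod 3" and "j = d mod 3"
      have c: "c = 3 * a + i" and d: "d = 3 * b + j" and ij: "i < 3" "j < 3"
        by (auto simp: a_def b_def i_def j_def)
      have ab: "a < 3 ^ n" "b < 3 ^ n" using cd(1,2) by (auto simp: a_def b_def)
      have *: "ones a \<inter> ones b = {}" "(i, j) \<noteq> (1, 1)" using cd(3) digit[OF ij] unfolding c d by auto
      have "z = (real a / 3 ^ n + real i * (1 / 3 ^ n) / 3, real b / 3 ^ n + real j * (1 / 3 ^ n) / 3, (1 / 3 ^ n) / 3)"
        unfolding z c d by (simp add: field_simps)
      moreover have "(real a / 3 ^ n, real b / 3 ^ n, 1 / 3 ^ n) \<in> carpet_level n"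
        unfolding Suc.IH using ab * by blast
      ultimately show "z \<in> ?L" unfolding carpet_level.simps using ij *(2) by blast
    qed
  qed
qed

lemma sierpinski_iff: "(x, y) \<in> sierpinski_carpet \<longleftrightarrow> (\<forall>n. square_meets n x y)"
proof -
  have sq: "(x, y) \<in> closed_square (real a / 3 ^ n, real b / 3 ^ n, 1 / 3 ^ n) \<longleftrightarrow>
      real a \<le> x * 3 ^ n \<and> x * 3 ^ n \<le> real a + 1 \<and> real b \<le> y * 3 ^ n \<and> y * 3 ^ n \<le> real b + 1" for a b n
    unfolding closed_square_def
    by (simp add: pos_divide_le_eq pos_le_divide_eq add_divide_distrib[symmetric])
  have "(x, y) \<in> (\<Union>q\<in>carpet_level n. closed_square q) \<longleftrightarrow> square_meets n x y" for n
    unfolding square_meets_def sq[symmetric] carpet_level_eq by blast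
  then show ?thesis by (auto simp: sierpinski_carpet_def)
qed

context carpet_coordinates
begin

text \<open>The pairwise conditions may use different cells when a coordinate is a ternary fraction; the
  index with fewer digits 1 serves all pairs at once.\<close>
lemma carpet_pairwise:
  assumes two: "\<And>i::'i. \<exists>j. j \<noteq> i"
  shows "x \<in> carpet \<longleftrightarrow> (\<forall>n i j. i \<noteq> j \<longrightarrow> square_meets n (crd x i) (crd x j))"
proof
  assume x: "x \<in> carpet"
  show "\<forall>n i j. i \<noteq> j \<longrightarrow> square_meets n (crd x i) (crd x j)"
  proof (intro allI impI)
    fix n and i j :: 'i assume "i \<noteq> j"
    obtain v where "v \<in> cells n" "x \<in> cube n v" using x by (auto simp: carpet_def)
    then show "square_meets n (crd x i) (crd x j)"
      using \<open>i \<noteq> j\<close> unfolding square_meets_def cube_iff cells_def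
      by (intro exI[of _ "v i"] exI[of _ "v j"]) auto
  qed
next
  assume pw: "\<forall>n i j. i \<noteq> j \<longrightarrow> square_meets n (crd x i) (crd x j)"
  have "\<exists>v\<in>cells n. x \<in> cube n v" for n
  proof -
    define P where "P i u \<longleftrightarrow> u < 3 ^ n \<and> real u \<le> crd x i * 3 ^ n \<and> crd x i * 3 ^ n \<le> real u + 1" for i u
    have "\<exists>u. P i u \<and> (\<forall>w. P i w \<longrightarrow> ones u \<subseteq> ones w)" for i
    proof -
      obtain j where "j \<noteq> i" using two by blast
      then have "square_meets n (crd x i) (crd x j)" by (intro pw[rule_format]) simp
      then obtain u0 where u0: "P i u0" unfolding square_meets_def P_def by blast
      have touch: "u \<le> w + 1" if "P i u" "P i w" for u w
      proof -
        have "real u \<le> real w + 1" using that unfolding P_def by linarith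
        then show ?thesis by linarith
      qed
      show ?thesis
      proof (cases "\<forall>w. P i w \<longrightarrow> ones u0 \<subseteq> ones w")
        case False
        then obtain u1 where u1: "P i u1" "\<not> ones u0 \<subseteq> ones u1" by blast
        then have "ones u1 \<subseteq> ones u0" using ones_nested[of u0 u1] touch u0 by blast
        moreover have "w = u0 \<or> w = u1" if "P i w" for w
        proof -
          have "u0 \<noteq> u1" using u1(2) by blast
          then show ?thesis
            using touch[OF that u0] touch[OF u0 that] touch[OF that u1(1)] touch[OF u1(1) that]
              touch[OF u0 u1(1)] touch[OF u1(1) u0] by linarith
        qed
        ultimately show ?thesis using u1(1) by blast
      qed (use u0 in blast)
    qed
    then obtain v where v: "\<And>i. P i (v i)" "\<And>i w. P i w \<Longrightarrow> ones (v i) \<subseteq> ones w" by metis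
    have "ones (v i) \<inter> ones (v j) = {}" if "i \<noteq> j" for i j
    proof -
      have "square_meets n (crd x i) (crd x j)" using that by (intro pw[rule_format])
      then obtain a b where "P i a" "P j b" "ones a \<inter> ones b = {}" unfolding square_meets_def P_def by blast
      then show ?thesis using v(2) by blast
    qed
    then have "v \<in> cells n" using v(1) by (simp add: cells_def P_def)
    moreover have "x \<in> cube n v" using v(1) by (simp add: cube_iff P_def)
    ultimately show ?thesis by blast
  qed
  then show "x \<in> carpet" by (simp add: carpet_def)
qed

end

definition plane_axis :: "bool \<Rightarrow> real \<times> real" where
  "plane_axis i = (if i then (1, 0) else (0, 1))"

definition space_axis :: "bool option \<Rightarrow> real \<times> real \<times> real" where
  "space_axis i = (case i of None \<Rightarrow> (1, 0, 0) | Some False \<Rightarrow> (0, 1, 0) | Some True \<Rightarrow> (0, 0, 1))"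

interpretation plane: carpet_coordinates plane_axis
proof
  show "bij_betw plane_axis UNIV Basis"
    unfolding bij_betw_def
  proof
    show "inj plane_axis" by (rule injI) (auto simp: plane_axis_def split: if_splits)
    show "range plane_axis = Basis" by (auto simp: plane_axis_def Basis_prod_def UNIV_bool)
  qed
qed

interpretation space: carpet_coordinates space_axis
proof
  show "bij_betw space_axis UNIV Basis"
    unfolding bij_betw_def
  proof
    show "inj space_axis" by (rule injI) (auto simp: space_axis_def split: option.splits bool.splits)
    show "range space_axis = Basis" by (auto simp: space_axis_def Basis_prod_def UNIV_option_conv UNIV_bool zero_prod_def)
  qed
qed

lemma plane_carpet: "plane.carpet = sierpinski_carpet"
proof -
  have "p \<in> plane.carpet \<longleftrightarrow> p \<in> sierpinski_carpet" for p
  proof (cases p)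
    case (Pair x y)
    have two: "\<exists>j. j \<noteq> i" for i :: bool by blast
    have "plane.crd p True = x" "plane.crd p False = y"
      by (simp_all add: plane.crd_def plane_axis_def Pair)
    then show ?thesis
      unfolding plane.carpet_pairwise[OF two] Pair sierpinski_iff
      using square_meets_sym by (auto simp: all_bool_eq)
  qed
  then show ?thesis by blast
qed

lemma space_carpet: "space.carpet = menger_sponge"
proof -
  have "p \<in> space.carpet \<longleftrightarrow> p \<in> menger_sponge" for p
  proof (cases p)
    case (fields x y z)
    have two: "\<exists>j. j \<noteq> i" for i :: "bool option" by (cases i) auto
    have crd: "space.crd p None = x" "space.crd p (Some False) = y" "space.crd p (Some True) = z"
      by (simp_all add: space.crd_def space_axis_def fields)
    have all: "(\<forall>i. Q i) \<longleftrightarrow> Q None \<and> Q (Some False) \<and> Q (Some True)" for Q :: "bool option \<Rightarrow> bool"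
      by (metis (full_types) option.exhaust)
    have "p \<in> space.carpet \<longleftrightarrow> (\<forall>n. square_meets n x y \<and> square_meets n x z \<and> square_meets n y z)"
      unfolding space.carpet_pairwise[OF two] all crd using square_meets_sym by (auto simp: crd)
    also have "\<dots> \<longleftrightarrow> p \<in> menger_sponge"
      by (auto simp: menger_sponge_def forget1_def forget2_def forget3_def fields sierpinski_iff)
    finally show ?thesis .
  qed
  then show ?thesis by blast
qed

theorem mainTheorem2:
  shows "CLP sierpinski_carpet \<and> CLP menger_sponge"
proof
  show "CLP sierpinski_carpet"
    using plane.CLP_carpet[of True False] by (simp add: plane_carpet)
  show "CLP menger_sponge"
    using space.CLP_carpet[of None "Some True"] by (simp add: space_carpet)
qed

end
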